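(* Let $\{W_n\}_{n=1}^{\infty}$ be a sequence of orderons. Then $\{W_n\}$ is Cauchy in $d_\triangle$ if and only if, for every fixed simple ordered graph $F$, the sequence $t(F,W_n)$ converges as $n\to\infty$.
   Context: An orderon is a (Lebesgue) measurable function $W:([0,1]^2)^2\to[0,1]$ with $W(u,v)=W(v,u)$ for all $u,v\in[0,1]^2$; $\mathcal{W}$ is the set of all orderons. A measure-preserving bijection of $[0,1]^2$ is a bijection $f:[0,1]^2\to[0,1]^2$ such that both $f$ and $f^{-1}$ are measure preserving for Lebesgue measure; $\mathcal{F}$ is the set of all of them. For $f\in\mathcal{F}$, $W^f(u,v)=W(f(u),f(v))$, and $\mathrm{Shift}(f)=\sup_{(x,a)\in[0,1]^2}|x-\pi_1(f(x,a))|$, where $\pi_1(y,b)=y$. The cut-norm of a symmetric measurable $V:([0,1]^2)^2\to\mathbb{R}$ is $\|V\|_\square=\sup_{S,T\subseteq[0,1]^2}\left|\int_{S\times T}V(u,v)\,du\,dv\right|$ over measurable $S,T$. The cut-shift distance is the pseudo-metric $d_\triangle(W,U)=\inf_{f\in\mathcal{F}}\left(\mathrm{Shift}(f)+\|W-U^f\|_\square\right)$ on $\mathcal{W}$. A simple ordered graph on $k$ vertices is a graph $F=([k],E)$ without loops on the linearly ordered vertex set $[k]=\{1,\dots,k\}$; two ordered graphs are identified only when they are equal. For an orderon $W$, the (induced) density of $F$ in $W$ is $$t(F,W)=k!\int_{v\in([0,1]^2)^k,\ \pi_1(v_1)\le\cdots\le\pi_1(v_k)}\ \prod_{i<j,\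 ij\in E}W(v_i,v_j)\prod_{i<j,\ ij\notin E}(1-W(v_i,v_j))\,dv .$$ Equivalently, it is the probability that the following random graph equals $F$: pick $k$ independent uniform points of $[0,1]^2$, order them by first coordinate, and join $i<j$ with probability $W$ of the corresponding pair of points, independently. *)

theory Defs
  imports "HOL-Analysis.Analysis"
begin

type_synonym point = "real \<times> real"

definition unit_square :: "point set" where
  "unit_square = {0..1} \<times> {0..1}"

text \<open>Functions are total in HOL; all notions below depend only on the values on the unit square
  (respectively its square). Measurability is with respect to the completed (Lebesgue)
  sigma-algebra throughout.\<close>

definition orderon :: "(point \<times> point \<Rightarrow> real) \<Rightarrow> bool" where
  "orderon W \<longleftrightarrow>
     W \<in> borel_measurable (lebesgue_on (unit_square \<times> unit_square)) \<and>
     (\<forall>u\<in>unit_square. \<forall>v\<in>unit_square. W (u, v) \<in> {0..1} \<and> W (u, v) = W (v, u))"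

definition measure_preserving :: "'a measure \<Rightarrow> 'b measure \<Rightarrow> ('a \<Rightarrow> 'b) \<Rightarrow> bool" where
  "measure_preserving M N f \<longleftrightarrow>
     f \<in> measurable M N \<and> (\<forall>A\<in>sets N. emeasure M (f -` A \<inter> space M) = emeasure N A)"

definition mp_bijections :: "(point \<Rightarrow> point) set" where
  "mp_bijections = {f. bij_betw f unit_square unit_square \<and>
     measure_preserving (lebesgue_on unit_square) (lebesgue_on unit_square) f \<and>
     measure_preserving (lebesgue_on unit_square) (lebesgue_on unit_square)
       (inv_into unit_square f)}"

definition pull :: "(point \<times> point \<Rightarrow> real) \<Rightarrow> (point \<Rightarrow> point) \<Rightarrow> point \<times> point \<Rightarrow> real" where
  "pull W f = (\<lambda>(u, v). W (f u, f v))"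

definition Shift :: "(point \<Rightarrow> point) \<Rightarrow> real" where
  "Shift f = (SUP p\<in>unit_square. \<bar>fst p - fst (f p)\<bar>)"

text \<open>The supremum is taken in the reals, hence meaningful only when it is finite; this is the case
  for the bounded measurable kernels to which it is applied.\<close>

definition cut_norm :: "(point \<times> point \<Rightarrow> real) \<Rightarrow> real" where
  "cut_norm V =
     (SUP (S, T)\<in>sets (lebesgue_on unit_square) \<times> sets (lebesgue_on unit_square).
        \<bar>LINT p:S \<times> T|lebesgue. V p\<bar>)"

definition cut_shift_dist ::
    "(point \<times> point \<Rightarrow> real) \<Rightarrow> (point \<times> point \<Rightarrow> real) \<Rightarrow> real" where
  "cut_shift_dist W U =
     (INF f\<in>mp_bijections. Shift f + cut_norm (\<lambda>p. W p - pull U f p))"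

text \<open>An ordered graph is the pair of its number of vertices \<open>k\<close> and its set of edges, the latter
  being two-element subsets of \<open>{1..k}\<close>.\<close>

type_synonym ordered_graph = "nat \<times> nat set set"

definition simple_ordered_graph :: "ordered_graph \<Rightarrow> bool" where
  "simple_ordered_graph F \<longleftrightarrow> (case F of (k, E) \<Rightarrow> \<forall>e\<in>E. e \<subseteq> {1..k} \<and> card e = 2)"

text \<open>The product measure has to be completed: for a merely Lebesgue measurable \<open>W\<close> the integrand
  need not be measurable with respect to the product sigma-algebra.\<close>

definition graph_density :: "ordered_graph \<Rightarrow> (point \<times> point \<Rightarrow> real) \<Rightarrow> real" where
  "graph_density F W = (case F of (k, E) \<Rightarrow>
     fact k *
     (LINT v : {v \<in> {1..k} \<rightarrow>\<^sub>E unit_square.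
                 \<forall>i\<in>{1..k}. \<forall>j\<in>{1..k}. i \<le> j \<longrightarrow> fst (v i) \<le> fst (v j)}
             | completion (Pi\<^sub>M {1..k} (\<lambda>_. lborel)).
        (\<Prod>(i, j)\<in>{(i, j). i \<in> {1..k} \<and> j \<in> {1..k} \<and> i < j \<and> {i, j} \<in> E}. W (v i, v j)) *
        (\<Prod>(i, j)\<in>{(i, j). i \<in> {1..k} \<and> j \<in> {1..k} \<and> i < j \<and> {i, j} \<notin> E}. 1 - W (v i, v j))))"

end

theory Submission
  imports Defs "HOL-Probability.Probability" "HOL-Combinatorics.Permutations"
begin

text \<open>Densities are continuous. Write the order constraint as a product of order kernels over all pairs of
  vertices, so that a density is an integral of a product of one kernel per pair. Exchanging the kernels
  one pair at a time, each exchange costs at most the cut-norm of the difference of two kernels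
  (\<open>counting\<close>). The order kernel is almost a sum of few products of indicators of strips, so multiplying
  by it does not increase the cut-norm too much (\<open>kcut_order\<close>), and a bijection with a small shift
  changes the order of few pairs of points only. This gives \<open>density_continuity\<close> and hence one
  direction.

  Conversely, a random graph on \<open>k\<close> points sampled from an orderon determines the orderon up to a
  small cut-shift distance, with a quality that depends on \<open>k\<close> alone. If two orderons have almost the
  same densities of all graphs on \<open>k\<close> vertices, the distributions of their samples almost coincide, so
  some graph is a good model of both, and the two orderons are close to each other.

  This is carried out on finite grids. In the mean, an orderon is close to a function of the cells of
  a fine square grid (\<open>ex_grid_approximation\<close>), its densities are then close to finite sums, and
  permutations of the cells by translations are measure preserving bijections; no other
  bijections have to be constructed. On a grid, weak regularity (\<open>weak_regularity\<close>) provides a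
  bounded number of types of cells, refining a division into vertical strips, such that the error of
  the type-wise constant approximation has a small count of four-cycles. The expected
  four-cycle count of the error of a random sample is the count on the whole grid up to
  \<open>O(1 / k)\<close>, because the four edges of a nondegenerate cycle are independent, and the number of sample
  points of each type concentrates by a variance estimate. When both statistics are as expected, most
  cells can be matched to sample points of the same type within the same strip
  (\<open>typical_models\<close>), and since four-cycle counts dominate the cut-norm, the sampled graph is a model of
  the grid in which no cell moves far. The number of cells in the grid, unlike the number of
  types and of sample points, may depend on the orderon.\<close>

section \<open>The cycle count and the cut-norm\<close>

text \<open>Up to normalisation this is the fourth power of the box norm. It dominates the cut-norm, and being
  a polynomial in the entries it has a computable expectation over random samples. This is why errors
  are measured by it instead of by the cut-norm, whose behaviour under sampling is much harder to control.\<close>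

definition cycle4 :: "'a set \<Rightarrow> ('a \<Rightarrow> 'a \<Rightarrow> real) \<Rightarrow> real" where
  "cycle4 A D = (\<Sum>i\<in>A. \<Sum>i'\<in>A. \<Sum>j\<in>A. \<Sum>j'\<in>A. D i j * D i j' * D i' j * D i' j')"

lemma cycle4_as_square: "cycle4 A D = (\<Sum>j\<in>A. \<Sum>j'\<in>A. (\<Sum>i\<in>A. D i j * D i j')\<^sup>2)"
proof -
  have "cycle4 A D = (\<Sum>i\<in>A. \<Sum>j\<in>A. \<Sum>i'\<in>A. \<Sum>j'\<in>A. D i j * D i j' * D i' j * D i' j')"
    unfolding cycle4_def by (intro sum.cong refl sum.swap)
  also have "\<dots> = (\<Sum>j\<in>A. \<Sum>i\<in>A. \<Sum>i'\<in>A. \<Sum>j'\<in>A. D i j * D i j' * D i' j * D i' j')"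
    by (rule sum.swap)
  also have "\<dots> = (\<Sum>j\<in>A. \<Sum>i\<in>A. \<Sum>j'\<in>A. \<Sum>i'\<in>A. D i j * D i j' * D i' j * D i' j')"
    by (intro sum.cong refl sum.swap)
  also have "\<dots> = (\<Sum>j\<in>A. \<Sum>j'\<in>A. \<Sum>i\<in>A. \<Sum>i'\<in>A. D i j * D i j' * D i' j * D i' j')"
    by (intro sum.cong refl sum.swap)
  also have "\<dots> = (\<Sum>j\<in>A. \<Sum>j'\<in>A. (\<Sum>i\<in>A. D i j * D i j')\<^sup>2)"
    by (simp add: power2_eq_square sum_product mult_ac)
  finally show ?thesis .
qed

lemma cycle4_nonneg: "0 \<le> cycle4 A D"
  unfolding cycle4_as_square by (intro sum_nonneg) auto

lemma sum_le_card_mult_sum_squares: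
  fixes a r :: "'a \<Rightarrow> real"
  assumes "\<And>i. i \<in> A \<Longrightarrow> \<bar>a i\<bar> \<le> 1"
  shows "(\<Sum>i\<in>A. a i * r i)\<^sup>2 \<le> card A * (\<Sum>i\<in>A. (r i)\<^sup>2)"
proof -
  have "(\<Sum>i\<in>A. a i * r i)\<^sup>2 \<le> (\<Sum>i\<in>A. (a i)\<^sup>2) * (\<Sum>i\<in>A. (r i)\<^sup>2)"
    by (rule Cauchy_Schwarz_ineq_sum)
  also have "(\<Sum>i\<in>A. (a i)\<^sup>2) \<le> (\<Sum>i\<in>A. 1)"
    using assms by (intro sum_mono) (simp add: abs_square_le_1)
  then have "(\<Sum>i\<in>A. (a i)\<^sup>2) * (\<Sum>i\<in>A. (r i)\<^sup>2) \<le> card A * (\<Sum>i\<in>A. (r i)\<^sup>2)"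
    by (intro mult_right_mono) (auto intro: sum_nonneg)
  finally show ?thesis .
qed

text \<open>Two applications of the Cauchy--Schwarz inequality, one for each of the test functions.\<close>

lemma bilinear_power4_le_cycle4:
  fixes a b :: "'a \<Rightarrow> real"
  assumes fin: "finite A" and a: "\<And>i. i \<in> A \<Longrightarrow> \<bar>a i\<bar> \<le> 1" and b: "\<And>i. i \<in> A \<Longrightarrow> \<bar>b i\<bar> \<le> 1"
  shows "(\<Sum>i\<in>A. \<Sum>j\<in>A. a i * b j * D i j) ^ 4 \<le> real (card A) ^ 4 * cycle4 A D"
proof -
  define n where "n = real (card A)"
  define r where "r i = (\<Sum>j\<in>A. b j * D i j)" for i
  define c where "c p = (\<Sum>i\<in>A. D i (fst p) * D i (snd p))" for p
  have S: "(\<Sum>i\<in>A. \<Sum>j\<in>A. a i * b j * D i j) = (\<Sum>i\<in>A. a i * r i)"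
    unfolding r_def by (simp add: sum_distrib_left mult_ac)
  have 1: "(\<Sum>i\<in>A. a i * r i)\<^sup>2 \<le> n * (\<Sum>i\<in>A. (r i)\<^sup>2)"
    unfolding n_def using a by (rule sum_le_card_mult_sum_squares)
  have "(\<Sum>i\<in>A. (r i)\<^sup>2) = (\<Sum>i\<in>A. \<Sum>j\<in>A. \<Sum>j'\<in>A. b j * b j' * (D i j * D i j'))"
    unfolding r_def by (simp add: power2_eq_square sum_product mult_ac)
  also have "\<dots> = (\<Sum>j\<in>A. \<Sum>i\<in>A. \<Sum>j'\<in>A. b j * b j' * (D i j * D i j'))"
    by (rule sum.swap)
  also have "\<dots> = (\<Sum>j\<in>A. \<Sum>j'\<in>A. \<Sum>i\<in>A. b j * b j' * (D i j * D i j'))"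
    by (intro sum.cong refl sum.swap)
  also have "\<dots> = (\<Sum>p\<in>A \<times> A. (b (fst p) * b (snd p)) * c p)"
    unfolding c_def by (simp add: sum.cartesian_product' sum_distrib_left)
  finally have R: "(\<Sum>i\<in>A. (r i)\<^sup>2) = (\<Sum>p\<in>A \<times> A. (b (fst p) * b (snd p)) * c p)" .
  have "(\<Sum>i\<in>A. (r i)\<^sup>2)\<^sup>2 \<le> card (A \<times> A) * (\<Sum>p\<in>A \<times> A. (c p)\<^sup>2)"
    unfolding R using b by (intro sum_le_card_mult_sum_squares) (auto simp: abs_mult intro!: mult_le_one)
  also have "(\<Sum>p\<in>A \<times> A. (c p)\<^sup>2) = cycle4 A D"
    unfolding cycle4_as_square c_def sum.cartesian_product by (simp add: case_prod_unfold)
  finally have 2: "(\<Sum>i\<in>A. (r i)\<^sup>2)\<^sup>2 \<le> n\<^sup>2 * cycle4 A D"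
    unfolding n_def by (simp add: card_cartesian_product power2_eq_square)
  have "((\<Sum>i\<in>A. a i * r i)\<^sup>2)\<^sup>2 \<le> (n * (\<Sum>i\<in>A. (r i)\<^sup>2))\<^sup>2"
    using 1 by (intro power_mono) auto
  also have "\<dots> \<le> n\<^sup>2 * (n\<^sup>2 * cycle4 A D)"
    unfolding power_mult_distrib using 2 by (intro mult_left_mono) auto
  finally have "((\<Sum>i\<in>A. a i * r i)\<^sup>2)\<^sup>2 \<le> (n\<^sup>2 * n\<^sup>2) * cycle4 A D" by (simp only: mult.assoc)
  then show ?thesis unfolding S n_def by (simp flip: power_mult power_add)
qed

lemma sum_abs_le_two_subset_sums:
  fixes h :: "'a \<Rightarrow> real"
  assumes fin: "finite A" and sub: "\<And>S. S \<subseteq> A \<Longrightarrow> \<bar>sum h S\<bar> \<le> d"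
  shows "(\<Sum>i\<in>A. \<bar>h i\<bar>) \<le> 2 * d"
proof -
  let ?P = "{i\<in>A. 0 \<le> h i}" and ?N = "{i\<in>A. h i < 0}"
  have "(\<Sum>i\<in>A. \<bar>h i\<bar>) = (\<Sum>i\<in>?P \<union> ?N. \<bar>h i\<bar>)" by (rule sum.cong) auto
  also have "\<dots> = (\<Sum>i\<in>?P. \<bar>h i\<bar>) + (\<Sum>i\<in>?N. \<bar>h i\<bar>)"
    using fin by (intro sum.union_disjoint) auto
  also have "\<dots> = sum h ?P - sum h ?N" by (simp add: sum_negf)
  finally show ?thesis using sub[of ?P] sub[of ?N] by fastforce
qed

text \<open>For fixed \<open>b\<close> the form is largest when \<open>a\<close> is the sign of the row sums, that is, a difference of two
  indicators; the same holds with the roles exchanged.\<close>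

lemma bilinear_le_four_rectangles:
  fixes a b :: "'a \<Rightarrow> real"
  assumes fin: "finite A" and a: "\<And>i. i \<in> A \<Longrightarrow> \<bar>a i\<bar> \<le> 1" and b: "\<And>i. i \<in> A \<Longrightarrow> \<bar>b i\<bar> \<le> 1"
    and rect: "\<And>S T. S \<subseteq> A \<Longrightarrow> T \<subseteq> A \<Longrightarrow> \<bar>\<Sum>i\<in>S. \<Sum>j\<in>T. D i j\<bar> \<le> d"
  shows "\<bar>\<Sum>i\<in>A. \<Sum>j\<in>A. a i * b j * D i j\<bar> \<le> 4 * d"
proof -
  have row: "\<bar>\<Sum>j\<in>T. \<Sum>i\<in>A. a i * D i j\<bar> \<le> 2 * d" if T: "T \<subseteq> A" for T
  proof -
    have "\<bar>\<Sum>j\<in>T. \<Sum>i\<in>A. a i * D i j\<bar> = \<bar>\<Sum>i\<in>A. a i * (\<Sum>j\<in>T. D i j)\<bar>"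
      by (subst sum.swap) (simp add: sum_distrib_left)
    also have "\<dots> \<le> (\<Sum>i\<in>A. \<bar>\<Sum>j\<in>T. D i j\<bar>)"
      using a by (intro order_trans[OF sum_abs] sum_mono) (auto simp: abs_mult intro!: mult_left_le_one_le)
    also have "\<dots> \<le> 2 * d" using rect T by (intro sum_abs_le_two_subset_sums fin)
    finally show ?thesis .
  qed
  have "\<bar>\<Sum>i\<in>A. \<Sum>j\<in>A. a i * b j * D i j\<bar> = \<bar>\<Sum>j\<in>A. b j * (\<Sum>i\<in>A. a i * D i j)\<bar>"
    by (subst sum.swap) (simp add: sum_distrib_left mult_ac)
  also have "\<dots> \<le> (\<Sum>j\<in>A. \<bar>\<Sum>i\<in>A. a i * D i j\<bar>)"
    using b by (intro order_trans[OF sum_abs] sum_mono) (auto simp: abs_mult intro!: mult_left_le_one_le)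
  also have "\<dots> \<le> 2 * (2 * d)" using row by (intro sum_abs_le_two_subset_sums fin)
  finally show ?thesis by simp
qed

text \<open>With the vertices \<open>i'\<close> and \<open>j'\<close> of the cycle fixed, the other three factors form a bilinear form in
  \<open>D\<close> whose test functions are a row and a column of \<open>D\<close>. One of these forms is large on average.\<close>

lemma large_cycle4_imp_large_rectangle:
  fixes \<epsilon> :: real
  assumes fin: "finite A" and D: "\<And>i j. i \<in> A \<Longrightarrow> j \<in> A \<Longrightarrow> \<bar>D i j\<bar> \<le> 1"
    and large: "cycle4 A D > \<epsilon> * real (card A) ^ 4"
  obtains S T where "S \<subseteq> A" "T \<subseteq> A" "\<bar>\<Sum>i\<in>S. \<Sum>j\<in>T. D i j\<bar> > \<epsilon> / 4 * real (card A) ^ 2"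
proof (rule ccontr)
  let ?n = "real (card A)"
  assume no: "\<not> thesis"
  note ex = that
  have rect: "\<bar>\<Sum>i\<in>S. \<Sum>j\<in>T. D i j\<bar> \<le> \<epsilon> / 4 * ?n ^ 2" if "S \<subseteq> A" "T \<subseteq> A" for S T
    using ex[OF that] no by force
  have "cycle4 A D = (\<Sum>i\<in>A. \<Sum>i'\<in>A. \<Sum>j'\<in>A. \<Sum>j\<in>A. D i j * D i j' * D i' j * D i' j')"
    unfolding cycle4_def by (intro sum.cong refl sum.swap)
  also have "\<dots> = (\<Sum>i'\<in>A. \<Sum>i\<in>A. \<Sum>j'\<in>A. \<Sum>j\<in>A. D i j * D i j' * D i' j * D i' j')"
    by (rule sum.swap)
  also have "\<dots> = (\<Sum>i'\<in>A. \<Sum>j'\<in>A. \<Sum>i\<in>A. \<Sum>j\<in>A. D i j * D i j' * D i' j * D i' j')"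
    by (intro sum.cong refl sum.swap)
  also have "\<dots> = (\<Sum>i'\<in>A. \<Sum>j'\<in>A. D i' j' * (\<Sum>i\<in>A. \<Sum>j\<in>A. D i j' * D i' j * D i j))"
    by (simp add: sum_distrib_left mult_ac)
  also have "\<dots> \<le> (\<Sum>i'\<in>A. \<Sum>j'\<in>A. \<epsilon> * ?n ^ 2)"
  proof (intro sum_mono)
    fix i' j' assume m: "i' \<in> A" "j' \<in> A"
    have "\<bar>\<Sum>i\<in>A. \<Sum>j\<in>A. D i j' * D i' j * D i j\<bar> \<le> 4 * (\<epsilon> / 4 * ?n ^ 2)"
      using D m by (intro bilinear_le_four_rectangles fin rect) auto
    then have "\<bar>D i' j' * (\<Sum>i\<in>A. \<Sum>j\<in>A. D i j' * D i' j * D i j)\<bar> \<le> 4 * (\<epsilon> / 4 * ?n ^ 2)"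
      using D[OF m] unfolding abs_mult
      by (meson abs_ge_zero mult_left_le_one_le order_trans)
    then show "D i' j' * (\<Sum>i\<in>A. \<Sum>j\<in>A. D i j' * D i' j * D i j) \<le> \<epsilon> * ?n ^ 2" by linarith
  qed
  also have "\<dots> = \<epsilon> * ?n ^ 4" by (simp add: power4_eq_xxxx power2_eq_square)
  finally show False using large by simp
qed

section \<open>Weak regularity\<close>

lemma clip_dist_le:
  fixes x w :: real
  assumes "0 \<le> w" "w \<le> 1"
  shows "(w - max 0 (min 1 x))\<^sup>2 \<le> (w - x)\<^sup>2"
proof -
  have "\<bar>w - max 0 (min 1 x)\<bar> \<le> \<bar>w - x\<bar>" using assms by linarith
  then show ?thesis by (simp add: abs_le_square_iff)
qed

text \<open>A rectangle that correlates with the error is subtracted with the coefficient \<open>\<epsilon> / 4\<close>, which is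
  optimal up to a factor; clipping to the unit interval only decreases the error further, because the
  values of \<open>w\<close> lie there. The new label encodes the old one and the membership in both sides of the
  rectangle.\<close>

lemma energy_decrement:
  fixes w :: "'a \<Rightarrow> 'a \<Rightarrow> real" and B :: "nat \<Rightarrow> nat \<Rightarrow> real" and c :: "'a \<Rightarrow> nat"
    and \<epsilon> :: real
  assumes fin: "finite A" and w: "\<And>u v. u \<in> A \<Longrightarrow> v \<in> A \<Longrightarrow> 0 \<le> w u v \<and> w u v \<le> 1"
    and c: "\<And>u. u \<in> A \<Longrightarrow> c u < m" and B: "\<And>k l. 0 \<le> B k l \<and> B k l \<le> 1"
    and e: "\<epsilon> > 0" and large: "cycle4 A (\<lambda>u v. w u v - B (c u) (c v)) > \<epsilon> * real (card A) ^ 4"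
  obtains c' :: "'a \<Rightarrow> nat" and B' :: "nat \<Rightarrow> nat \<Rightarrow> real" where "\<And>u. u \<in> A \<Longrightarrow> c' u < 4 * m" "\<And>u. c u = c' u div 4"
    "\<And>k l. 0 \<le> B' k l \<and> B' k l \<le> (1::real)"
    "(\<Sum>u\<in>A. \<Sum>v\<in>A. (w u v - B' (c' u) (c' v))\<^sup>2) \<le>
      (\<Sum>u\<in>A. \<Sum>v\<in>A. (w u v - B (c u) (c v))\<^sup>2) - (\<epsilon> / 4)\<^sup>2 * real (card A) ^ 2"
proof -
  let ?n = "real (card A)"
  define D where "D u v = w u v - B (c u) (c v)" for u v
  have D1: "\<bar>D u v\<bar> \<le> 1" if "u \<in> A" "v \<in> A" for u v
    using w[OF that] B[of "c u" "c v"] unfolding D_def by linarith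
  obtain S T where ST: "S \<subseteq> A" "T \<subseteq> A" and big: "\<bar>\<Sum>i\<in>S. \<Sum>j\<in>T. D i j\<bar> > \<epsilon> / 4 * ?n ^ 2"
  proof (rule large_cycle4_imp_large_rectangle[OF fin, of D \<epsilon>])
    show "cycle4 A D > \<epsilon> * real (card A) ^ 4" using large unfolding D_def .
  qed (use D1 in auto)
  define t where "t = \<epsilon> / 4 * sgn (\<Sum>i\<in>S. \<Sum>j\<in>T. D i j)"
  define I where "I u v = (if u \<in> S \<and> v \<in> T then 1 else 0 :: real)" for u v
  define c' where "c' u = 4 * c u + 2 * of_bool (u \<in> S) + of_bool (u \<in> T)" for u
  define B' where "B' k l = max 0 (min 1 (B (k div 4) (l div 4) + t * of_bool (k mod 4 \<ge> 2 \<and> odd l)))"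
    for k l :: nat
  have dv: "c' u div 4 = c u" and md: "c' u mod 4 \<ge> 2 \<longleftrightarrow> u \<in> S" and od: "odd (c' u) \<longleftrightarrow> u \<in> T" for u
    unfolding c'_def by (cases "u \<in> S"; cases "u \<in> T"; simp; presburger)+
  have B'c': "B' (c' u) (c' v) = max 0 (min 1 (B (c u) (c v) + t * I u v))" for u v
    unfolding B'_def I_def dv md od by auto
  have rect: "(\<Sum>u\<in>A. \<Sum>v\<in>A. f u v * I u v) = (\<Sum>u\<in>S. \<Sum>v\<in>T. f u v)" for f :: "'a \<Rightarrow> 'a \<Rightarrow> real"
  proof -
    have "(\<Sum>u\<in>A. \<Sum>v\<in>A. f u v * I u v) = (\<Sum>u\<in>A. if u \<in> S then (\<Sum>v\<in>A. if v \<in> T then f u v else 0) else 0)"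
      unfolding I_def by (auto intro!: sum.cong)
    also have "\<dots> = (\<Sum>u\<in>S. \<Sum>v\<in>T. f u v)"
      using ST fin by (simp add: sum.inter_restrict[symmetric] Int_absorb1)
    finally show ?thesis .
  qed
  have I2: "(I u v)\<^sup>2 = I u v" for u v unfolding I_def by simp
  have "(\<Sum>u\<in>A. \<Sum>v\<in>A. (w u v - B' (c' u) (c' v))\<^sup>2) \<le> (\<Sum>u\<in>A. \<Sum>v\<in>A. (D u v - t * I u v)\<^sup>2)"
    unfolding B'c' D_def using w
    by (intro sum_mono) (metis (no_types, lifting) clip_dist_le diff_diff_eq)
  also have "\<dots> = (\<Sum>u\<in>A. \<Sum>v\<in>A. (D u v)\<^sup>2 - 2 * t * (D u v * I u v) + t\<^sup>2 * (1 * I u v))"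
    by (simp add: power2_diff power_mult_distrib I2 algebra_simps)
  also have "\<dots> = (\<Sum>u\<in>A. \<Sum>v\<in>A. (D u v)\<^sup>2) - 2 * t * (\<Sum>u\<in>S. \<Sum>v\<in>T. D u v) + t\<^sup>2 * (\<Sum>u\<in>S. \<Sum>v\<in>T. 1)"
    unfolding rect[symmetric] by (simp add: sum.distrib sum_subtractf sum_distrib_left)
  also have "\<dots> \<le> (\<Sum>u\<in>A. \<Sum>v\<in>A. (D u v)\<^sup>2) - 2 * (\<epsilon> / 4)\<^sup>2 * ?n ^ 2 + (\<epsilon> / 4)\<^sup>2 * ?n ^ 2"
  proof -
    have "t * (\<Sum>u\<in>S. \<Sum>v\<in>T. D u v) = \<epsilon> / 4 * \<bar>\<Sum>u\<in>S. \<Sum>v\<in>T. D u v\<bar>"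
      unfolding t_def by (simp add: abs_sgn mult_ac)
    also have "\<dots> \<ge> \<epsilon> / 4 * (\<epsilon> / 4 * ?n ^ 2)" using big e by (intro mult_left_mono) auto
    finally have "t * (\<Sum>u\<in>S. \<Sum>v\<in>T. D u v) \<ge> (\<epsilon> / 4)\<^sup>2 * ?n ^ 2" by (simp add: power2_eq_square)
    moreover have "t\<^sup>2 * (\<Sum>u\<in>S. \<Sum>v\<in>T. 1) \<le> (\<epsilon> / 4)\<^sup>2 * ?n ^ 2"
    proof (intro mult_mono)
      show "t\<^sup>2 \<le> (\<epsilon> / 4)\<^sup>2" unfolding t_def by (simp add: power_mult_distrib sgn_if)
      show "(\<Sum>u\<in>S. \<Sum>v\<in>T. 1::real) \<le> ?n ^ 2"
        using card_mono[OF fin ST(1)] card_mono[OF fin ST(2)]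
        by (simp add: power2_eq_square mult_mono)
    qed (auto intro!: sum_nonneg)
    ultimately show ?thesis by linarith
  qed
  finally have energy: "(\<Sum>u\<in>A. \<Sum>v\<in>A. (w u v - B' (c' u) (c' v))\<^sup>2) \<le>
      (\<Sum>u\<in>A. \<Sum>v\<in>A. (D u v)\<^sup>2) - (\<epsilon> / 4)\<^sup>2 * ?n ^ 2" by linarith
  show thesis
  proof (rule that[of c' B'])
    show "c' u < 4 * m" if "u \<in> A" for u using c[OF that] unfolding c'_def by (auto simp: of_bool_def)
    show "c u = c' u div 4" for u using dv by simp
    show "0 \<le> B' k l \<and> B' k l \<le> 1" for k l unfolding B'_def by auto
  qed (use energy D_def in auto)
qed

text \<open>Starting from the labels \<open>s\<close>, which all later labels determine, decrement as long as the cycle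
  count of the error is large. Each decrement lowers the energy, which starts below \<open>card A ^ 2\<close>, by a fixed fraction of
  \<open>card A ^ 2\<close>; so their number, and with it the number of labels, is bounded in terms of \<open>\<epsilon>\<close> alone.\<close>

lemma weak_regularity:
  fixes \<epsilon> :: real and Q :: nat
  assumes e: "\<epsilon> > 0"
  shows "\<exists>M. \<forall>(A :: 'a set) w s. finite A \<longrightarrow> (\<forall>u\<in>A. \<forall>v\<in>A. 0 \<le> w u v \<and> w u v \<le> 1) \<longrightarrow>
       (\<forall>u\<in>A. s u < Q) \<longrightarrow>
       (\<exists>(c :: 'a \<Rightarrow> nat) (B :: nat \<Rightarrow> nat \<Rightarrow> real) (g :: nat \<Rightarrow> nat).
          (\<forall>u\<in>A. c u < M) \<and> (\<forall>u\<in>A. s u = g (c u)) \<and> (\<forall>k l. 0 \<le> B k l \<and> B k l \<le> 1) \<and>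
          cycle4 A (\<lambda>u v. w u v - B (c u) (c v)) \<le> \<epsilon> * real (card A) ^ 4)"
proof -
  obtain R :: nat where R: "1 < real R * (\<epsilon> / 4)\<^sup>2"
    using ex_less_of_nat_mult[of "(\<epsilon> / 4)\<^sup>2" 1] e by auto
  show ?thesis
  proof (intro exI[of _ "Q * 4 ^ R"] allI impI)
    fix A :: "'a set" and w :: "'a \<Rightarrow> 'a \<Rightarrow> real" and s :: "'a \<Rightarrow> nat"
    assume fin: "finite A" and w': "\<forall>u\<in>A. \<forall>v\<in>A. 0 \<le> w u v \<and> w u v \<le> 1" and s: "\<forall>u\<in>A. s u < Q"
    have w: "\<And>u v. u \<in> A \<Longrightarrow> v \<in> A \<Longrightarrow> 0 \<le> w u v \<and> w u v \<le> 1" using w' by blast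
    let ?n = "real (card A)"
    define good where "good c B g \<longleftrightarrow> (\<forall>u\<in>A. s u = g (c u)) \<and> (\<forall>k l. 0 \<le> B k l \<and> B k l \<le> 1)"
      for c :: "'a \<Rightarrow> nat" and B :: "nat \<Rightarrow> nat \<Rightarrow> real" and g :: "nat \<Rightarrow> nat"
    have step: "\<exists>c B g. (\<forall>u\<in>A. c u < Q * 4 ^ r) \<and> good c B g \<and>
        (cycle4 A (\<lambda>u v. w u v - B (c u) (c v)) \<le> \<epsilon> * ?n ^ 4 \<or>
         (\<Sum>u\<in>A. \<Sum>v\<in>A. (w u v - B (c u) (c v))\<^sup>2) \<le> ?n ^ 2 * (1 - r * (\<epsilon> / 4)\<^sup>2))" for r :: nat
    proof (induction r)
      case 0
      have "(\<Sum>u\<in>A. \<Sum>v\<in>A. (w u v)\<^sup>2) \<le> (\<Sum>u\<in>A. \<Sum>v\<in>A. 1)"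
        using w by (intro sum_mono) (simp add: abs_square_le_1)
      then show ?case using s
        by (intro exI[of _ s] exI[of _ "\<lambda>_ _. 0"] exI[of _ id]) (auto simp: good_def power2_eq_square)
    next
      case (Suc r)
      then obtain c B g where c: "\<forall>u\<in>A. c u < Q * 4 ^ r" and g: "good c B g" and
        alt: "cycle4 A (\<lambda>u v. w u v - B (c u) (c v)) \<le> \<epsilon> * ?n ^ 4 \<or>
         (\<Sum>u\<in>A. \<Sum>v\<in>A. (w u v - B (c u) (c v))\<^sup>2) \<le> ?n ^ 2 * (1 - r * (\<epsilon> / 4)\<^sup>2)" by blast
      show ?case
      proof (cases "cycle4 A (\<lambda>u v. w u v - B (c u) (c v)) \<le> \<epsilon> * ?n ^ 4")
        case True
        then show ?thesis using c g by (intro exI[of _ c] exI[of _ B] exI[of _ g]) fastforce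
      next
        case False
        with alt have en: "(\<Sum>u\<in>A. \<Sum>v\<in>A. (w u v - B (c u) (c v))\<^sup>2) \<le> ?n ^ 2 * (1 - r * (\<epsilon> / 4)\<^sup>2)" by simp
        obtain c' B' where "\<And>u. u \<in> A \<Longrightarrow> c' u < 4 * (Q * 4 ^ r)" "\<And>u. c u = c' u div 4"
          "\<And>k l. 0 \<le> B' k l \<and> B' k l \<le> (1::real)"
          "(\<Sum>u\<in>A. \<Sum>v\<in>A. (w u v - B' (c' u) (c' v))\<^sup>2) \<le>
            (\<Sum>u\<in>A. \<Sum>v\<in>A. (w u v - B (c u) (c v))\<^sup>2) - (\<epsilon> / 4)\<^sup>2 * ?n ^ 2"
          using energy_decrement[where A = A and w = w and c = c and m = "Q * 4 ^ r" and B = B and \<epsilon> = \<epsilon>]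
            c g False e fin w unfolding good_def not_le by blast
        then show ?thesis using g en
          by (intro exI[of _ c'] exI[of _ B'] exI[of _ "\<lambda>k. g (k div 4)"])
            (auto simp: good_def algebra_simps)
      qed
    qed
    obtain c B g where c: "\<forall>u\<in>A. c u < Q * 4 ^ R" and g: "good c B g" and
      alt: "cycle4 A (\<lambda>u v. w u v - B (c u) (c v)) \<le> \<epsilon> * ?n ^ 4 \<or>
       (\<Sum>u\<in>A. \<Sum>v\<in>A. (w u v - B (c u) (c v))\<^sup>2) \<le> ?n ^ 2 * (1 - R * (\<epsilon> / 4)\<^sup>2)"
      using step[of R] by blast
    have "cycle4 A (\<lambda>u v. w u v - B (c u) (c v)) \<le> \<epsilon> * ?n ^ 4"
    proof (cases "card A = 0")
      case True
      then show ?thesis using fin by (simp add: cycle4_def)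
    next
      case False
      have "0 \<le> (\<Sum>u\<in>A. \<Sum>v\<in>A. (w u v - B (c u) (c v))\<^sup>2)" by (intro sum_nonneg) auto
      moreover have "?n ^ 2 * (1 - R * (\<epsilon> / 4)\<^sup>2) < 0" using R False by (intro mult_pos_neg) auto
      ultimately show ?thesis using alt by linarith
    qed
    then show "\<exists>c B g. (\<forall>u\<in>A. c u < Q * 4 ^ R) \<and> (\<forall>u\<in>A. s u = g (c u)) \<and>
        (\<forall>k l. 0 \<le> B k l \<and> B k l \<le> 1) \<and> cycle4 A (\<lambda>u v. w u v - B (c u) (c v)) \<le> \<epsilon> * ?n ^ 4"
      using c g unfolding good_def by blast
  qed
qed

section \<open>Matchings that respect strips\<close>

text \<open>Greedy: as long as some colour is present on both sides, two points of it are matched, which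
  changes neither the number of mismatches nor the right-hand side. Afterwards every point is a
  mismatch, and each removal of a pair lowers the right-hand side by one. Since \<open>p\<close> factors through
  the colour, the pairs can always be chosen within one block of \<open>p\<close>.\<close>

lemma colour_matching:
  fixes \<kappa> :: "'a \<Rightarrow> 'c" and \<mu> :: "'b \<Rightarrow> 'c" and p :: "'c \<Rightarrow> 'q"
  assumes "finite A" "finite B" "finite L" "\<kappa> ` A \<subseteq> L"
    and "\<And>q. card {a\<in>A. p (\<kappa> a) = q} = card {b\<in>B. p (\<mu> b) = q}"
  shows "\<exists>h. bij_betw h A B \<and> (\<forall>a\<in>A. p (\<mu> (h a)) = p (\<kappa> a)) \<and>
    card {a\<in>A. \<kappa> a \<noteq> \<mu> (h a)} \<le> (\<Sum>l\<in>L. card {a\<in>A. \<kappa> a = l} - card {b\<in>B. \<mu> b = l})"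
  using assms
proof (induction "card A" arbitrary: A B)
  case 0
  then have A: "A = {}" by simp
  have "B = {}"
  proof (rule ccontr)
    assume "B \<noteq> {}"
    then obtain b where "b \<in> B" by blast
    then have "card {b'\<in>B. p (\<mu> b') = p (\<mu> b)} > 0" using 0 by (subst card_gt_0_iff) auto
    then show False using 0(6)[of "p (\<mu> b)"] A by simp
  qed
  then show ?case using A by (simp add: bij_betw_def)
next
  case (Suc n)
  have pick: "\<exists>a\<in>A. \<exists>b\<in>B. p (\<kappa> a) = p (\<mu> b) \<and> (\<kappa> a = \<mu> b \<or> (\<forall>a\<in>A. \<forall>b\<in>B. \<kappa> a \<noteq> \<mu> b))"
  proof (cases "\<exists>a\<in>A. \<exists>b\<in>B. \<kappa> a = \<mu> b")
    case True then show ?thesis by force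
  next
    case False
    from Suc(2) obtain a where a: "a \<in> A" by fastforce
    then have "card {a'\<in>A. p (\<kappa> a') = p (\<kappa> a)} > 0" using Suc by (subst card_gt_0_iff) auto
    then have "{b\<in>B. p (\<mu> b) = p (\<kappa> a)} \<noteq> {}" using Suc(7)[of "p (\<kappa> a)"] by force
    then show ?thesis using a False by fastforce
  qed
  then obtain a b where ab: "a \<in> A" "b \<in> B" "p (\<kappa> a) = p (\<mu> b)"
    and alt: "\<kappa> a = \<mu> b \<or> (\<forall>a\<in>A. \<forall>b\<in>B. \<kappa> a \<noteq> \<mu> b)" by blast
  define A' B' where "A' = A - {a}" and "B' = B - {b}"
  have cA: "card {x\<in>A. P x} = card {x\<in>A'. P x} + of_bool (P a)" for P
  proof -
    have "{x\<in>A. P x} = (if P a then insert a {x\<in>A'. P x} else {x\<in>A'. P x})"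
      using ab(1) unfolding A'_def by auto
    then show ?thesis using Suc(3) unfolding A'_def by auto
  qed
  have cB: "card {x\<in>B. P x} = card {x\<in>B'. P x} + of_bool (P b)" for P
  proof -
    have "{x\<in>B. P x} = (if P b then insert b {x\<in>B'. P x} else {x\<in>B'. P x})"
      using ab(2) unfolding B'_def by auto
    then show ?thesis using Suc(4) unfolding B'_def by auto
  qed
  have "\<exists>h. bij_betw h A' B' \<and> (\<forall>a\<in>A'. p (\<mu> (h a)) = p (\<kappa> a)) \<and>
    card {a\<in>A'. \<kappa> a \<noteq> \<mu> (h a)} \<le> (\<Sum>l\<in>L. card {a\<in>A'. \<kappa> a = l} - card {b\<in>B'. \<mu> b = l})"
  proof (rule Suc(1))
    show "n = card A'" using Suc(2,3) ab(1) unfolding A'_def by simp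
    show "finite A'" "finite B'" "\<kappa> ` A' \<subseteq> L" "finite L" using Suc(3-6) unfolding A'_def B'_def by auto
    show "card {a \<in> A'. p (\<kappa> a) = q} = card {b \<in> B'. p (\<mu> b) = q}" for q
      using Suc(7)[of q] cA[of "\<lambda>x. p (\<kappa> x) = q"] cB[of "\<lambda>x. p (\<mu> x) = q"] ab(3) by simp
  qed
  then obtain h where h: "bij_betw h A' B'" "\<forall>a\<in>A'. p (\<mu> (h a)) = p (\<kappa> a)"
    "card {a\<in>A'. \<kappa> a \<noteq> \<mu> (h a)} \<le> (\<Sum>l\<in>L. card {a\<in>A'. \<kappa> a = l} - card {b\<in>B'. \<mu> b = l})"
    by blast
  define h' where "h' = h(a := b)"
  have A_eq: "A = insert a A'" and B_eq: "B = insert b B'" and nin: "a \<notin> A'" "b \<notin> B'"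
    using ab unfolding A'_def B'_def by auto
  have "bij_betw h' A' B'" using h(1) nin(1) unfolding h'_def
    by (subst bij_betw_cong[of _ _ h]) auto
  then have "bij_betw h' A B" unfolding A_eq B_eq using nin
    using notIn_Un_bij_betw[of a A' h' B'] by (simp add: h'_def)
  moreover have "\<forall>a\<in>A. p (\<mu> (h' a)) = p (\<kappa> a)"
    using h(2) ab(3) nin unfolding A_eq h'_def by auto
  moreover have "card {x\<in>A. \<kappa> x \<noteq> \<mu> (h' x)} \<le> (\<Sum>l\<in>L. card {a\<in>A. \<kappa> a = l} - card {b\<in>B. \<mu> b = l})"
  proof -
    have "{x\<in>A'. \<kappa> x \<noteq> \<mu> (h' x)} = {x\<in>A'. \<kappa> x \<noteq> \<mu> (h x)}" using nin unfolding h'_def by auto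
    then have mm: "card {x\<in>A. \<kappa> x \<noteq> \<mu> (h' x)} = card {x\<in>A'. \<kappa> x \<noteq> \<mu> (h x)} + of_bool (\<kappa> a \<noteq> \<mu> b)"
      unfolding cA by (simp add: h'_def)
    let ?f = "\<lambda>l. card {a\<in>A. \<kappa> a = l} - card {b\<in>B. \<mu> b = l}"
    let ?f' = "\<lambda>l. card {a\<in>A'. \<kappa> a = l} - card {b\<in>B'. \<mu> b = l}"
    show ?thesis
    proof (cases "\<kappa> a = \<mu> b")
      case True
      then have "?f l = ?f' l" for l by (auto simp: cA cB)
      then show ?thesis using mm h(3) True by simp
    next
      case False
      with alt have no: "\<And>a b. a \<in> A \<Longrightarrow> b \<in> B \<Longrightarrow> \<kappa> a \<noteq> \<mu> b" by blast
      have "{x \<in> B. \<mu> x = \<kappa> a} = {}" using no ab(1) by force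
      then have z1: "card {x \<in> B. \<mu> x = \<kappa> a} = 0" by (simp only: card.empty)
      have "{x \<in> A. \<kappa> x = \<mu> b} = {}" using no ab(2) by force
      then have z2: "card {x \<in> A. \<kappa> x = \<mu> b} = 0" by (simp only: card.empty)
      have le: "?f' l + of_bool (l = \<kappa> a) \<le> ?f l" for l
        using z1 z2 False by (cases "l = \<kappa> a"; cases "l = \<mu> b") (auto simp: cA cB)
      have "(\<Sum>l\<in>L. ?f' l) + 1 = (\<Sum>l\<in>L. ?f' l + of_bool (l = \<kappa> a))"
        using Suc(5,6) ab(1) by (simp add: sum.distrib of_bool_def sum.delta image_subset_iff)
      also have "\<dots> \<le> (\<Sum>l\<in>L. ?f l)" by (intro sum_mono le)
      finally show ?thesis using mm h(3) False by simp
    qed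
  qed
  ultimately show ?case by blast
qed

definition strip :: "nat \<Rightarrow> nat \<Rightarrow> nat \<Rightarrow> nat" where
  "strip Q N i = i * Q div N"

lemma strip_multiple:
  assumes "Q > 0" "r > 0" shows "strip Q (Q * r) i = i div r"
  unfolding strip_def using assms by (metis div_mult_mult1 mult.commute not_gr0)

text \<open>A monotone sequence of strip numbers differs from the equidistributed one only where some
  initial segment \<open>{i. r i < q}\<close> differs from the right one; the symmetric difference of two
  initial segments has the size of the difference of their cardinalities.\<close>

lemma misplaced_le:
  fixes r :: "nat \<Rightarrow> nat"
  assumes mono: "\<And>i j. i \<le> j \<Longrightarrow> j < k \<Longrightarrow> r i \<le> r j" and r: "\<And>i. i < k \<Longrightarrow> r i < Q"
    and s: "\<And>i j. i \<le> j \<Longrightarrow> j < k \<Longrightarrow> s i \<le> (s j :: nat)" 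
    and dev: "\<And>q. q < Q \<Longrightarrow> \<bar>real (card {i. i < k \<and> r i < q}) - real (card {i. i < k \<and> s i < q})\<bar> \<le> d"
    and sQ: "\<And>i. i < k \<Longrightarrow> s i < Q"
  shows "real (card {i. i < k \<and> r i \<noteq> s i}) \<le> Q * d"
proof -
  define R S where "R q = {i. i < k \<and> r i < q}" and "S q = {i. i < k \<and> s i < q}" for q
  have fin: "finite (R q)" "finite (S q)" for q unfolding R_def S_def by auto
  have nested: "R q \<subseteq> S q \<or> S q \<subseteq> R q" for q
  proof (rule ccontr)
    assume "\<not> ?thesis"
    then obtain i j where "i \<in> R q" "i \<notin> S q" "j \<in> S q" "j \<notin> R q" by blast
    then show False using mono[of i j] mono[of j i] s[of i j] s[of j i] unfolding R_def S_def
      by (cases "i \<le> j") auto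
  qed
  have sd: "real (card (R q - S q \<union> (S q - R q))) \<le> d" if "q < Q" for q
  proof -
    have "real (card (R q - S q \<union> (S q - R q))) = \<bar>real (card (R q)) - real (card (S q))\<bar>"
    proof (cases "R q \<subseteq> S q")
      case True
      then have "R q - S q \<union> (S q - R q) = S q - R q" by auto
      then show ?thesis using True card_mono[OF fin(2) True] fin by (simp add: card_Diff_subset of_nat_diff)
    next
      case False
      then have T: "S q \<subseteq> R q" using nested by blast
      then have "R q - S q \<union> (S q - R q) = R q - S q" by auto
      then show ?thesis using T card_mono[OF fin(1) T] fin by (simp add: card_Diff_subset of_nat_diff)
    qed
    then show ?thesis using dev[OF that] unfolding R_def S_def by simp
  qed
  have "{i. i < k \<and> r i \<noteq> s i} \<subseteq> (\<Union>q<Q. R q - S q \<union> (S q - R q))"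
  proof
    fix i assume "i \<in> {i. i < k \<and> r i \<noteq> s i}"
    then have i: "i < k" "r i \<noteq> s i" by auto
    then have "i \<in> R (max (r i) (s i)) - S (max (r i) (s i)) \<union> (S (max (r i) (s i)) - R (max (r i) (s i)))"
      unfolding R_def S_def by auto
    then show "i \<in> (\<Union>q<Q. R q - S q \<union> (S q - R q))" using r[OF i(1)] sQ[OF i(1)]
      by (intro UN_I[of "max (r i) (s i)"]) auto
  qed
  then have "card {i. i < k \<and> r i \<noteq> s i} \<le> card (\<Union>q<Q. R q - S q \<union> (S q - R q))"
    by (intro card_mono) (auto simp: fin)
  also have "\<dots> \<le> (\<Sum>q<Q. card (R q - S q \<union> (S q - R q)))" by (rule card_UN_le) simp
  finally have "real (card {i. i < k \<and> r i \<noteq> s i}) \<le> (\<Sum>q<Q. real (card (R q - S q \<union> (S q - R q))))"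
    by (simp flip: of_nat_sum)
  also have "\<dots> \<le> (\<Sum>q<Q. d)" using sd by (intro sum_mono) auto
  finally show ?thesis by simp
qed

section \<open>Typical samples of a grid\<close>

text \<open>The cut-norm without normalisation. Test functions with values in the unit interval are used in place
  of sets because averages over fibres of such functions are again of this kind.\<close>

definition cut_le :: "'a set \<Rightarrow> ('a \<Rightarrow> 'a \<Rightarrow> real) \<Rightarrow> real \<Rightarrow> bool" where
  "cut_le A D c \<longleftrightarrow> (\<forall>a b. (\<forall>i\<in>A. 0 \<le> a i \<and> a i \<le> 1) \<longrightarrow> (\<forall>i\<in>A. 0 \<le> b i \<and> b i \<le> 1) \<longrightarrow>
     \<bar>\<Sum>i\<in>A. \<Sum>j\<in>A. a i * b j * D i j\<bar> \<le> c)"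

lemma cut_leD:
  assumes "cut_le A D c" "\<And>i. i \<in> A \<Longrightarrow> 0 \<le> a i \<and> a i \<le> 1" "\<And>i. i \<in> A \<Longrightarrow> 0 \<le> b i \<and> b i \<le> 1"
  shows "\<bar>\<Sum>i\<in>A. \<Sum>j\<in>A. a i * b j * D i j\<bar> \<le> c"
  using assms unfolding cut_le_def by blast

lemma cut_le_cong: "(\<And>i j. i \<in> A \<Longrightarrow> j \<in> A \<Longrightarrow> D i j = D' i j) \<Longrightarrow> cut_le A D c = cut_le A D' c"
  unfolding cut_le_def by (simp cong: sum.cong)

lemma cut_le_mono: "cut_le A D c \<Longrightarrow> c \<le> c' \<Longrightarrow> cut_le A D c'"
  unfolding cut_le_def by (meson order_trans)

lemma cut_le_add:
  assumes "cut_le A D c" "cut_le A D' c'"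
  shows "cut_le A (\<lambda>i j. D i j + D' i j) (c + c')"
  unfolding cut_le_def
proof (intro allI impI)
  fix a b :: "'a \<Rightarrow> real"
  assume *: "\<forall>i\<in>A. 0 \<le> a i \<and> a i \<le> 1" "\<forall>i\<in>A. 0 \<le> b i \<and> b i \<le> 1"
  have "(\<Sum>i\<in>A. \<Sum>j\<in>A. a i * b j * (D i j + D' i j)) =
    (\<Sum>i\<in>A. \<Sum>j\<in>A. a i * b j * D i j) + (\<Sum>i\<in>A. \<Sum>j\<in>A. a i * b j * D' i j)"
    by (simp add: distrib_left sum.distrib)
  then show "\<bar>\<Sum>i\<in>A. \<Sum>j\<in>A. a i * b j * (D i j + D' i j)\<bar> \<le> c + c'"
    using cut_leD[OF assms(1), of a b] cut_leD[OF assms(2), of a b] * by fastforce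
qed

lemma cut_le_uminus: "cut_le A (\<lambda>i j. - D i j) c = cut_le A D c"
  unfolding cut_le_def by (simp add: sum_negf)

lemma cut_le_L1:
  assumes "(\<Sum>i\<in>A. \<Sum>j\<in>A. \<bar>D i j\<bar>) \<le> c"
  shows "cut_le A D c"
  unfolding cut_le_def
proof (intro allI impI)
  fix a b :: "'a \<Rightarrow> real"
  assume *: "\<forall>i\<in>A. 0 \<le> a i \<and> a i \<le> 1" "\<forall>i\<in>A. 0 \<le> b i \<and> b i \<le> 1"
  have "\<bar>\<Sum>i\<in>A. \<Sum>j\<in>A. a i * b j * D i j\<bar> \<le> (\<Sum>i\<in>A. \<Sum>j\<in>A. \<bar>a i * b j * D i j\<bar>)"
    by (rule order_trans[OF sum_abs sum_mono[OF sum_abs]])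
  also have "\<dots> \<le> (\<Sum>i\<in>A. \<Sum>j\<in>A. \<bar>D i j\<bar>)"
    using * by (intro sum_mono) (auto simp: abs_mult intro!: mult_left_le_one_le mult_le_one)
  finally show "\<bar>\<Sum>i\<in>A. \<Sum>j\<in>A. a i * b j * D i j\<bar> \<le> c" using assms by linarith
qed

lemma cut_le_cycle4:
  assumes fin: "finite A" and rho: "0 \<le> \<rho>" and small: "cycle4 A D \<le> \<rho> ^ 4 * real (card A) ^ 4"
  shows "cut_le A D (\<rho> * real (card A) ^ 2)"
  unfolding cut_le_def
proof (intro allI impI)
  fix a b :: "'a \<Rightarrow> real"
  assume *: "\<forall>i\<in>A. 0 \<le> a i \<and> a i \<le> 1" "\<forall>i\<in>A. 0 \<le> b i \<and> b i \<le> 1"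
  let ?S = "\<Sum>i\<in>A. \<Sum>j\<in>A. a i * b j * D i j"
  have "\<bar>?S\<bar> ^ 4 = ?S ^ 4" by (simp add: power_even_abs)
  also have "\<dots> \<le> real (card A) ^ 4 * cycle4 A D"
    using * by (intro bilinear_power4_le_cycle4 fin) auto
  also have "\<dots> \<le> real (card A) ^ 4 * (\<rho> ^ 4 * real (card A) ^ 4)"
    using small by (intro mult_left_mono) auto
  also have "\<dots> = (\<rho> * real (card A) ^ 2) ^ 4"
    by (simp add: power_mult_distrib flip: power_mult power_add)
  finally show "\<bar>?S\<bar> \<le> \<rho> * real (card A) ^ 2" using rho
    by (subst (asm) power_mono_iff) auto
qed

text \<open>A test function on the larger set acts on the smaller one through its averages over the
  fibres.\<close>

lemma cut_le_pull:
  assumes finA: "finite A" and finV: "finite V" and \<phi>: "\<And>z. z \<in> A \<Longrightarrow> \<phi> z \<in> V"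
    and fib: "\<And>i. i \<in> V \<Longrightarrow> card {z\<in>A. \<phi> z = i} = m" and cut: "cut_le V D c"
  shows "cut_le A (\<lambda>z z'. D (\<phi> z) (\<phi> z')) (real m ^ 2 * c)"
  unfolding cut_le_def
proof (intro allI impI)
  fix a b :: "'a \<Rightarrow> real"
  assume ab: "\<forall>i\<in>A. 0 \<le> a i \<and> a i \<le> 1" "\<forall>i\<in>A. 0 \<le> b i \<and> b i \<le> 1"
  define avg where "avg f i = (\<Sum>z\<in>{z\<in>A. \<phi> z = i}. f z) / m" for f :: "'a \<Rightarrow> real" and i
  have avg_sum: "(\<Sum>z\<in>{z\<in>A. \<phi> z = i}. f z) = m * avg f i" if "i \<in> V" for f i
  proof (cases "m = 0")
    case True
    then have "{z\<in>A. \<phi> z = i} = {}" using fib[OF that] finA by (simp del: Collect_empty_eq)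
    then show ?thesis using True by (simp only: sum.empty)
  qed (simp add: avg_def)
  have avg: "0 \<le> avg f i \<and> avg f i \<le> 1" if f: "\<forall>i\<in>A. 0 \<le> f i \<and> f i \<le> 1" and i: "i \<in> V" for f i
  proof -
    have "(\<Sum>z\<in>{z\<in>A. \<phi> z = i}. f z) \<le> (\<Sum>z\<in>{z\<in>A. \<phi> z = i}. 1)" using f by (intro sum_mono) auto
    then have "(\<Sum>z\<in>{z\<in>A. \<phi> z = i}. f z) \<le> m" using fib[OF i] by simp
    then show ?thesis using f unfolding avg_def by (cases "m = 0") (auto simp: divide_le_eq_1 intro!: sum_nonneg divide_nonneg_nonneg)
  qed
  have grp: "(\<Sum>z\<in>A. f z) = (\<Sum>i\<in>V. \<Sum>z\<in>{z\<in>A. \<phi> z = i}. f z)" for f :: "'a \<Rightarrow> real"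
    using sum.group[OF finA finV, of \<phi> f] \<phi> by (simp add: image_subset_iff)
  have "(\<Sum>z\<in>A. \<Sum>z'\<in>A. a z * b z' * D (\<phi> z) (\<phi> z')) =
    (\<Sum>i\<in>V. \<Sum>z\<in>{z\<in>A. \<phi> z = i}. \<Sum>j\<in>V. \<Sum>z'\<in>{z\<in>A. \<phi> z = j}. a z * b z' * D i j)"
    by (subst grp, intro sum.cong refl, subst grp) (auto intro!: sum.cong)
  also have "\<dots> = (\<Sum>i\<in>V. \<Sum>z\<in>{z\<in>A. \<phi> z = i}. a z * (\<Sum>j\<in>V. (m * avg b j) * D i j))"
    using avg_sum[of _ b] by (simp add: sum_distrib_left sum_distrib_right mult_ac flip: avg_sum cong: sum.cong)
  also have "\<dots> = (\<Sum>i\<in>V. (m * avg a i) * (\<Sum>j\<in>V. (m * avg b j) * D i j))"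
    by (intro sum.cong refl) (simp flip: avg_sum add: sum_distrib_right)
  also have "\<dots> = real m ^ 2 * (\<Sum>i\<in>V. \<Sum>j\<in>V. avg a i * avg b j * D i j)"
    by (simp add: sum_distrib_left power2_eq_square mult_ac)
  finally have eq: "(\<Sum>z\<in>A. \<Sum>z'\<in>A. a z * b z' * D (\<phi> z) (\<phi> z')) =
    real m ^ 2 * (\<Sum>i\<in>V. \<Sum>j\<in>V. avg a i * avg b j * D i j)" .
  show "\<bar>\<Sum>z\<in>A. \<Sum>z'\<in>A. a z * b z' * D (\<phi> z) (\<phi> z')\<bar> \<le> real m ^ 2 * c"
    unfolding eq abs_mult
    using cut_leD[OF cut, of "avg a" "avg b"] avg ab by (auto intro!: mult_left_mono)
qed

lemma strip_eq_imp_close: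
  assumes "strip Q N i = strip Q k j" "Q > 0" "N > 0" "k > 0"
  shows "\<bar>real i / N - real j / k\<bar> \<le> 1 / Q"
proof -
  have "\<lfloor>real (i * Q) / real N\<rfloor> = \<lfloor>real (j * Q) / real k\<rfloor>"
    using assms(1) unfolding strip_def floor_divide_of_nat_eq by simp
  then have "\<bar>real (i * Q) / real N - real (j * Q) / real k\<bar> \<le> 1" by linarith
  moreover have "real (i * Q) / real N - real (j * Q) / real k = (real i / N - real j / k) * Q"
    by (simp add: algebra_simps)
  ultimately have "\<bar>real i / N - real j / k\<bar> * Q \<le> 1" by (simp add: abs_mult)
  then show ?thesis using assms(2) by (simp add: field_simps)
qed

lemma card_strip:
  assumes "Q > 0" "r > 0"
  shows "card {i. i < Q * r \<and> strip Q (Q * r) i = q} = (if q < Q then r else 0)"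
proof -
  have "{i. i < Q * r \<and> strip Q (Q * r) i = q} = (if q < Q then {q * r..<Suc q * r} else {})"
  proof (intro set_eqI)
    fix i
    have "i div r = q \<longleftrightarrow> q * r \<le> i \<and> i < Suc q * r"
      using assms(2) by (metis div_nat_eqI dividend_less_times_div mult.commute mult_Suc_right times_div_less_eq_dividend)
    moreover have "i < Q * r \<longleftrightarrow> i div r < Q" using assms(2) by (simp add: less_mult_imp_div_less div_less_iff_less_mult)
    ultimately show "i \<in> {i. i < Q * r \<and> strip Q (Q * r) i = q} \<longleftrightarrow>
        i \<in> (if q < Q then {q * r..<Suc q * r} else {})"
      unfolding strip_multiple[OF assms] by auto
  qed
  then show ?thesis by simp
qed

lemma card_strip_less:
  assumes "Q > 0" "r > 0" "q \<le> Q"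
  shows "card {i. i < Q * r \<and> strip Q (Q * r) i < q} = q * r"
proof -
  have "{i. i < Q * r \<and> strip Q (Q * r) i < q} = {..<q * r}"
  proof (intro set_eqI)
    fix i
    have "i div r < q \<longleftrightarrow> i < q * r" using assms(2) by (simp add: div_less_iff_less_mult)
    moreover have "q * r \<le> Q * r" using assms(3) by simp
    ultimately show "i \<in> {i. i < Q * r \<and> strip Q (Q * r) i < q} \<longleftrightarrow> i \<in> {..<q * r}"
      unfolding strip_multiple[OF assms(1,2)] by (auto intro: less_le_trans)
  qed
  then show ?thesis by simp
qed

definition cells :: "nat \<Rightarrow> (nat \<times> nat) set" where "cells N = {..<N} \<times> {..<N}"

definition adjacency :: "(nat \<times> nat) set \<Rightarrow> nat \<Rightarrow> nat \<Rightarrow> real" where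
  "adjacency E i j = of_bool ((i, j) \<in> E \<or> (j, i) \<in> E)"

lemma finite_cells [simp]: "finite (cells N)" and card_cells [simp]: "card (cells N) = N * N"
  unfolding cells_def by auto

text \<open>The graph on \<open>k\<close> vertices is blown up to the grid by an equitable map \<open>\<phi>\<close>, whose fibres are
  the pieces of the grid that represent the vertices.\<close>

definition models :: "nat \<Rightarrow> nat \<Rightarrow> real \<Rightarrow> (nat \<times> nat \<Rightarrow> nat \<times> nat \<Rightarrow> real) \<Rightarrow> (nat \<times> nat) set \<Rightarrow> bool" where
  "models k N \<epsilon> w E \<longleftrightarrow> (\<exists>\<phi>. (\<forall>z\<in>cells N. \<phi> z < k) \<and>
     (\<forall>i<k. card {z\<in>cells N. \<phi> z = i} = N * N div k) \<and>
     (\<forall>z\<in>cells N. \<bar>real (fst z) / N - real (\<phi> z) / k\<bar> \<le> \<epsilon>) \<and>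
     cut_le (cells N) (\<lambda>z z'. w z z' - adjacency E (\<phi> z) (\<phi> z')) (\<epsilon> * real (N * N) ^ 2))"

lemma card_eq_sum_card_fibres:
  assumes "finite A" "\<And>a. a \<in> A \<Longrightarrow> f a < (M::nat)"
  shows "card {a\<in>A. P (f a) a} = (\<Sum>l<M. card {a\<in>A. f a = l \<and> P l a})"
proof -
  have "{a\<in>A. P (f a) a} = (\<Union>l<M. {a\<in>A. f a = l \<and> P l a})" using assms by auto
  then show ?thesis using assms by (simp only:) (subst card_UN_disjoint; auto)
qed

text \<open>The cells of the grid have types \<open>c\<close>, each within one of \<open>Q\<close> vertical strips, and \<open>w\<close> is nearly the
  step function \<open>B\<close> of the types. The sample is typical for a graph on it if the graph is nearly the same
  step function of the types of the sample points, and if each type occurs in the sample about as often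
  as it should.\<close>

locale typical_sample =
  fixes Q r N' M k N :: nat and \<rho> \<tau> :: real and w :: "nat \<times> nat \<Rightarrow> nat \<times> nat \<Rightarrow> real"
    and c :: "nat \<times> nat \<Rightarrow> nat" and B :: "nat \<Rightarrow> nat \<Rightarrow> real" and g :: "nat \<Rightarrow> nat"
    and x :: "nat \<Rightarrow> nat \<times> nat" and E :: "(nat \<times> nat) set"
  assumes pos: "Q > 0" "r > 0" "N' > 0" and k: "k = Q * r" and N: "N = k * N'"
    and c: "\<And>z. z \<in> cells N \<Longrightarrow> c z < M"
    and g: "\<And>z. z \<in> cells N \<Longrightarrow> strip Q N (fst z) = g (c z)"
    and B: "\<And>k l. 0 \<le> B k l \<and> B k l \<le> 1"
    and rho: "0 \<le> \<rho>" and tau: "0 \<le> \<tau>"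
    and regular: "cycle4 (cells N) (\<lambda>u v. w u v - B (c u) (c v)) \<le> \<rho> ^ 4 * real (N * N) ^ 4"
    and x: "\<And>i. i < k \<Longrightarrow> x i \<in> cells N"
    and x_mono: "\<And>i j. i \<le> j \<Longrightarrow> j < k \<Longrightarrow> fst (x i) \<le> fst (x j)"
    and sample_regular: "cycle4 {..<k} (\<lambda>i j. adjacency E i j - B (c (x i)) (c (x j))) \<le> \<rho> ^ 4 * real k ^ 4"
    and counts: "\<And>l. l < M \<Longrightarrow>
      \<bar>real (card {z\<in>cells N. c z = l}) / (N * N) - real (card {i. i < k \<and> c (x i) = l}) / k\<bar> \<le> \<tau>"
begin

abbreviation "n \<equiv> N * N"
abbreviation "m \<equiv> N' * N"

lemma pos': "k > 0" "N > 0" "n > 0" "m > 0" using pos k N by auto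

lemma n_eq: "n = k * m" unfolding N by simp

lemma div_eq: "n div k = m" using pos' unfolding n_eq by simp

lemma N_eq: "N = Q * (r * N')" unfolding N k by (simp add: mult.assoc)

lemma card_cells_fst: "card {z\<in>cells N. P (fst z)} = card {i. i < N \<and> P i} * N"
proof -
  have "{z\<in>cells N. P (fst z)} = {i. i < N \<and> P i} \<times> {..<N}" unfolding cells_def by auto
  then show ?thesis by simp
qed

lemma count_le: 
  assumes "l < M"
  shows "\<bar>real (card {z\<in>cells N. c z = l}) - m * real (card {i. i < k \<and> c (x i) = l})\<bar> \<le> \<tau> * n"
proof -
  let ?a = "real (card {z\<in>cells N. c z = l})" and ?b = "real (card {i. i < k \<and> c (x i) = l})"
  have "?b / k = m * ?b / n" using pos' unfolding n_eq by simp
  then have "?a / n - ?b / k = (?a - m * ?b) / n" by (simp add: diff_divide_distrib)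
  then have "\<bar>?a - m * ?b\<bar> / n \<le> \<tau>" using counts[OF assms] pos' by simp
  then show ?thesis using pos' by (simp add: pos_divide_le_eq)
qed

text \<open>The type counts determine how many sample points lie in the first \<open>q\<close> strips.\<close>

lemma card_misplaced:
  "real (card {i. i < k \<and> strip Q N (fst (x i)) \<noteq> strip Q k i}) \<le> Q * (k * (M * \<tau>))"
proof (rule misplaced_le)
  have N0: "strip Q N i < Q" if "i < N" for i
    using that pos' pos unfolding strip_def by (simp add: div_less_iff_less_mult mult.commute)
  show "strip Q N (fst (x i)) < Q" if "i < k" for i
    using x[OF that] N0 by (auto simp: cells_def)
  show "strip Q k i < Q" if "i < k" for i
    using that pos' pos unfolding strip_def by (simp add: div_less_iff_less_mult mult.commute)
  show "strip Q N (fst (x i)) \<le> strip Q N (fst (x j))" if "i \<le> j" "j < k" for i j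
    using x_mono[OF that] unfolding strip_def by (intro div_le_mono mult_le_mono1)
  show "strip Q k i \<le> strip Q k j" if "i \<le> j" "j < k" for i j
    using that unfolding strip_def by (intro div_le_mono mult_le_mono1)
  show "\<bar>real (card {i. i < k \<and> strip Q N (fst (x i)) < q}) -
      real (card {i. i < k \<and> strip Q k i < q})\<bar> \<le> k * (M * \<tau>)" if q: "q < Q" for q
  proof -
    let ?a = "\<lambda>l. real (card {z\<in>cells N. c z = l})" and ?b = "\<lambda>l. real (card {i. i < k \<and> c (x i) = l})"
    have "card {i. i < k \<and> strip Q N (fst (x i)) < q} = card {i\<in>{..<k}. g (c (x i)) < q}"
      using g[OF x] by (intro arg_cong[of _ _ card]) auto
    also have "\<dots> = (\<Sum>l<M. card {i\<in>{..<k}. c (x i) = l \<and> g l < q})"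
      using c x by (intro card_eq_sum_card_fibres) auto
    also have "\<dots> = (\<Sum>l<M. if g l < q then card {i. i < k \<and> c (x i) = l} else 0)"
      by (intro sum.cong) auto
    finally have 1: "real (card {i. i < k \<and> strip Q N (fst (x i)) < q}) = (\<Sum>l<M. if g l < q then ?b l else 0)"
      by (simp add: of_nat_sum if_distrib[of real] cong: if_cong)
    have "q * (r * N') * N = card {z\<in>cells N. strip Q N (fst z) < q}"
      using card_strip_less[of Q "r * N'" q] pos q card_cells_fst[of "\<lambda>i. strip Q N i < q"] by (simp flip: N_eq)
    also have "\<dots> = card {z\<in>cells N. g (c z) < q}"
      using g by (auto intro!: arg_cong[of _ _ card])
    also have "\<dots> = (\<Sum>l<M. card {z\<in>cells N. c z = l \<and> g l < q})"
      using c by (intro card_eq_sum_card_fibres) auto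
    also have "\<dots> = (\<Sum>l<M. if g l < q then card {z\<in>cells N. c z = l} else 0)"
      by (intro sum.cong) auto
    finally have 2: "real (q * r) * m = (\<Sum>l<M. if g l < q then ?a l else 0)"
      by (simp add: of_nat_sum if_distrib[of real] mult_ac cong: if_cong flip: of_nat_mult)
    have 3: "card {i. i < k \<and> strip Q k i < q} = q * r"
      unfolding k using pos q by (intro card_strip_less) auto
    have "m * \<bar>real (card {i. i < k \<and> strip Q N (fst (x i)) < q}) - real (q * r)\<bar> =
      \<bar>real (q * r) * m - m * real (card {i. i < k \<and> strip Q N (fst (x i)) < q})\<bar>"
    proof -
      have "y * \<bar>a - b\<bar> = \<bar>b * y - y * a\<bar>" if "0 \<le> y" for a b y :: real
        using that by (metis abs_minus_commute abs_mult abs_of_nonneg mult.commute right_diff_distrib)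
      then show ?thesis by simp
    qed
    also have "\<dots> = \<bar>\<Sum>l<M. if g l < q then ?a l - m * ?b l else 0\<bar>"
      unfolding 1 2 sum_distrib_left by (simp add: sum_subtractf[symmetric] if_distrib cong: if_cong sum.cong)
    also have "\<dots> \<le> (\<Sum>l<M. \<tau> * n)"
      using count_le tau by (intro order_trans[OF sum_abs] sum_mono) auto
    also have "\<dots> = m * (k * (M * \<tau>))" by (simp add: n_eq mult_ac)
    finally show ?thesis using pos' unfolding 3 by simp
  qed
qed

text \<open>Replace each sample point by \<open>m\<close> copies and match cells with copies of the same type, always within
  a strip. Cells left without a partner of their type are few, and they are still matched within
  their strip, so that they affect the cut-norm but not the displacement.\<close>

lemma typical_models: "models k N (2 * \<rho> + 2 * (1 + Q) * (M * \<tau>) + 1 / Q) w E"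
proof -
  define \<kappa> where "\<kappa> z = (g (c z), c z)" for z
  define \<mu> where "\<mu> b = (strip Q k (fst b), c (x (fst b)))" for b :: "nat \<times> nat"
  define L where "L = (\<lambda>l. (g l, l)) ` {..<M}"
  define V where "V = {..<k} \<times> {..<m}"
  have cardV: "card {b\<in>V. P (fst b)} = card {i. i < k \<and> P i} * m" for P
  proof -
    have "{b\<in>V. P (fst b)} = {i. i < k \<and> P i} \<times> {..<m}" unfolding V_def by auto
    then show ?thesis by simp
  qed
  have "\<exists>h. bij_betw h (cells N) V \<and> (\<forall>a\<in>cells N. fst (\<mu> (h a)) = fst (\<kappa> a)) \<and>
    card {a\<in>cells N. \<kappa> a \<noteq> \<mu> (h a)} \<le> (\<Sum>l\<in>L. card {a\<in>cells N. \<kappa> a = l} - card {b\<in>V. \<mu> b = l})"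
  proof (rule colour_matching)
    show "finite (cells N)" "finite V" "finite L" unfolding V_def L_def by auto
    show "\<kappa> ` cells N \<subseteq> L" using c unfolding \<kappa>_def L_def by auto
    fix q
    have "card {a \<in> cells N. fst (\<kappa> a) = q} = card {z\<in>cells N. strip Q N (fst z) = q}"
      using g unfolding \<kappa>_def by (auto intro!: arg_cong[of _ _ card])
    also have "\<dots> = card {i. i < N \<and> strip Q N i = q} * N" by (rule card_cells_fst)
    also have "\<dots> = (if q < Q then r * N' else 0) * N"
      using card_strip[of Q "r * N'" q] pos by (simp flip: N_eq)
    also have "\<dots> = card {i. i < k \<and> strip Q k i = q} * m"
      unfolding k using card_strip[of Q r q] pos by simp
    also have "\<dots> = card {b \<in> V. fst (\<mu> b) = q}" unfolding \<mu>_def fst_conv by (rule cardV[symmetric])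
    finally show "card {a \<in> cells N. fst (\<kappa> a) = q} = card {b \<in> V. fst (\<mu> b) = q}" .
  qed
  then obtain h where h: "bij_betw h (cells N) V" "\<And>a. a \<in> cells N \<Longrightarrow> fst (\<mu> (h a)) = fst (\<kappa> a)"
    and mis: "card {a\<in>cells N. \<kappa> a \<noteq> \<mu> (h a)} \<le> (\<Sum>l\<in>L. card {a\<in>cells N. \<kappa> a = l} - card {b\<in>V. \<mu> b = l})"
    by blast
  define Z where "Z = {a\<in>cells N. \<kappa> a \<noteq> \<mu> (h a)}"
  let ?wrong = "\<lambda>l. card {i. i < k \<and> c (x i) = l \<and> strip Q k i \<noteq> g l}"
  have excess: "real (card {a\<in>cells N. \<kappa> a = (g l, l)} - card {b\<in>V. \<mu> b = (g l, l)}) \<le> \<tau> * n + m * ?wrong l"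
    if l: "l < M" for l
  proof -
    have "{a\<in>cells N. \<kappa> a = (g l, l)} = {z\<in>cells N. c z = l}" unfolding \<kappa>_def by auto
    then have 1: "card {a\<in>cells N. \<kappa> a = (g l, l)} = card {z\<in>cells N. c z = l}" by (simp only:)
    have "card {b\<in>V. \<mu> b = (g l, l)} = card {i. i < k \<and> (strip Q k i = g l \<and> c (x i) = l)} * m"
      using cardV[of "\<lambda>i. strip Q k i = g l \<and> c (x i) = l"] unfolding \<mu>_def by simp
    moreover have "card {i. i < k \<and> c (x i) = l} = card {i. i < k \<and> (strip Q k i = g l \<and> c (x i) = l)} + ?wrong l"
      by (subst card_Un_disjoint[symmetric]) (auto intro!: arg_cong[of _ _ card])
    ultimately have 2: "real (card {b\<in>V. \<mu> b = (g l, l)}) = m * real (card {i. i < k \<and> c (x i) = l}) - m * ?wrong l"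
      by (simp add: algebra_simps)
    have "real (a - b) \<le> y" if "real a - real b \<le> y" "0 \<le> y" for a b :: nat and y :: real
      using that by (cases "b \<le> a") (auto simp: of_nat_diff)
    then show ?thesis using count_le[OF l] 2 tau unfolding 1 by simp
  qed
  have "real (card Z) \<le> real (\<Sum>l<M. card {a\<in>cells N. \<kappa> a = (g l, l)} - card {b\<in>V. \<mu> b = (g l, l)})"
    using mis unfolding Z_def L_def of_nat_le_iff by (subst (asm) sum.reindex) (auto intro!: inj_onI)
  also have "\<dots> \<le> (\<Sum>l<M. \<tau> * n + m * ?wrong l)" unfolding of_nat_sum using excess by (intro sum_mono) auto
  also have "\<dots> = M * (\<tau> * n) + real m * real (\<Sum>l<M. ?wrong l)"
    by (simp add: sum.distrib sum_distrib_left)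
  also have "(\<Sum>l<M. ?wrong l) = card {i. i < k \<and> strip Q N (fst (x i)) \<noteq> strip Q k i}"
  proof -
    have "(\<Sum>l<M. ?wrong l) = (\<Sum>l<M. card {i\<in>{..<k}. c (x i) = l \<and> strip Q k i \<noteq> g l})" by simp
    also have "\<dots> = card {i\<in>{..<k}. strip Q k i \<noteq> g (c (x i))}"
      using c x by (intro card_eq_sum_card_fibres[symmetric]) auto
    also have "\<dots> = card {i. i < k \<and> strip Q N (fst (x i)) \<noteq> strip Q k i}"
      using g[OF x] by (intro arg_cong[of _ _ card]) auto
    finally show ?thesis .
  qed
  also have "M * (\<tau> * n) + real m * real (card {i. i < k \<and> strip Q N (fst (x i)) \<noteq> strip Q k i}) \<le>
      M * (\<tau> * n) + m * (Q * (k * (M * \<tau>)))"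
    using card_misplaced by (intro add_left_mono mult_left_mono) auto
  also have "\<dots> = (1 + Q) * (M * \<tau>) * n" by (simp add: n_eq algebra_simps)
  finally have cardZ: "real (card Z) \<le> (1 + Q) * (M * \<tau>) * n" .
  define \<phi> where "\<phi> = fst \<circ> h"
  have hV: "h z \<in> V" if "z \<in> cells N" for z using h(1) that by (auto simp: bij_betw_def)
  have \<phi>: "\<phi> z < k" if "z \<in> cells N" for z using hV[OF that] unfolding V_def \<phi>_def by auto
  have fib: "card {z\<in>cells N. \<phi> z = i} = m" if "i < k" for i
  proof -
    have "bij_betw h {z\<in>cells N. \<phi> z = i} {b\<in>V. fst b = i}"
      using h(1) unfolding bij_betw_def \<phi>_def by (auto intro: inj_on_subset)
    then have "card {z\<in>cells N. \<phi> z = i} = card {b\<in>V. fst b = i}" by (rule bij_betw_same_card)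
    also have "\<dots> = card {j. j < k \<and> j = i} * m" by (rule cardV)
    also have "{j. j < k \<and> j = i} = {i}" using that by auto
    finally show ?thesis by simp
  qed
  have near: "\<bar>real (fst z) / N - real (\<phi> z) / k\<bar> \<le> 1 / Q" if z: "z \<in> cells N" for z
  proof (rule strip_eq_imp_close)
    show "strip Q N (fst z) = strip Q k (\<phi> z)"
      using h(2)[OF z] g[OF z] unfolding \<mu>_def \<kappa>_def \<phi>_def by simp
  qed (use pos pos' in auto)
  have ok: "c z = c (x (\<phi> z))" if "z \<in> cells N - Z" for z
    using that unfolding Z_def \<mu>_def \<kappa>_def \<phi>_def by auto
  \<comment> \<open>Compare \<open>w\<close>, the step function, its version on the sample points and the graph, in this order.\<close>
  have cut1: "cut_le (cells N) (\<lambda>u v. w u v - B (c u) (c v)) (\<rho> * real n ^ 2)"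
    using cut_le_cycle4[OF finite_cells rho, of N "\<lambda>u v. w u v - B (c u) (c v)"] regular by simp
  let ?D2 = "\<lambda>u v. B (c u) (c v) - B (c (x (\<phi> u))) (c (x (\<phi> v)))"
  have cut2: "cut_le (cells N) ?D2 (2 * (1 + Q) * (M * \<tau>) * real n ^ 2)"
  proof (rule cut_le_L1)
    have "\<bar>?D2 u v\<bar> \<le> of_bool (u \<in> Z) + of_bool (v \<in> Z)" if "u \<in> cells N" "v \<in> cells N" for u v
    proof (cases "u \<in> Z \<or> v \<in> Z")
      case True
      have "\<bar>?D2 u v\<bar> \<le> 1" using B[of "c u" "c v"] B[of "c (x (\<phi> u))" "c (x (\<phi> v))"] by linarith
      then show ?thesis using True by auto
    next
      case False
      then show ?thesis using ok[of u] ok[of v] that by simp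
    qed
    then have "(\<Sum>u\<in>cells N. \<Sum>v\<in>cells N. \<bar>?D2 u v\<bar>) \<le>
      (\<Sum>u\<in>cells N. \<Sum>v\<in>cells N. of_bool (u \<in> Z) + of_bool (v \<in> Z))" by (intro sum_mono)
    also have "\<dots> = 2 * real n * real (card Z)"
    proof -
      have "cells N \<inter> Z = Z" unfolding Z_def by auto
      then show ?thesis by (simp add: sum.distrib of_bool_def sum.If_cases flip: sum_distrib_left)
    qed
    also have "\<dots> \<le> 2 * real n * ((1 + Q) * (M * \<tau>) * n)" using cardZ by (intro mult_left_mono) auto
    also have "\<dots> = 2 * (1 + Q) * (M * \<tau>) * real n ^ 2" by (simp add: power2_eq_square mult_ac)
    finally show "(\<Sum>u\<in>cells N. \<Sum>v\<in>cells N. \<bar>?D2 u v\<bar>) \<le> 2 * (1 + Q) * (M * \<tau>) * real n ^ 2" .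
  qed
  have "cut_le {..<k} (\<lambda>i j. adjacency E i j - B (c (x i)) (c (x j))) (\<rho> * real k ^ 2)"
    using cut_le_cycle4[OF _ rho, of "{..<k}"] sample_regular by simp
  then have "cut_le {..<k} (\<lambda>i j. B (c (x i)) (c (x j)) - adjacency E i j) (\<rho> * real k ^ 2)"
    by (subst cut_le_uminus[symmetric]) simp
  then have "cut_le (cells N) (\<lambda>z z'. B (c (x (\<phi> z))) (c (x (\<phi> z'))) - adjacency E (\<phi> z) (\<phi> z'))
      (real m ^ 2 * (\<rho> * real k ^ 2))"
    using \<phi> fib by (intro cut_le_pull[where V = "{..<k}"]) auto
  then have cut3: "cut_le (cells N) (\<lambda>z z'. B (c (x (\<phi> z))) (c (x (\<phi> z'))) - adjacency E (\<phi> z) (\<phi> z'))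
      (\<rho> * real n ^ 2)"
    by (rule cut_le_mono) (simp add: n_eq power_mult_distrib del: of_nat_mult, simp add: power_mult_distrib mult_ac)
  have "cut_le (cells N) (\<lambda>z z'. w z z' - adjacency E (\<phi> z) (\<phi> z'))
     (\<rho> * real n ^ 2 + 2 * (1 + Q) * (M * \<tau>) * real n ^ 2 + \<rho> * real n ^ 2)"
    using cut_le_add[OF cut_le_add[OF cut1 cut2] cut3] by (rule cut_le_cong[THEN iffD1, rotated]) simp
  then have "cut_le (cells N) (\<lambda>z z'. w z z' - adjacency E (\<phi> z) (\<phi> z'))
     ((2 * \<rho> + 2 * (1 + Q) * (M * \<tau>) + 1 / Q) * real n ^ 2)"
    by (rule cut_le_mono) (simp add: algebra_simps)
  moreover have "1 / Q \<le> 2 * \<rho> + 2 * (1 + Q) * (M * \<tau>) + 1 / Q" using rho tau by simp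
  then have "\<bar>real (fst z) / N - real (\<phi> z) / k\<bar> \<le> 2 * \<rho> + 2 * (1 + Q) * (M * \<tau>) + 1 / Q"
    if "z \<in> cells N" for z using near[OF that] by linarith
  ultimately show ?thesis unfolding models_def div_eq using \<phi> fib by blast
qed

end

section \<open>Random graphs sampled from a grid\<close>

definition pairs :: "nat \<Rightarrow> (nat \<times> nat) set" where "pairs k = {(i, j). i < j \<and> j < k}"

lemma finite_pairs [simp]: "finite (pairs k)"
  by (rule finite_subset[of _ "{..<k} \<times> {..<k}"]) (auto simp: pairs_def)

definition graph_prob :: "nat \<Rightarrow> ('a \<Rightarrow> 'a \<Rightarrow> real) \<Rightarrow> (nat \<Rightarrow> 'a) \<Rightarrow> (nat \<times> nat) set \<Rightarrow> real" where
  "graph_prob k w x E = (\<Prod>e\<in>pairs k. if e \<in> E then w (x (fst e)) (x (snd e)) else 1 - w (x (fst e)) (x (snd e)))"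

definition increasing_samples :: "nat \<Rightarrow> nat \<Rightarrow> (nat \<Rightarrow> nat \<times> nat) set" where
  "increasing_samples k N = {x \<in> {..<k} \<rightarrow>\<^sub>E cells N. \<forall>i j. i < j \<longrightarrow> j < k \<longrightarrow> fst (x i) < fst (x j)}"

text \<open>Samples with two points in one column are left out; they are negligible on a fine grid.\<close>

definition grid_density :: "nat \<Rightarrow> nat \<Rightarrow> (nat \<times> nat \<Rightarrow> nat \<times> nat \<Rightarrow> real) \<Rightarrow> (nat \<times> nat) set \<Rightarrow> real" where
  "grid_density k N w E = fact k * (\<Sum>x\<in>increasing_samples k N. graph_prob k w x E) / real (N * N) ^ k"

text \<open>Independence of the edges of a random graph: the sum over all graphs is the expansion of a product over
  the edges of sums of two terms, present and absent.\<close>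

lemma sum_edge_weights:
  fixes p q :: "'e \<Rightarrow> real"
  assumes P: "finite P" and S: "S \<subseteq> P"
  shows "(\<Sum>E\<in>Pow P. (\<Prod>e\<in>P. if e \<in> E then p e else 1 - p e) * (\<Prod>e\<in>S. of_bool (e \<in> E) - q e)) =
    (\<Prod>e\<in>S. p e - q e)"
proof -
  define u where "u e = p e * (if e \<in> S then 1 - q e else 1)" for e
  define v where "v e = (1 - p e) * (if e \<in> S then - q e else 1)" for e
  have "(\<Prod>e\<in>P. if e \<in> E then p e else 1 - p e) * (\<Prod>e\<in>S. of_bool (e \<in> E) - q e) =
      (\<Prod>e\<in>E. u e) * (\<Prod>e\<in>P - E. v e)" if E: "E \<in> Pow P" for E
  proof -
    have "(\<Prod>e\<in>S. of_bool (e \<in> E) - q e) = (\<Prod>e\<in>P. if e \<in> S then of_bool (e \<in> E) - q e else 1)"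
      using P S by (simp add: prod.inter_restrict[symmetric] Int_absorb1)
    then have "(\<Prod>e\<in>P. if e \<in> E then p e else 1 - p e) * (\<Prod>e\<in>S. of_bool (e \<in> E) - q e) =
      (\<Prod>e\<in>P. (if e \<in> E then p e else 1 - p e) * (if e \<in> S then of_bool (e \<in> E) - q e else 1))"
      by (simp add: prod.distrib)
    also have "\<dots> = (\<Prod>e\<in>P. if e \<in> E then u e else v e)"
      by (intro prod.cong) (auto simp: u_def v_def)
    also have "\<dots> = (\<Prod>e\<in>P \<inter> E. u e) * (\<Prod>e\<in>P \<inter> - E. v e)"
      using P by (simp add: prod.If_cases)
    also have "P \<inter> E = E" using E by auto
    also have "P \<inter> - E = P - E" by auto
    finally show ?thesis .
  qed
  then have "(\<Sum>E\<in>Pow P. (\<Prod>e\<in>P. if e \<in> E then p e else 1 - p e) * (\<Prod>e\<in>S. of_bool (e \<in> E) - q e)) =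
    (\<Sum>E\<in>Pow P. (\<Prod>e\<in>E. u e) * (\<Prod>e\<in>P - E. v e))" by (intro sum.cong) auto
  also have "\<dots> = (\<Prod>e\<in>P. u e + v e)" using prod_add[OF P, of u v] by simp
  also have "\<dots> = (\<Prod>e\<in>P. if e \<in> S then p e - q e else 1)"
    by (intro prod.cong) (auto simp: u_def v_def algebra_simps)
  also have "\<dots> = (\<Prod>e\<in>S. p e - q e)"
    using P S by (simp add: prod.inter_restrict[symmetric] Int_absorb1)
  finally show ?thesis .
qed

lemma sum_graph_prob: "(\<Sum>E\<in>Pow (pairs k). graph_prob k w x E) = 1"
  using sum_edge_weights[of "pairs k" "{}" "\<lambda>e. w (x (fst e)) (x (snd e))"]
  by (simp add: graph_prob_def)

lemma graph_prob_nonneg: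
  assumes "\<And>i j. i < k \<Longrightarrow> j < k \<Longrightarrow> 0 \<le> w (x i) (x j) \<and> w (x i) (x j) \<le> 1"
  shows "0 \<le> graph_prob k w x E"
  unfolding graph_prob_def using assms by (intro prod_nonneg) (auto simp: pairs_def)

text \<open>The four edges of a cycle through distinct vertices \<open>i, j, i', j'\<close> are distinct, hence
  independent, so the expectation of the product is the product of the expectations.\<close>

lemma expected_cycle:
  fixes b :: "nat \<Rightarrow> nat \<Rightarrow> real"
  assumes sym: "\<And>u v. u \<in> A \<Longrightarrow> v \<in> A \<Longrightarrow> w u v = w v u" and x: "\<And>i. i < k \<Longrightarrow> x i \<in> A"
    and lt: "i < k" "i' < k" "j < k" "j' < k" and dist: "distinct [i, i', j, j']"
  shows "(\<Sum>E\<in>Pow (pairs k). graph_prob k w x E * ((adjacency E i j - b i j) * (adjacency E i j' - b i j') *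
      (adjacency E i' j - b i' j) * (adjacency E i' j' - b i' j'))) =
    (w (x i) (x j) - b i j) * (w (x i) (x j') - b i j') * (w (x i') (x j) - b i' j) * (w (x i') (x j') - b i' j')"
proof -
  define o' where "o' i j = (min i j, max i j)" for i j :: nat
  define S where "S = {o' i j, o' i j', o' i' j, o' i' j'}"
  define q where "q e = (if fst e \<in> {i, i'} then b (fst e) (snd e) else b (snd e) (fst e))" for e
  define p where "p e = w (x (fst e)) (x (snd e))" for e
  have SP: "S \<subseteq> pairs k" using lt dist unfolding S_def o'_def pairs_def by (auto simp: min_def max_def)
  have four: "(\<Prod>e\<in>S. f e) = f (o' i j) * f (o' i j') * f (o' i' j) * f (o' i' j')" for f :: "nat \<times> nat \<Rightarrow> real"
  proof -
    have "o' i j \<notin> {o' i j', o' i' j, o' i' j'}" "o' i j' \<notin> {o' i' j, o' i' j'}" "o' i' j \<notin> {o' i' j'}"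
      using dist unfolding o'_def by (auto simp: min_def max_def split: if_splits)
    then show ?thesis unfolding S_def by (simp add: mult.assoc)
  qed
  have qo: "q (o' i j) = b i j" "q (o' i j') = b i j'" "q (o' i' j) = b i' j" "q (o' i' j') = b i' j'"
    using dist unfolding q_def o'_def by (auto simp: min_def max_def)
  have po: "p (o' s t) = w (x s) (x t)" if "s < k" "t < k" for s t
    using sym[OF x x] that unfolding p_def o'_def by (auto simp: min_def max_def)
  have ao: "adjacency E s t = of_bool (o' s t \<in> E)" if "E \<in> Pow (pairs k)" for E s t
    using that unfolding adjacency_def o'_def pairs_def by (auto simp: min_def max_def)
  have "(\<Sum>E\<in>Pow (pairs k). graph_prob k w x E * ((adjacency E i j - b i j) * (adjacency E i j' - b i j') *
      (adjacency E i' j - b i' j) * (adjacency E i' j' - b i' j'))) =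
    (\<Sum>E\<in>Pow (pairs k). (\<Prod>e\<in>pairs k. if e \<in> E then p e else 1 - p e) * (\<Prod>e\<in>S. of_bool (e \<in> E) - q e))"
    unfolding four qo graph_prob_def p_def by (intro sum.cong refl) (simp only: ao)
  also have "\<dots> = (\<Prod>e\<in>S. p e - q e)" by (rule sum_edge_weights[OF finite_pairs SP])
  finally show ?thesis unfolding four qo using po lt by simp
qed

lemma card_PiE_constrained:
  assumes "finite I" "J \<subseteq> I"
  shows "card {x \<in> I \<rightarrow>\<^sub>E A. \<forall>t\<in>J. P t (x t)} = (\<Prod>t\<in>J. card {a\<in>A. P t a}) * card A ^ card (I - J)"
proof -
  have "{x \<in> I \<rightarrow>\<^sub>E A. \<forall>t\<in>J. P t (x t)} = Pi\<^sub>E I (\<lambda>t. if t \<in> J then {a\<in>A. P t a} else A)"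
    using assms by (auto simp: PiE_iff extensional_def split: if_splits)
  then have "card {x \<in> I \<rightarrow>\<^sub>E A. \<forall>t\<in>J. P t (x t)} = (\<Prod>t\<in>I. card (if t \<in> J then {a\<in>A. P t a} else A))"
    using assms by (simp only: card_PiE)
  also have "\<dots> = (\<Prod>t\<in>I. if t \<in> J then card {a\<in>A. P t a} else card A)" by (intro prod.cong) auto
  also have "\<dots> = (\<Prod>t\<in>I \<inter> J. card {a\<in>A. P t a}) * (\<Prod>t\<in>I \<inter> - J. card A)"
    using assms by (simp add: prod.If_cases)
  also have "I \<inter> J = J" using assms by auto
  also have "I \<inter> - J = I - J" by auto
  finally show ?thesis by simp
qed

lemma sum_four_coordinates:
  fixes f :: "'a \<Rightarrow> 'a \<Rightarrow> 'a \<Rightarrow> 'a \<Rightarrow> real"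
  assumes A: "finite A" and lt: "i < k" "i' < k" "j < k" "j' < k" and dist: "distinct [i, i', j, j']"
  shows "(\<Sum>x\<in>{..<k} \<rightarrow>\<^sub>E A. f (x i) (x i') (x j) (x j')) =
    real (card A) ^ (k - 4) * (\<Sum>a\<in>A. \<Sum>a'\<in>A. \<Sum>b\<in>A. \<Sum>b'\<in>A. f a a' b b')"
proof -
  let ?X = "{..<k} \<rightarrow>\<^sub>E A"
  define T where "T x = (x i, x i', x j, x j')" for x :: "nat \<Rightarrow> 'a"
  define f' where "f' t = f (fst t) (fst (snd t)) (fst (snd (snd t))) (snd (snd (snd t)))" for t
  have fib: "card {x\<in>?X. T x = t} = card A ^ (k - 4)" if t: "t \<in> A \<times> A \<times> A \<times> A" for t
  proof -
    obtain a a' b b' where t': "t = (a, a', b, b')" by (cases t)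
    let ?J = "{i, i', j, j'}"
    define y where "y = (\<lambda>_. undefined)(i := a, i' := a', j := b, j' := b')"
    have y: "y i = a" "y i' = a'" "y j = b" "y j' = b'" using dist unfolding y_def by auto
    have "{x\<in>?X. T x = t} = {x\<in>?X. \<forall>s\<in>?J. x s = y s}" unfolding T_def t' using y by auto
    also have "card \<dots> = (\<Prod>s\<in>?J. card {a\<in>A. a = y s}) * card A ^ card ({..<k} - ?J)"
      using lt by (intro card_PiE_constrained) auto
    also have "(\<Prod>s\<in>?J. card {a\<in>A. a = y s}) = 1"
    proof (intro prod.neutral ballI)
      fix s assume "s \<in> ?J"
      then have "y s \<in> A" using t y unfolding t' by auto
      then have "{a\<in>A. a = y s} = {y s}" by auto
      then show "card {a\<in>A. a = y s} = 1" by simp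
    qed
    also have "card ({..<k} - ?J) = k - 4" using lt dist by (subst card_Diff_subset) auto
    finally show ?thesis by simp
  qed
  have "(\<Sum>x\<in>?X. f (x i) (x i') (x j) (x j')) = (\<Sum>x\<in>?X. f' (T x))" by (simp add: T_def f'_def)
  also have "\<dots> = (\<Sum>t\<in>A \<times> A \<times> A \<times> A. \<Sum>x\<in>{x\<in>?X. T x = t}. f' (T x))"
    using A lt by (intro sum.group[symmetric]) (auto simp: T_def intro!: finite_PiE)
  also have "\<dots> = (\<Sum>t\<in>A \<times> A \<times> A \<times> A. real (card A) ^ (k - 4) * f' t)"
    using fib by (intro sum.cong) auto
  also have "\<dots> = real (card A) ^ (k - 4) * (\<Sum>a\<in>A. \<Sum>a'\<in>A. \<Sum>b\<in>A. \<Sum>b'\<in>A. f a a' b b')"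
    by (simp add: sum_distrib_left[symmetric] sum.cartesian_product' f'_def)
  finally show ?thesis .
qed

text \<open>Points in general position have exactly one increasing enumeration, so each increasing sample
  arises from \<open>fact k\<close> unordered ones. Two permutations with the same order pattern agree, because
  each of them is recovered as the rank function of the pattern.\<close>

lemma compose_permutation_inj:
  "inj_on (\<lambda>(\<pi>, x). x \<circ> \<pi>) ({\<pi>. \<pi> permutes {..<k}} \<times> increasing_samples k N)"
proof (rule inj_onI, clarify)
  fix \<pi> x \<pi>' x'
  assume \<pi>: "\<pi> permutes {..<k}" "\<pi>' permutes {..<k}" and x: "x \<in> increasing_samples k N" "x' \<in> increasing_samples k N"
    and eq: "x \<circ> \<pi> = x' \<circ> \<pi>'"
  have rank: "\<rho> i = card {j. j < k \<and> \<rho> j < \<rho> i}" if \<rho>: "\<rho> permutes {..<k}" and i: "i < k" for \<rho> i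
  proof -
    have "\<rho> ` {j. j < k \<and> \<rho> j < \<rho> i} = {..<\<rho> i}"
    proof (intro set_eqI iffI)
      fix t assume t: "t \<in> {..<\<rho> i}"
      have "\<rho> i < k" using permutes_in_image[OF \<rho>, of i] i by simp
      then have "inv \<rho> t < k" using t permutes_in_image[OF permutes_inv[OF \<rho>], of t] by simp
      then show "t \<in> \<rho> ` {j. j < k \<and> \<rho> j < \<rho> i}" using t permutes_inverses(1)[OF \<rho>, of t]
        by (intro image_eqI[of _ _ "inv \<rho> t"]) auto
    qed auto
    then have "card {j. j < k \<and> \<rho> j < \<rho> i} = card {..<\<rho> i}"
      using permutes_inj[OF \<rho>] by (metis (no_types, lifting) card_image inj_on_subset subset_UNIV)
    then show ?thesis by simp
  qed
  have ord: "\<rho> i < \<rho> j \<longleftrightarrow> fst (z (\<rho> i)) < fst (z (\<rho> j))"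
    if "\<rho> permutes {..<k}" "z \<in> increasing_samples k N" "i < k" "j < k" for \<rho> z i j
  proof -
    have "\<rho> i < k" "\<rho> j < k" using permutes_in_image[OF that(1)] that(3,4) by auto
    then show ?thesis using that(2) unfolding increasing_samples_def
      by (metis (mono_tags, lifting) mem_Collect_eq less_asym less_irrefl linorder_neqE_nat)
  qed
  have "\<pi> i = \<pi>' i" for i
  proof (cases "i < k")
    case True
    have "\<pi> j < \<pi> i \<longleftrightarrow> \<pi>' j < \<pi>' i" if "j < k" for j
      using ord[OF \<pi>(1) x(1) that True] ord[OF \<pi>(2) x(2) that True] fun_cong[OF eq, of i] fun_cong[OF eq, of j] by simp
    then have "{j. j < k \<and> \<pi> j < \<pi> i} = {j. j < k \<and> \<pi>' j < \<pi>' i}" by auto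
    then show ?thesis using rank[OF \<pi>(1) True] rank[OF \<pi>(2) True] by simp
  next
    case False
    then show ?thesis using \<pi> by (simp add: permutes_def)
  qed
  then have 1: "\<pi> = \<pi>'" by auto
  have "x = x \<circ> \<pi> \<circ> inv \<pi>" using permutes_inverses(1)[OF \<pi>(1)] by (auto simp: fun_eq_iff)
  also have "\<dots> = x' \<circ> \<pi>' \<circ> inv \<pi>'" using eq 1 by simp
  also have "\<dots> = x'" using permutes_inverses(1)[OF \<pi>(2)] by (auto simp: fun_eq_iff)
  finally show "\<pi> = \<pi>' \<and> x = x'" using 1 by simp
qed

lemma compose_permutation_in:
  assumes "\<pi> permutes {..<k}" "x \<in> {..<k} \<rightarrow>\<^sub>E A"
  shows "x \<circ> \<pi> \<in> {..<k} \<rightarrow>\<^sub>E A"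
proof (intro PiE_I)
  fix i assume "i \<in> {..<k}"
  then show "(x \<circ> \<pi>) i \<in> A" using assms permutes_in_image[OF assms(1), of i] by auto
next
  fix i assume "i \<notin> {..<k}"
  then show "(x \<circ> \<pi>) i = undefined" using assms by (auto simp: permutes_def PiE_iff extensional_def)
qed

lemma sum_increasing_le:
  fixes g :: "(nat \<Rightarrow> nat \<times> nat) \<Rightarrow> real"
  assumes g0: "\<And>x. x \<in> {..<k} \<rightarrow>\<^sub>E cells N \<Longrightarrow> 0 \<le> g x"
    and sym: "\<And>x \<pi>. x \<in> {..<k} \<rightarrow>\<^sub>E cells N \<Longrightarrow> \<pi> permutes {..<k} \<Longrightarrow> g (x \<circ> \<pi>) = g x"
  shows "fact k * (\<Sum>x\<in>increasing_samples k N. g x) \<le> (\<Sum>x\<in>{..<k} \<rightarrow>\<^sub>E cells N. g x)"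
proof -
  let ?P = "{\<pi>. \<pi> permutes {..<k}}" and ?X = "{..<k} \<rightarrow>\<^sub>E cells N"
  have inc: "increasing_samples k N \<subseteq> ?X" unfolding increasing_samples_def by auto
  have "fact k * (\<Sum>x\<in>increasing_samples k N. g x) = (\<Sum>\<pi>\<in>?P. \<Sum>x\<in>increasing_samples k N. g x)"
    by (simp add: card_permutations)
  also have "\<dots> = (\<Sum>\<pi>\<in>?P. \<Sum>x\<in>increasing_samples k N. g (x \<circ> \<pi>))"
    using sym inc by (intro sum.cong refl) (metis mem_Collect_eq subsetD)
  also have "\<dots> = (\<Sum>p\<in>?P \<times> increasing_samples k N. g (case p of (\<pi>, x) \<Rightarrow> x \<circ> \<pi>))"
    by (simp add: sum.cartesian_product')
  also have "\<dots> = (\<Sum>y\<in>(\<lambda>(\<pi>, x). x \<circ> \<pi>) ` (?P \<times> increasing_samples k N). g y)"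
    by (subst sum.reindex[OF compose_permutation_inj], intro sum.cong refl) simp
  also have "\<dots> \<le> (\<Sum>x\<in>?X. g x)"
    using inc g0 by (intro sum_mono2) (auto intro!: finite_PiE compose_permutation_in)
  finally show ?thesis .
qed

lemma ex_sorting_permutation:
  fixes f :: "nat \<Rightarrow> nat"
  assumes "inj_on f {..<k}"
  shows "\<exists>\<pi>. \<pi> permutes {..<k} \<and> (\<forall>i j. i < j \<longrightarrow> j < k \<longrightarrow> f (\<pi> i) < f (\<pi> j))"
proof -
  let ?A = "f ` {..<k}"
  have cA: "card ?A = k" using assms by (simp add: card_image)
  define e where "e i = sorted_list_of_set ?A ! i" for i
  have len: "length (sorted_list_of_set ?A) = k" using cA by simp
  have e_lt: "e i < e j" if "i < j" "j < k" for i j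
    unfolding e_def using that strict_sorted_list_of_set[of ?A] len by (simp add: sorted_wrt_nth_less)
  have eA: "e i \<in> ?A" if "i < k" for i
    using that len nth_mem[of i "sorted_list_of_set ?A"] unfolding e_def by simp
  define \<pi> where "\<pi> i = (if i < k then inv_into {..<k} f (e i) else i)" for i
  have f\<pi>: "f (\<pi> i) = e i" if "i < k" for i
    using eA[OF that] that unfolding \<pi>_def by (simp add: f_inv_into_f)
  have "\<pi> permutes {..<k}"
  proof (rule bij_imp_permutes)
    have "inj_on \<pi> {..<k}"
    proof (rule inj_onI)
      fix i j assume ij: "i \<in> {..<k}" "j \<in> {..<k}" "\<pi> i = \<pi> j"
      then have "e i = e j" using f\<pi> by (metis lessThan_iff)
      then show "i = j" using e_lt[of i j] e_lt[of j i] ij(1,2) by (metis lessThan_iff less_irrefl linorder_neqE_nat)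
    qed
    moreover have "\<pi> ` {..<k} \<subseteq> {..<k}"
      using eA inv_into_into[of _ f "{..<k}"] unfolding \<pi>_def by fastforce
    ultimately show "bij_betw \<pi> {..<k} {..<k}"
      unfolding bij_betw_def by (metis endo_inj_surj finite_lessThan)
  qed (simp add: \<pi>_def)
  then show ?thesis using f\<pi> e_lt by (metis less_trans)
qed

text \<open>The only samples without an increasing enumeration are those with two points in one column.\<close>

lemma sum_grid_density_ge:
  assumes N: "N > 0"
  shows "1 - real k ^ 2 / N \<le> (\<Sum>E\<in>Pow (pairs k). grid_density k N w E)"
proof -
  let ?X = "{..<k} \<rightarrow>\<^sub>E cells N" and ?P = "{\<pi>. \<pi> permutes {..<k}}" and ?n = "real (N * N)"
  define tie where "tie i j = {x\<in>?X. fst (x i) = fst (x j)}" for i j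
  have finX: "finite ?X" by (intro finite_PiE) auto
  have fin_inc: "finite (increasing_samples k N)"
    by (rule finite_subset[OF _ finX]) (auto simp: increasing_samples_def)
  have cardX: "card ?X = (N * N) ^ k" by (simp add: card_PiE)
  have tie: "real (card (tie i j)) = ?n ^ k / N" if "i < k" "j < k" "i \<noteq> j" for i j
  proof -
    have k2: "k \<ge> 2" using that by linarith
    have "tie i j = {x\<in>?X. fst (x i) = fst (x j)}" by (simp add: tie_def)
    also have "\<dots> = (\<Union>q<N. {x\<in>?X. \<forall>t\<in>{i, j}. fst (x t) = q})"
      using that by (force simp: cells_def PiE_iff)
    also have "card \<dots> = (\<Sum>q<N. card {x\<in>?X. \<forall>t\<in>{i, j}. fst (x t) = q})"
      by (rule card_UN_disjoint) (auto intro!: finite_subset[OF _ finX])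
    also have "\<dots> = (\<Sum>q<N. N * N * (N * N) ^ (k - 2))"
    proof (intro sum.cong refl)
      fix q assume "q \<in> {..<N}"
      then have "{a\<in>cells N. fst a = q} = {q} \<times> {..<N}" unfolding cells_def by auto
      then have c: "card {a\<in>cells N. fst a = q} = N" by simp
      have "card {x\<in>?X. \<forall>t\<in>{i, j}. fst (x t) = q} = (\<Prod>t\<in>{i, j}. card {a\<in>cells N. fst a = q}) * card (cells N) ^ card ({..<k} - {i, j})"
        using that by (intro card_PiE_constrained) auto
      also have "\<dots> = N * N * (N * N) ^ (k - 2)" using that c by (simp add: card_Diff_subset numeral_2_eq_2)
      finally show "card {x\<in>?X. \<forall>t\<in>{i, j}. fst (x t) = q} = N * N * (N * N) ^ (k - 2)" .
    qed
    also have "\<dots> = N * (N * N) ^ (k - 1)"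
    proof -
      have "k - 1 = Suc (k - 2)" using k2 by simp
      then show ?thesis by simp
    qed
    finally have "N * card (tie i j) = (N * N) ^ Suc (k - 1)" by simp
    also have "Suc (k - 1) = k" using k2 by simp
    finally have "real N * card (tie i j) = ?n ^ k" by (metis of_nat_mult of_nat_power)
    then show ?thesis using N by (simp add: field_simps)
  qed
  have "?X \<subseteq> (\<lambda>(\<pi>, x). x \<circ> \<pi>) ` (?P \<times> increasing_samples k N) \<union> (\<Union>p\<in>{p\<in>{..<k} \<times> {..<k}. fst p \<noteq> snd p}. tie (fst p) (snd p))"
  proof
    fix x assume x: "x \<in> ?X"
    show "x \<in> (\<lambda>(\<pi>, x). x \<circ> \<pi>) ` (?P \<times> increasing_samples k N) \<union> (\<Union>p\<in>{p\<in>{..<k} \<times> {..<k}. fst p \<noteq> snd p}. tie (fst p) (snd p))"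
    proof (cases "inj_on (fst \<circ> x) {..<k}")
      case True
      then obtain \<pi> where \<pi>: "\<pi> permutes {..<k}" and lt: "\<And>i j. i < j \<Longrightarrow> j < k \<Longrightarrow> fst (x (\<pi> i)) < fst (x (\<pi> j))"
        using ex_sorting_permutation[OF True] by auto
      have "x \<circ> \<pi> \<in> increasing_samples k N"
        using lt compose_permutation_in[OF \<pi> x] unfolding increasing_samples_def by auto
      moreover have "x = (x \<circ> \<pi>) \<circ> inv \<pi>" using permutes_inverses(1)[OF \<pi>] by (auto simp: fun_eq_iff)
      ultimately show ?thesis using permutes_inv[OF \<pi>]
        by (intro UnI1 image_eqI[of _ _ "(inv \<pi>, x \<circ> \<pi>)"]) auto
    next
      case False
      then obtain i j where "i < k" "j < k" "i \<noteq> j" "fst (x i) = fst (x j)" unfolding inj_on_def by auto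
      then show ?thesis using x unfolding tie_def by (intro UnI2 UN_I[of "(i, j)"]) auto
    qed
  qed
  then have "card ?X \<le> card ((\<lambda>(\<pi>, x). x \<circ> \<pi>) ` (?P \<times> increasing_samples k N) \<union>
      (\<Union>p\<in>{p\<in>{..<k} \<times> {..<k}. fst p \<noteq> snd p}. tie (fst p) (snd p)))"
    by (intro card_mono) (auto simp: finite_permutations fin_inc tie_def intro!: finite_subset[OF _ finX])
  also have "\<dots> \<le> card ((\<lambda>(\<pi>, x). x \<circ> \<pi>) ` (?P \<times> increasing_samples k N)) +
      (\<Sum>p\<in>{p\<in>{..<k} \<times> {..<k}. fst p \<noteq> snd p}. card (tie (fst p) (snd p)))"
    by (rule order_trans[OF card_Un_le add_left_mono[OF card_UN_le]]) auto
  also have "card ((\<lambda>(\<pi>, x). x \<circ> \<pi>) ` (?P \<times> increasing_samples k N)) = fact k * card (increasing_samples k N)"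
    by (simp add: card_image[OF compose_permutation_inj] card_cartesian_product card_permutations)
  finally have "real (card ?X) \<le> real (fact k * card (increasing_samples k N) +
      (\<Sum>p\<in>{p\<in>{..<k} \<times> {..<k}. fst p \<noteq> snd p}. card (tie (fst p) (snd p))))"
    by (simp only: of_nat_le_iff)
  also have "\<dots> = fact k * card (increasing_samples k N) + (\<Sum>p\<in>{p\<in>{..<k} \<times> {..<k}. fst p \<noteq> snd p}. ?n ^ k / N)"
    unfolding of_nat_add of_nat_sum of_nat_mult of_nat_fact
    using tie by (intro arg_cong2[where f = "(+)"] sum.cong refl) auto
  also have "(\<Sum>p\<in>{p\<in>{..<k} \<times> {..<k}. fst p \<noteq> snd p}. ?n ^ k / N) \<le> (\<Sum>p\<in>{..<k} \<times> {..<k}. ?n ^ k / N)"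
    by (intro sum_mono2) auto
  also have "\<dots> = real k ^ 2 / N * ?n ^ k" by (simp add: power2_eq_square)
  finally have "?n ^ k \<le> fact k * card (increasing_samples k N) + real k ^ 2 / N * ?n ^ k"
    unfolding cardX by simp
  then have "(1 - real k ^ 2 / N) * ?n ^ k \<le> fact k * card (increasing_samples k N)" by (simp add: left_diff_distrib)
  then have "1 - real k ^ 2 / N \<le> fact k * card (increasing_samples k N) / ?n ^ k"
    using N by (subst pos_le_divide_eq) auto
  also have "\<dots> = (\<Sum>E\<in>Pow (pairs k). grid_density k N w E)"
    unfolding grid_density_def sum_divide_distrib[symmetric] sum_distrib_left[symmetric]
    by (subst sum.swap) (simp add: sum_graph_prob)
  finally show ?thesis .
qed

text \<open>A degenerate quadruple of vertices is estimated by one, which is harmless since there are only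
  of the order of \<open>k ^ 3\<close> of them.\<close>

definition cycle_bound :: "nat \<Rightarrow> ('a \<Rightarrow> 'a \<Rightarrow> real) \<Rightarrow> (nat \<Rightarrow> 'a) \<Rightarrow> real" where
  "cycle_bound k D x = (\<Sum>i<k. \<Sum>i'<k. \<Sum>j<k. \<Sum>j'<k. if distinct [i, i', j, j']
     then D (x i) (x j) * D (x i) (x j') * D (x i') (x j) * D (x i') (x j') else 1)"

lemma expected_cycle4_le:
  fixes B :: "'a \<Rightarrow> 'a \<Rightarrow> real"
  assumes sym: "\<And>u v. u \<in> A \<Longrightarrow> v \<in> A \<Longrightarrow> w u v = w v u"
    and w: "\<And>u v. u \<in> A \<Longrightarrow> v \<in> A \<Longrightarrow> 0 \<le> w u v \<and> w u v \<le> 1"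
    and B: "\<And>u v. 0 \<le> B u v \<and> B u v \<le> 1" and x: "\<And>i. i < k \<Longrightarrow> x i \<in> A"
  shows "(\<Sum>E\<in>Pow (pairs k). graph_prob k w x E * cycle4 {..<k} (\<lambda>i j. adjacency E i j - B (x i) (x j))) \<le>
    cycle_bound k (\<lambda>u v. w u v - B u v) x"
proof -
  let ?p = "\<lambda>E. graph_prob k w x E"
  let ?a = "\<lambda>E i j. adjacency E i j - B (x i) (x j)"
  have p0: "0 \<le> ?p E" for E using w x by (intro graph_prob_nonneg) auto
  have a1: "\<bar>?a E i j\<bar> \<le> 1" for E i j
    using B[of "x i" "x j"] unfolding adjacency_def by (auto simp: of_bool_def)
  have "(\<Sum>E\<in>Pow (pairs k). ?p E * cycle4 {..<k} (?a E)) =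
    (\<Sum>E\<in>Pow (pairs k). \<Sum>i<k. \<Sum>i'<k. \<Sum>j<k. \<Sum>j'<k. ?p E * (?a E i j * ?a E i j' * ?a E i' j * ?a E i' j'))"
    unfolding cycle4_def by (simp add: sum_distrib_left)
  also have "\<dots> = (\<Sum>q\<in>{..<k} \<times> {..<k} \<times> {..<k} \<times> {..<k}. \<Sum>E\<in>Pow (pairs k). case q of (i, i', j, j') \<Rightarrow>
      ?p E * (?a E i j * ?a E i j' * ?a E i' j * ?a E i' j'))"
    by (subst sum.swap) (simp add: sum.cartesian_product')
  also have "\<dots> \<le> (\<Sum>q\<in>{..<k} \<times> {..<k} \<times> {..<k} \<times> {..<k}. case q of (i, i', j, j') \<Rightarrow> if distinct [i, i', j, j']
     then (w (x i) (x j) - B (x i) (x j)) * (w (x i) (x j') - B (x i) (x j')) *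
        (w (x i') (x j) - B (x i') (x j)) * (w (x i') (x j') - B (x i') (x j')) else 1)"
  proof (intro sum_mono)
    fix q assume q: "q \<in> {..<k} \<times> {..<k} \<times> {..<k} \<times> {..<k}"
    obtain i i' j j' where q': "q = (i, i', j, j')" by (cases q)
    then have lt: "i \<in> {..<k}" "i' \<in> {..<k}" "j \<in> {..<k}" "j' \<in> {..<k}" using q by auto
    have "(\<Sum>E\<in>Pow (pairs k). ?p E * (?a E i j * ?a E i j' * ?a E i' j * ?a E i' j')) \<le>
      (if distinct [i, i', j, j']
     then (w (x i) (x j) - B (x i) (x j)) * (w (x i) (x j') - B (x i) (x j')) *
        (w (x i') (x j) - B (x i') (x j)) * (w (x i') (x j') - B (x i') (x j')) else 1)"
    proof (cases "distinct [i, i', j, j']")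
      case True
      then show ?thesis using lt
        using expected_cycle[where A = A and w = w and x = x and b = "\<lambda>i j. B (x i) (x j)", OF sym x _ _ _ _ True]
        by simp
    next
      case False
      have "(\<Sum>E\<in>Pow (pairs k). ?p E * (?a E i j * ?a E i j' * ?a E i' j * ?a E i' j')) \<le> (\<Sum>E\<in>Pow (pairs k). ?p E * 1)"
      proof (intro sum_mono mult_left_mono p0)
        fix E
        have "\<bar>?a E i j * ?a E i j' * ?a E i' j * ?a E i' j'\<bar> \<le> 1"
          unfolding abs_mult by (intro mult_le_one a1 mult_nonneg_nonneg abs_ge_zero)
        then show "?a E i j * ?a E i j' * ?a E i' j * ?a E i' j' \<le> 1" by linarith
      qed
      also have "\<dots> = 1" by (simp add: sum_graph_prob)
      finally show ?thesis using False by (simp only: if_False)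
    qed
    then show "(\<Sum>E\<in>Pow (pairs k). case q of (i, i', j, j') \<Rightarrow> ?p E * (?a E i j * ?a E i j' * ?a E i' j * ?a E i' j')) \<le>
      (case q of (i, i', j, j') \<Rightarrow> if distinct [i, i', j, j']
     then (w (x i) (x j) - B (x i) (x j)) * (w (x i) (x j') - B (x i) (x j')) *
        (w (x i') (x j) - B (x i') (x j)) * (w (x i') (x j') - B (x i') (x j')) else 1)"
      unfolding q' prod.case .
  qed
  also have "\<dots> = cycle_bound k (\<lambda>u v. w u v - B u v) x"
    unfolding cycle_bound_def by (simp add: sum.cartesian_product')
  finally show ?thesis .
qed

lemma cycle_bound_permute:
  assumes \<pi>: "\<pi> permutes {..<k}"
  shows "cycle_bound k D (x \<circ> \<pi>) = cycle_bound k D x"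
proof -
  define F where "F i i' j j' = (if distinct [i, i', j, j']
     then D (x i) (x j) * D (x i) (x j') * D (x i') (x j) * D (x i') (x j') else 1)" for i i' j j'
  have inj: "\<pi> s = \<pi> t \<longleftrightarrow> s = t" for s t using permutes_inj[OF \<pi>] by (auto dest: injD)
  have perm: "(\<Sum>i<k. f (\<pi> i)) = (\<Sum>i<k. f i)" for f :: "nat \<Rightarrow> real"
    using sum.permute[OF \<pi>, of f] by (simp add: o_def)
  have "cycle_bound k D (x \<circ> \<pi>) = (\<Sum>i<k. \<Sum>i'<k. \<Sum>j<k. \<Sum>j'<k. F (\<pi> i) (\<pi> i') (\<pi> j) (\<pi> j'))"
    unfolding cycle_bound_def F_def by (simp add: inj cong: if_cong)
  also have "\<dots> = (\<Sum>i<k. \<Sum>i'<k. \<Sum>j<k. \<Sum>j'<k. F i i' j j')"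
    by (subst perm[of "\<lambda>i. \<Sum>i'<k. \<Sum>j<k. \<Sum>j'<k. F i (\<pi> i') (\<pi> j) (\<pi> j')"],
        subst perm[of "\<lambda>i'. \<Sum>j<k. \<Sum>j'<k. F _ i' (\<pi> j) (\<pi> j')"],
        subst perm[of "\<lambda>j. \<Sum>j'<k. F _ _ j (\<pi> j')"], subst perm[of "F _ _ _"]) (rule refl)
  finally show ?thesis unfolding cycle_bound_def F_def .
qed

text \<open>Four different coordinates of a uniform sample are independent and uniform.\<close>

lemma sum_cycle_bound_le:
  assumes A: "finite A"
  shows "real (card A) ^ 4 * (\<Sum>x\<in>{..<k} \<rightarrow>\<^sub>E A. cycle_bound k D x) \<le>
    real (card A) ^ k * (real k ^ 4 * cycle4 A D + 6 * real k ^ 3 * real (card A) ^ 4)"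
proof -
  let ?X = "{..<k} \<rightarrow>\<^sub>E A" and ?n = "real (card A)"
  define F where "F x i i' j j' = (if distinct [i, i', j, j']
     then D (x i) (x j) * D (x i) (x j') * D (x i') (x j) * D (x i') (x j') else 1)" for x :: "nat \<Rightarrow> 'a" and i i' j j' :: nat
  define S where "S i i' j j' = (of_bool (i = i') + of_bool (i = j) + of_bool (i = j') + of_bool (i' = j) + of_bool (i' = j') + of_bool (j = j') :: real)" for i i' j j' :: nat
  have v0: "0 \<le> ?n ^ k * cycle4 A D" using cycle4_nonneg[of A D] by simp
  have cardX: "real (card ?X) = ?n ^ k" using A by (simp add: card_PiE)
  have one: "?n ^ 4 * (\<Sum>x\<in>?X. F x i i' j j') \<le> ?n ^ k * cycle4 A D + ?n ^ k * ?n ^ 4 * S i i' j j'"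
    if lt: "i < k" "i' < k" "j < k" "j' < k" for i i' j j'
  proof (cases "distinct [i, i', j, j']")
    case True
    have "4 \<le> k"
    proof -
      have "card {i, i', j, j'} \<le> card {..<k}" using lt by (intro card_mono) auto
      then show ?thesis using True by simp
    qed
    have "(\<Sum>x\<in>?X. F x i i' j j') = (\<Sum>x\<in>?X. D (x i) (x j) * D (x i) (x j') * D (x i') (x j) * D (x i') (x j'))"
      unfolding F_def using True by (simp only: if_True)
    also have "\<dots> = ?n ^ (k - 4) * cycle4 A D"
      unfolding cycle4_def by (rule sum_four_coordinates[OF A lt True])
    finally have "?n ^ 4 * (\<Sum>x\<in>?X. F x i i' j j') = (?n ^ 4 * ?n ^ (k - 4)) * cycle4 A D" by simp
    also have "?n ^ 4 * ?n ^ (k - 4) = ?n ^ k" using \<open>4 \<le> k\<close> by (simp flip: power_add)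
    finally show ?thesis by (simp add: S_def)
  next
    case False
    then have "(\<Sum>x\<in>?X. F x i i' j j') = ?n ^ k" using cardX unfolding F_def by (simp only: if_False) simp
    moreover have "1 \<le> S i i' j j'" using False by (auto simp: S_def)
    then have "?n ^ k * ?n ^ 4 * 1 \<le> ?n ^ k * ?n ^ 4 * S i i' j j'"
      by (intro mult_left_mono) auto
    ultimately show ?thesis using v0 by (simp add: mult_ac)
  qed
  have "(\<Sum>x\<in>?X. cycle_bound k D x) = (\<Sum>q\<in>{..<k} \<times> {..<k} \<times> {..<k} \<times> {..<k}. \<Sum>x\<in>?X. case q of (i, i', j, j') \<Rightarrow> F x i i' j j')"
    unfolding cycle_bound_def F_def by (subst sum.swap) (simp add: sum.cartesian_product')
  also have "\<dots> = (\<Sum>i<k. \<Sum>i'<k. \<Sum>j<k. \<Sum>j'<k. \<Sum>x\<in>?X. F x i i' j j')"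
    by (simp add: sum.cartesian_product')
  finally have "?n ^ 4 * (\<Sum>x\<in>?X. cycle_bound k D x) = (\<Sum>i<k. \<Sum>i'<k. \<Sum>j<k. \<Sum>j'<k. ?n ^ 4 * (\<Sum>x\<in>?X. F x i i' j j'))"
    by (simp only: sum_distrib_left)
  also have "\<dots> \<le> (\<Sum>i<k. \<Sum>i'<k. \<Sum>j<k. \<Sum>j'<k. ?n ^ k * cycle4 A D + ?n ^ k * ?n ^ 4 * S i i' j j')"
    using one by (intro sum_mono) auto
  also have "\<dots> = real k ^ 4 * (?n ^ k * cycle4 A D) + ?n ^ k * ?n ^ 4 * (\<Sum>i<k. \<Sum>i'<k. \<Sum>j<k. \<Sum>j'<k. S i i' j j')"
    by (simp add: sum.distrib power4_eq_xxxx mult.assoc flip: sum_distrib_left)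
  also have "(\<Sum>i<k. \<Sum>i'<k. \<Sum>j<k. \<Sum>j'<k. S i i' j j') = 6 * real k ^ 3"
    unfolding S_def by (simp add: sum.distrib of_bool_def sum.delta sum.delta' power3_eq_cube flip: sum_distrib_left cong: if_cong)
  finally show ?thesis by (simp add: algebra_simps)
qed

text \<open>Squares are taken because the expectation of this sum is a sum of variances.\<close>

definition count_deviation :: "nat \<Rightarrow> nat \<Rightarrow> (nat \<times> nat \<Rightarrow> nat) \<Rightarrow> nat \<Rightarrow> (nat \<Rightarrow> nat \<times> nat) \<Rightarrow> real" where
  "count_deviation k N c M x = (\<Sum>l<M. (real (card {z\<in>cells N. c z = l}) / (N * N) - real (card {i. i < k \<and> c (x i) = l}) / k)\<^sup>2)"

lemma count_deviation_permute:
  assumes \<pi>: "\<pi> permutes {..<k}"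
  shows "count_deviation k N c M (x \<circ> \<pi>) = count_deviation k N c M x"
proof -
  have "card {i. i < k \<and> c (x (\<pi> i)) = l} = card {i. i < k \<and> c (x i) = l}" for l
  proof (rule bij_betw_same_card)
    have "\<pi> i < k \<longleftrightarrow> i < k" for i using permutes_in_image[OF \<pi>, of i] by simp
    moreover have "\<exists>i'. i = \<pi> i'" for i using permutes_surj[OF \<pi>] by (metis surjD)
    ultimately show "bij_betw \<pi> {i. i < k \<and> c (x (\<pi> i)) = l} {i. i < k \<and> c (x i) = l}"
      using permutes_inj[OF \<pi>] unfolding bij_betw_def by (fastforce intro: inj_on_subset)
  qed
  then show ?thesis unfolding count_deviation_def by simp
qed

text \<open>The variance of a sum of independent centred variables bounded by one.\<close>

lemma sum_centred_square_le:
  fixes f :: "'a \<Rightarrow> real"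
  assumes A: "finite A" and centred: "(\<Sum>a\<in>A. f a) = 0" and f: "\<And>a. a \<in> A \<Longrightarrow> \<bar>f a\<bar> \<le> 1"
  shows "(\<Sum>x\<in>{..<k} \<rightarrow>\<^sub>E A. (\<Sum>i<k. f (x i))\<^sup>2) \<le> real k * real (card A) ^ k"
proof -
  let ?X = "{..<k} \<rightarrow>\<^sub>E A"
  have off: "(\<Sum>x\<in>?X. f (x i) * f (x j)) = 0" if "i < k" "j < k" "i \<noteq> j" for i j
  proof -
    have "(\<Sum>x\<in>?X. f (x i) * f (x j)) = (\<Sum>x\<in>?X. \<Prod>t<k. if t \<in> {i, j} then f (x t) else 1)"
    proof (intro sum.cong refl)
      fix x
      have "{..<k} \<inter> {i, j} = {i, j}" using that by auto
      then have "(\<Prod>t\<in>{i, j}. f (x t)) = (\<Prod>t<k. if t \<in> {i, j} then f (x t) else 1)"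
        using prod.inter_restrict[of "{..<k}" "\<lambda>t. f (x t)" "{i, j}"] by simp
      then show "f (x i) * f (x j) = (\<Prod>t<k. if t \<in> {i, j} then f (x t) else 1)" using that by simp
    qed
    also have "\<dots> = (\<Prod>t<k. \<Sum>a\<in>A. if t \<in> {i, j} then f a else 1)"
      using A by (subst prod_sum_PiE) auto
    also have "\<dots> = 0" using that centred by (auto intro!: prod_zero bexI[of _ i])
    finally show ?thesis .
  qed
  have diag: "(\<Sum>x\<in>?X. f (x i) * f (x i)) \<le> real (card A) ^ k" if "i < k" for i
  proof -
    have "(\<Sum>x\<in>?X. f (x i) * f (x i)) \<le> (\<Sum>x\<in>?X. 1)"
    proof (rule sum_mono)
      fix x assume "x \<in> ?X"
      then have "\<bar>f (x i)\<bar> \<le> 1" using that f by auto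
      then show "f (x i) * f (x i) \<le> 1" by (metis abs_square_le_1 power2_eq_square)
    qed
    then show ?thesis using A by (simp add: card_PiE)
  qed
  have "(\<Sum>x\<in>?X. (\<Sum>i<k. f (x i))\<^sup>2) = (\<Sum>i<k. \<Sum>j<k. \<Sum>x\<in>?X. f (x i) * f (x j))"
  proof -
    have "(\<Sum>x\<in>?X. (\<Sum>i<k. f (x i))\<^sup>2) = (\<Sum>x\<in>?X. \<Sum>i<k. \<Sum>j<k. f (x i) * f (x j))"
      by (simp add: power2_eq_square sum_product)
    also have "\<dots> = (\<Sum>i<k. \<Sum>x\<in>?X. \<Sum>j<k. f (x i) * f (x j))" by (rule sum.swap)
    also have "\<dots> = (\<Sum>i<k. \<Sum>j<k. \<Sum>x\<in>?X. f (x i) * f (x j))" by (intro sum.cong refl sum.swap)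
    finally show ?thesis .
  qed
  also have "\<dots> \<le> (\<Sum>i<k. \<Sum>j<k. if j = i then real (card A) ^ k else 0)"
    using off diag by (intro sum_mono) auto
  also have "\<dots> = real k * real (card A) ^ k" by simp
  finally show ?thesis .
qed

lemma sum_count_deviation_le:
  assumes k: "k > 0" and N: "N > 0"
  shows "(\<Sum>x\<in>{..<k} \<rightarrow>\<^sub>E cells N. count_deviation k N c M x) \<le> real M / k * real (N * N) ^ k"
proof -
  let ?X = "{..<k} \<rightarrow>\<^sub>E cells N" and ?n = "real (N * N)"
  have "(\<Sum>x\<in>?X. (real (card {z\<in>cells N. c z = l}) / ?n - real (card {i. i < k \<and> c (x i) = l}) / k)\<^sup>2) \<le> ?n ^ k / k" for l
  proof -
    define p where "p = real (card {z\<in>cells N. c z = l}) / ?n"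
    define f where "f a = of_bool (c a = l) - p" for a
    have "card {z\<in>cells N. c z = l} \<le> card (cells N)" by (intro card_mono) auto
    then have "real (card {z\<in>cells N. c z = l}) \<le> ?n" unfolding card_cells of_nat_le_iff .
    then have p: "0 \<le> p" "p \<le> 1" using N unfolding p_def by (auto simp: divide_le_eq_1)
    have "(\<Sum>a\<in>cells N. of_bool (c a = l)) = real (card {z\<in>cells N. c z = l})"
      by (simp add: of_bool_def sum.If_cases Int_def)
    then have centred: "(\<Sum>a\<in>cells N. f a) = 0" using N unfolding f_def p_def by (simp add: sum_subtractf)
    have eq: "(p - real (card {i. i < k \<and> c (x i) = l}) / k)\<^sup>2 = (\<Sum>i<k. f (x i))\<^sup>2 / real k ^ 2" for x
    proof -
      have "(\<Sum>i<k. f (x i)) = real (card {i. i < k \<and> c (x i) = l}) - k * p"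
        unfolding f_def by (simp add: sum_subtractf of_bool_def sum.If_cases Int_def)
      then have "(\<Sum>i<k. f (x i)) / k = real (card {i. i < k \<and> c (x i) = l}) / k - p" using k by (simp add: field_simps)
      then show ?thesis by (metis power2_commute power_divide)
    qed
    have "(\<Sum>x\<in>?X. (p - real (card {i. i < k \<and> c (x i) = l}) / k)\<^sup>2) = (\<Sum>x\<in>?X. (\<Sum>i<k. f (x i))\<^sup>2) / real k ^ 2"
      unfolding eq by (simp add: sum_divide_distrib)
    also have "\<dots> \<le> (real k * real (card (cells N)) ^ k) / real k ^ 2"
      using centred p by (intro divide_right_mono sum_centred_square_le) (auto simp: f_def abs_if)
    also have "\<dots> = ?n ^ k / k" using k by (simp add: power2_eq_square)
    finally show ?thesis unfolding p_def .
  qed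
  then have "(\<Sum>l<M. \<Sum>x\<in>?X. (real (card {z\<in>cells N. c z = l}) / ?n - real (card {i. i < k \<and> c (x i) = l}) / k)\<^sup>2) \<le> (\<Sum>l<M. ?n ^ k / k)"
    by (intro sum_mono)
  then show ?thesis unfolding count_deviation_def by (subst sum.swap) simp
qed

lemma models_mono:
  assumes "models k N \<epsilon> w E" "\<epsilon> \<le> \<epsilon>'"
  shows "models k N \<epsilon>' w E"
proof -
  obtain \<phi> where \<phi>: "\<forall>z\<in>cells N. \<phi> z < k" "\<forall>i<k. card {z\<in>cells N. \<phi> z = i} = N * N div k"
     "\<forall>z\<in>cells N. \<bar>real (fst z) / N - real (\<phi> z) / k\<bar> \<le> \<epsilon>"
     "cut_le (cells N) (\<lambda>z z'. w z z' - adjacency E (\<phi> z) (\<phi> z')) (\<epsilon> * real (N * N) ^ 2)"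
    using assms(1) unfolding models_def by blast
  have "cut_le (cells N) (\<lambda>z z'. w z z' - adjacency E (\<phi> z) (\<phi> z')) (\<epsilon>' * real (N * N) ^ 2)"
    using \<phi>(4) by (rule cut_le_mono) (use assms(2) in \<open>auto intro: mult_right_mono\<close>)
  moreover have "\<forall>z\<in>cells N. \<bar>real (fst z) / N - real (\<phi> z) / k\<bar> \<le> \<epsilon>'"
    using \<phi>(3) assms(2) by (blast intro: order_trans)
  ultimately show ?thesis using \<phi>(1,2) unfolding models_def by blast
qed

section \<open>The finite inverse counting lemma\<close>

text \<open>If a sample and its graph are not typical, then the cycle count of the error or the deviation of
  the type counts exceeds its threshold. Both are symmetric functions of the sample, at least after
  averaging over the graph, so their expectations over increasing samples are bounded by those over
  independent points, and Markov's inequality applies.\<close>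

lemma sampling:
  fixes \<epsilon> :: real
  assumes e: "\<epsilon> > 0"
  shows "\<exists>k>0. \<forall>N'>0. \<forall>w. (\<forall>u\<in>cells (k * N'). \<forall>v\<in>cells (k * N'). w u v = w v u \<and> 0 \<le> w u v \<and> w u v \<le> 1) \<longrightarrow>
       (\<Sum>E\<in>{E\<in>Pow (pairs k). \<not> models k (k * N') \<epsilon> w E}. grid_density k (k * N') w E) \<le> 1 / 4"
proof -
  \<comment> \<open>The three summands \<open>2 * \<rho>\<close>, \<open>2 * (1 + Q) * (M * \<tau>)\<close> and \<open>1 / Q\<close> of the error in
    \<open>typical_models\<close> get a third of \<open>\<epsilon>\<close> each.\<close>
  define \<rho> where "\<rho> = \<epsilon> / 6"
  have rho: "\<rho> > 0" using e unfolding \<rho>_def by simp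
  obtain Q :: nat where Q: "1 < real Q * (\<epsilon> / 3)" using ex_less_of_nat_mult[of "\<epsilon> / 3" 1] e by auto
  then have Q0: "Q > 0" by (cases "Q = 0") auto
  have Qe: "1 / Q \<le> \<epsilon> / 3" using Q Q0 by (simp add: field_simps)
  have rho16: "0 < \<rho> ^ 4 / 16" using rho by simp
  obtain M :: nat where M: "\<forall>(A :: (nat \<times> nat) set) w s. finite A \<longrightarrow> (\<forall>u\<in>A. \<forall>v\<in>A. 0 \<le> w u v \<and> w u v \<le> 1) \<longrightarrow>
       (\<forall>u\<in>A. s u < Q) \<longrightarrow>
       (\<exists>(c :: nat \<times> nat \<Rightarrow> nat) (B :: nat \<Rightarrow> nat \<Rightarrow> real) (g :: nat \<Rightarrow> nat).
          (\<forall>u\<in>A. c u < M) \<and> (\<forall>u\<in>A. s u = g (c u)) \<and> (\<forall>k l. 0 \<le> B k l \<and> B k l \<le> 1) \<and>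
          cycle4 A (\<lambda>u v. w u v - B (c u) (c v)) \<le> \<rho> ^ 4 / 16 * real (card A) ^ 4)"
    using weak_regularity[where 'a = "nat \<times> nat" and \<epsilon> = "\<rho> ^ 4 / 16" and Q = Q, OF rho16] by (rule exE) (rule that)
  define \<tau> where "\<tau> = \<epsilon> / (6 * (1 + real Q)) / (real M + 1)"
  have tau: "\<tau> > 0" using e unfolding \<tau>_def by (intro divide_pos_pos) auto
  have taue: "2 * (1 + Q) * (M * \<tau>) \<le> \<epsilon> / 3"
  proof -
    have "2 * a * (m * (\<epsilon> / (6 * a) / b)) = \<epsilon> / 3 * (m / b)" if "a > 0" "b > 0" for a b m :: real
      using that by (simp add: field_simps)
    then have "2 * (1 + real Q) * (M * \<tau>) = (\<epsilon> / 3) * (real M / (real M + 1))"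
      unfolding \<tau>_def by (meson add_nonneg_pos add_pos_nonneg of_nat_0_le_iff zero_less_one)
    also have "\<dots> \<le> (\<epsilon> / 3) * 1" using e by (intro mult_left_mono) auto
    finally show ?thesis by simp
  qed
  \<comment> \<open>A sample so large that the degenerate cycles and the variance of the type counts each contribute
    at most \<open>1 / 16\<close> to the bounds from Markov's inequality.\<close>
  obtain r :: nat where r: "96 / \<rho> ^ 4 + 16 * M / \<tau>\<^sup>2 < r" using reals_Archimedean2 by blast
  have nonneg: "0 \<le> 96 / \<rho> ^ 4" "0 \<le> 16 * M / \<tau>\<^sup>2" using rho by auto
  then have "0 < real r" using r by linarith
  then have r0: "r > 0" by simp
  define k where "k = Q * r"
  have k0: "k > 0" using Q0 r0 unfolding k_def by simp
  have "r \<le> k" using Q0 unfolding k_def by simp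
  then have "real r \<le> real k" by simp
  then have kr: "96 / \<rho> ^ 4 \<le> k" "16 * M / \<tau>\<^sup>2 \<le> k" using r nonneg by linarith+
  have k1: "6 / (\<rho> ^ 4 * k) \<le> 1 / 16"
  proof -
    have "6 / (b * c) \<le> 1 / 16" if "96 / b \<le> c" "b > 0" "c > 0" for b c :: real
      using that by (simp add: field_simps)
    then show ?thesis using kr(1) rho k0 by simp
  qed
  have k2: "M / k / \<tau>\<^sup>2 \<le> 1 / 16"
  proof -
    have "a / c / b \<le> 1 / 16" if "16 * a / b \<le> c" "b > 0" "c > 0" for a b c :: real
      using that by (simp add: field_simps)
    then show ?thesis using kr(2) tau k0 by simp
  qed
  show ?thesis
  proof (intro exI[of _ k] conjI k0 allI impI)
    fix N' :: nat and w :: "nat \<times> nat \<Rightarrow> nat \<times> nat \<Rightarrow> real"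
    define N where "N = k * N'"
    assume N': "N' > 0" and w': "\<forall>u\<in>cells (k * N'). \<forall>v\<in>cells (k * N'). w u v = w v u \<and> 0 \<le> w u v \<and> w u v \<le> 1"
    have w: "w u v = w v u" "0 \<le> w u v \<and> w u v \<le> 1" if "u \<in> cells N" "v \<in> cells N" for u v
      using w' that unfolding N_def by auto
    have N0: "N > 0" using k0 N' unfolding N_def by simp
    let ?n = "real (N * N)" and ?X = "{..<k} \<rightarrow>\<^sub>E cells N"
    have n0: "?n > 0" using N0 by simp
    have strip_lt: "strip Q N (fst u) < Q" if "u \<in> cells N" for u
      using N0 Q0 that unfolding strip_def cells_def by (auto simp: div_less_iff_less_mult mult.commute)
    have "\<exists>(c :: nat \<times> nat \<Rightarrow> nat) (B :: nat \<Rightarrow> nat \<Rightarrow> real) (g :: nat \<Rightarrow> nat).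
          (\<forall>u\<in>cells N. c u < M) \<and> (\<forall>u\<in>cells N. strip Q N (fst u) = g (c u)) \<and> (\<forall>k l. 0 \<le> B k l \<and> B k l \<le> 1) \<and>
          cycle4 (cells N) (\<lambda>u v. w u v - B (c u) (c v)) \<le> (\<rho> ^ 4 / 16) * real (card (cells N)) ^ 4"
      by (rule M[rule_format]) (use w strip_lt in auto)
    then obtain c :: "nat \<times> nat \<Rightarrow> nat" and B :: "nat \<Rightarrow> nat \<Rightarrow> real" and g :: "nat \<Rightarrow> nat" where
      c: "\<And>u. u \<in> cells N \<Longrightarrow> c u < M" and g: "\<And>u. u \<in> cells N \<Longrightarrow> strip Q N (fst u) = g (c u)" and
      B: "\<And>k l. 0 \<le> B k l \<and> B k l \<le> 1" and
      reg: "cycle4 (cells N) (\<lambda>u v. w u v - B (c u) (c v)) \<le> (\<rho> ^ 4 / 16) * ?n ^ 4"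
      unfolding card_cells by blast
    define D where "D u v = w u v - B (c u) (c v)" for u v
    define T where "T x E = cycle4 {..<k} (\<lambda>i j. adjacency E i j - B (c (x i)) (c (x j)))" for x E
    define V where "V x = count_deviation k N c M x / \<tau>\<^sup>2" for x
    define G where "G x = cycle_bound k D x / (\<rho> ^ 4 * real k ^ 4) + V x" for x
    let ?p = "\<lambda>x E. graph_prob k w x E"
    have p0: "0 \<le> ?p x E" if "x \<in> ?X" for x E by (intro graph_prob_nonneg w(2)) (use that in auto)
    have V0: "0 \<le> V x" for x unfolding V_def count_deviation_def by (intro divide_nonneg_nonneg sum_nonneg) auto
    have T0: "0 \<le> T x E / (\<rho> ^ 4 * real k ^ 4)" for x E unfolding T_def
      by (intro divide_nonneg_nonneg cycle4_nonneg mult_nonneg_nonneg) (use rho in auto)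
    have bad: "1 \<le> T x E / (\<rho> ^ 4 * real k ^ 4) + V x"
      if x: "x \<in> increasing_samples k N" and no: "\<not> models k N \<epsilon> w E" for x E
    proof (rule ccontr)
      have P0: "0 < \<rho> ^ 4 * real k ^ 4" using rho k0 by simp
      assume "\<not> ?thesis"
      then have "T x E / (\<rho> ^ 4 * real k ^ 4) < 1" "V x < 1" using V0[of x] T0[of x E] by linarith+
      then have T1: "T x E \<le> \<rho> ^ 4 * real k ^ 4" and V1: "count_deviation k N c M x \<le> \<tau>\<^sup>2"
        using P0 tau unfolding V_def by (simp_all add: pos_divide_less_eq less_imp_le)
      interpret typical_sample Q r N' M k N \<rho> \<tau> w c B g x E
      proof
        have "\<rho> ^ 4 / 16 * ?n ^ 4 \<le> \<rho> ^ 4 * ?n ^ 4" using rho by (intro mult_right_mono) auto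
        then show "cycle4 (cells N) (\<lambda>u v. w u v - B (c u) (c v)) \<le> \<rho> ^ 4 * real (N * N) ^ 4"
          using reg by (rule order_trans[rotated])
        show "fst (x i) \<le> fst (x j)" if "i \<le> j" "j < k" for i j
          using x that unfolding increasing_samples_def by (cases "i = j") (auto simp: less_imp_le)
        show "\<bar>real (card {z \<in> cells N. c z = l}) / real (N * N) - real (card {i. i < k \<and> c (x i) = l}) / real k\<bar> \<le> \<tau>"
          if l: "l < M" for l
        proof -
          have "(real (card {z \<in> cells N. c z = l}) / real (N * N) - real (card {i. i < k \<and> c (x i) = l}) / real k)\<^sup>2 \<le> count_deviation k N c M x"
            unfolding count_deviation_def using l by (intro member_le_sum) auto
          from order_trans[OF this V1] show ?thesis using tau by (simp only: power2_le_iff_abs_le less_imp_le)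
        qed
        show "x i \<in> cells N" if "i < k" for i using x that unfolding increasing_samples_def by auto
      qed (use Q0 r0 N' k_def N_def c g B rho tau T1 T_def in auto)
      have "2 * \<rho> + 2 * (1 + Q) * (M * \<tau>) + 1 / Q \<le> \<epsilon>" using taue Qe unfolding \<rho>_def by simp
      then show False using models_mono[OF typical_models] no by simp
    qed
    have ET: "(\<Sum>E\<in>Pow (pairs k). ?p x E * T x E) \<le> cycle_bound k D x" if "x \<in> ?X" for x
      unfolding T_def D_def
      by (rule expected_cycle4_le[of "cells N"]) (use w B that in auto)
    have G1: "(\<Sum>E\<in>Pow (pairs k). ?p x E * (T x E / (\<rho> ^ 4 * real k ^ 4) + V x)) \<le> G x" if "x \<in> ?X" for x
    proof -
      have "(\<Sum>E\<in>Pow (pairs k). ?p x E * (T x E / (\<rho> ^ 4 * real k ^ 4) + V x)) =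
        (\<Sum>E\<in>Pow (pairs k). ?p x E * T x E) / (\<rho> ^ 4 * real k ^ 4) + (\<Sum>E\<in>Pow (pairs k). ?p x E) * V x"
        by (simp add: distrib_left sum.distrib sum_divide_distrib sum_distrib_right)
      also have "\<dots> \<le> G x" unfolding G_def sum_graph_prob using ET[OF that] rho
        by (simp add: divide_right_mono)
      finally show ?thesis .
    qed
    have G0: "0 \<le> G x" if "x \<in> ?X" for x
      using p0[OF that] T0 V0 by (intro order_trans[OF sum_nonneg G1[OF that]]) auto
    have Gsym: "G (x \<circ> \<pi>) = G x" if "\<pi> permutes {..<k}" for x \<pi>
      unfolding G_def V_def cycle_bound_permute[OF that] count_deviation_permute[OF that] ..
    have sub: "increasing_samples k N \<subseteq> ?X" unfolding increasing_samples_def by auto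
    have "(\<Sum>E\<in>{E\<in>Pow (pairs k). \<not> models k N \<epsilon> w E}. grid_density k N w E) =
      fact k * (\<Sum>x\<in>increasing_samples k N. \<Sum>E\<in>{E\<in>Pow (pairs k). \<not> models k N \<epsilon> w E}. ?p x E) / ?n ^ k"
      unfolding grid_density_def sum_divide_distrib[symmetric] sum_distrib_left[symmetric] by (subst sum.swap) (rule refl)
    also have "\<dots> \<le> fact k * (\<Sum>x\<in>increasing_samples k N. G x) / ?n ^ k"
    proof (intro divide_right_mono mult_left_mono sum_mono)
      fix x assume x: "x \<in> increasing_samples k N"
      then have xX: "x \<in> ?X" using sub by auto
      have "(\<Sum>E\<in>{E\<in>Pow (pairs k). \<not> models k N \<epsilon> w E}. ?p x E) \<le>
        (\<Sum>E\<in>{E\<in>Pow (pairs k). \<not> models k N \<epsilon> w E}. ?p x E * (T x E / (\<rho> ^ 4 * real k ^ 4) + V x))"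
      proof (rule sum_mono)
        fix E assume "E \<in> {E\<in>Pow (pairs k). \<not> models k N \<epsilon> w E}"
        then have "?p x E * 1 \<le> ?p x E * (T x E / (\<rho> ^ 4 * real k ^ 4) + V x)"
          using bad[OF x] by (intro mult_left_mono p0[OF xX]) auto
        then show "?p x E \<le> ?p x E * (T x E / (\<rho> ^ 4 * real k ^ 4) + V x)" by simp
      qed
      also have "\<dots> \<le> (\<Sum>E\<in>Pow (pairs k). ?p x E * (T x E / (\<rho> ^ 4 * real k ^ 4) + V x))"
        using p0[OF xX] T0 V0 by (intro sum_mono2) auto
      also have "\<dots> \<le> G x" by (rule G1[OF xX])
      finally show "(\<Sum>E\<in>{E\<in>Pow (pairs k). \<not> models k N \<epsilon> w E}. ?p x E) \<le> G x" .
    qed auto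
    also have "\<dots> \<le> (\<Sum>x\<in>?X. G x) / ?n ^ k"
      using G0 Gsym by (intro divide_right_mono sum_increasing_le) auto
    also have "\<dots> \<le> 1 / 4"
    proof -
      let ?S = "\<Sum>x\<in>?X. cycle_bound k D x"
      have "?n ^ 4 * ?S \<le> ?n ^ k * (real k ^ 4 * cycle4 (cells N) D + 6 * real k ^ 3 * ?n ^ 4)"
        using sum_cycle_bound_le[of "cells N" k D] by simp
      also have "\<dots> \<le> ?n ^ k * (real k ^ 4 * ((\<rho> ^ 4 / 16) * ?n ^ 4) + 6 * real k ^ 3 * ?n ^ 4)"
        using reg unfolding D_def by (intro mult_left_mono add_right_mono) auto
      also have "\<dots> = ?n ^ 4 * (?n ^ k * (real k ^ 4 * (\<rho> ^ 4 / 16) + 6 * real k ^ 3))"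
        by (simp add: algebra_simps)
      finally have "?S \<le> ?n ^ k * (real k ^ 4 * (\<rho> ^ 4 / 16) + 6 * real k ^ 3)"
        using n0 by (simp only: mult_le_cancel_left_pos zero_less_power)
      then have "?S / (\<rho> ^ 4 * real k ^ 4) \<le> ?n ^ k * (real k ^ 4 * (\<rho> ^ 4 / 16) + 6 * real k ^ 3) / (\<rho> ^ 4 * real k ^ 4)"
        using rho by (intro divide_right_mono) auto
      also have "\<dots> = ?n ^ k * (1 / 16 + 6 / (\<rho> ^ 4 * k))"
        using rho k0 by (simp add: field_simps power4_eq_xxxx power3_eq_cube)
      also have "\<dots> \<le> ?n ^ k * (1 / 8)" using k1 by (intro mult_left_mono) auto
      finally have 1: "?S / (\<rho> ^ 4 * real k ^ 4) \<le> ?n ^ k * (1 / 8)" .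
      have "(\<Sum>x\<in>?X. V x) = (\<Sum>x\<in>?X. count_deviation k N c M x) / \<tau>\<^sup>2"
        unfolding V_def by (simp add: sum_divide_distrib)
      also have "\<dots> \<le> (M / k * ?n ^ k) / \<tau>\<^sup>2" by (intro divide_right_mono sum_count_deviation_le k0 N0) auto
      also have "\<dots> = ?n ^ k * (M / k / \<tau>\<^sup>2)" by simp
      also have "\<dots> \<le> ?n ^ k * (1 / 16)" using k2 by (intro mult_left_mono) auto
      finally have 2: "(\<Sum>x\<in>?X. V x) \<le> ?n ^ k * (1 / 16)" .
      have "(\<Sum>x\<in>?X. G x) = ?S / (\<rho> ^ 4 * real k ^ 4) + (\<Sum>x\<in>?X. V x)"
        unfolding G_def by (simp add: sum.distrib sum_divide_distrib)
      also have "\<dots> \<le> ?n ^ k * (1 / 8) + ?n ^ k * (1 / 16)" using 1 2 by linarith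
      also have "\<dots> \<le> (1 / 4) * ?n ^ k" using n0 by (simp add: field_simps)
      finally show ?thesis using n0 by (simp add: pos_divide_le_eq)
    qed
    finally show "(\<Sum>E\<in>{E\<in>Pow (pairs k). \<not> models k (k * N') \<epsilon> w E}. grid_density k (k * N') w E) \<le> 1 / 4"
      unfolding N_def .
  qed
qed

text \<open>A graph that models both grids serves as a common blueprint: cells are matched when they lie
  in pieces of the same vertex.\<close>

lemma common_model_imp_close:
  assumes N: "N > 0" and k: "k > 0" and m: "models k N \<epsilon> w E" and m': "models k N \<epsilon> w' E"
  shows "\<exists>\<sigma>. bij_betw \<sigma> (cells N) (cells N) \<and>
    (\<forall>z\<in>cells N. \<bar>real (fst z) / N - real (fst (\<sigma> z)) / N\<bar> \<le> 2 * \<epsilon>) \<and>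
    cut_le (cells N) (\<lambda>z z'. w z z' - w' (\<sigma> z) (\<sigma> z')) (2 * \<epsilon> * real (N * N) ^ 2)"
proof -
  obtain \<phi> where \<phi>: "\<And>z. z \<in> cells N \<Longrightarrow> \<phi> z < k" "\<And>i. i < k \<Longrightarrow> card {z\<in>cells N. \<phi> z = i} = N * N div k"
     "\<And>z. z \<in> cells N \<Longrightarrow> \<bar>real (fst z) / N - real (\<phi> z) / k\<bar> \<le> \<epsilon>"
     and cut: "cut_le (cells N) (\<lambda>z z'. w z z' - adjacency E (\<phi> z) (\<phi> z')) (\<epsilon> * real (N * N) ^ 2)"
    using m unfolding models_def by blast
  obtain \<psi> where \<psi>: "\<And>z. z \<in> cells N \<Longrightarrow> \<psi> z < k" "\<And>i. i < k \<Longrightarrow> card {z\<in>cells N. \<psi> z = i} = N * N div k"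
     "\<And>z. z \<in> cells N \<Longrightarrow> \<bar>real (fst z) / N - real (\<psi> z) / k\<bar> \<le> \<epsilon>"
     and cut': "cut_le (cells N) (\<lambda>z z'. w' z z' - adjacency E (\<psi> z) (\<psi> z')) (\<epsilon> * real (N * N) ^ 2)"
    using m' unfolding models_def by blast
  have "\<exists>h. bij_betw h (cells N) (cells N) \<and> (\<forall>a\<in>cells N. id (\<psi> (h a)) = id (\<phi> a)) \<and>
    card {a\<in>cells N. \<phi> a \<noteq> \<psi> (h a)} \<le> (\<Sum>l\<in>{..<k}. card {a\<in>cells N. \<phi> a = l} - card {b\<in>cells N. \<psi> b = l})"
  proof (rule colour_matching)
    show "card {a \<in> cells N. id (\<phi> a) = q} = card {b \<in> cells N. id (\<psi> b) = q}" for q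
    proof (cases "q < k")
      case False
      then have "{a \<in> cells N. \<phi> a = q} = {}" "{b \<in> cells N. \<psi> b = q} = {}" using \<phi>(1) \<psi>(1) by auto
      then show ?thesis by (simp only: id_apply)
    qed (use \<phi>(2) \<psi>(2) in simp)
  qed (use \<phi>(1) in auto)
  then obtain \<sigma> where \<sigma>: "bij_betw \<sigma> (cells N) (cells N)" and \<psi>\<sigma>: "\<And>a. a \<in> cells N \<Longrightarrow> \<psi> (\<sigma> a) = \<phi> a" by auto
  have \<sigma>_in: "\<sigma> z \<in> cells N" if "z \<in> cells N" for z using \<sigma> that by (auto simp: bij_betw_def)
  have "cut_le (cells N) (\<lambda>z z'. w' (\<sigma> z) (\<sigma> z') - adjacency E (\<psi> (\<sigma> z)) (\<psi> (\<sigma> z'))) (real 1 ^ 2 * (\<epsilon> * real (N * N) ^ 2))"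
  proof (rule cut_le_pull[where V = "cells N" and D = "\<lambda>z z'. w' z z' - adjacency E (\<psi> z) (\<psi> z')"])
    show "card {z \<in> cells N. \<sigma> z = i} = 1" if i: "i \<in> cells N" for i
    proof -
      have "i \<in> \<sigma> ` cells N" using i \<sigma> by (simp add: bij_betw_def)
      then obtain z where z: "i = \<sigma> z" "z \<in> cells N" by (rule imageE)
      then have "{z \<in> cells N. \<sigma> z = i} = {z}" using \<sigma> by (auto simp: bij_betw_def dest: inj_onD)
      then show ?thesis by simp
    qed
  qed (use \<sigma>_in cut' in auto)
  then have "cut_le (cells N) (\<lambda>z z'. - (w' (\<sigma> z) (\<sigma> z') - adjacency E (\<psi> (\<sigma> z)) (\<psi> (\<sigma> z')))) (\<epsilon> * real (N * N) ^ 2)"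
    by (simp only: cut_le_uminus of_nat_1 power_one mult_1)
  from cut_le_add[OF cut this] have "cut_le (cells N) (\<lambda>z z'. w z z' - w' (\<sigma> z) (\<sigma> z')) (\<epsilon> * real (N * N) ^ 2 + \<epsilon> * real (N * N) ^ 2)"
    by (rule cut_le_cong[THEN iffD1, rotated]) (simp add: \<psi>\<sigma>)
  then have "cut_le (cells N) (\<lambda>z z'. w z z' - w' (\<sigma> z) (\<sigma> z')) (2 * \<epsilon> * real (N * N) ^ 2)" by (simp add: mult.assoc)
  moreover have "\<bar>real (fst z) / N - real (fst (\<sigma> z)) / N\<bar> \<le> 2 * \<epsilon>" if z: "z \<in> cells N" for z
    using \<phi>(3)[OF z] \<psi>(3)[OF \<sigma>_in[OF z]] unfolding \<psi>\<sigma>[OF z] by linarith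
  ultimately show ?thesis using \<sigma> by blast
qed

text \<open>The graphs that fail to model one of the two grids have total weight at most \<open>1 / 4 + (1 / 4 + 1 / 8)\<close>,
  where the last term accounts for the exchange of \<open>w\<close> and \<open>w'\<close>; all graphs together have weight at
  least \<open>3 / 4\<close>. So some graph models both.\<close>

lemma grid_inverse_counting:
  fixes \<epsilon> :: real
  assumes e: "\<epsilon> > 0"
  obtains k :: nat where "k > 0"
    "\<And>N' w w'. N' \<ge> 4 * k \<Longrightarrow>
       (\<And>u v. w u v = w v u \<and> 0 \<le> w u v \<and> w u v \<le> 1) \<Longrightarrow> (\<And>u v. w' u v = w' v u \<and> 0 \<le> w' u v \<and> w' u v \<le> 1) \<Longrightarrow>
       (\<Sum>E\<in>Pow (pairs k). \<bar>grid_density k (k * N') w E - grid_density k (k * N') w' E\<bar>) \<le> 1 / 8 \<Longrightarrow>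
       \<exists>\<sigma>. bij_betw \<sigma> (cells (k * N')) (cells (k * N')) \<and>
         (\<forall>z\<in>cells (k * N'). \<bar>real (fst z) / (k * N') - real (fst (\<sigma> z)) / (k * N')\<bar> \<le> \<epsilon>) \<and>
         cut_le (cells (k * N')) (\<lambda>z z'. w z z' - w' (\<sigma> z) (\<sigma> z')) (\<epsilon> * real (k * N' * (k * N')) ^ 2)"
proof -
  obtain k :: nat where k: "k > 0" and samp: "\<forall>N'>0. \<forall>w. (\<forall>u\<in>cells (k * N'). \<forall>v\<in>cells (k * N'). w u v = w v u \<and> 0 \<le> w u v \<and> w u v \<le> 1) \<longrightarrow>
       (\<Sum>E\<in>{E\<in>Pow (pairs k). \<not> models k (k * N') (\<epsilon> / 2) w E}. grid_density k (k * N') w E) \<le> 1 / 4"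
    using sampling[OF half_gt_zero[OF e]] by blast
  show thesis
  proof (rule that[OF k])
    fix N' :: nat and w w' :: "nat \<times> nat \<Rightarrow> nat \<times> nat \<Rightarrow> real"
    let ?N = "k * N'" and ?P = "Pow (pairs k)"
    assume N': "N' \<ge> 4 * k" and w: "\<And>u v. w u v = w v u \<and> 0 \<le> w u v \<and> w u v \<le> 1"
      and w': "\<And>u v. w' u v = w' v u \<and> 0 \<le> w' u v \<and> w' u v \<le> 1"
      and close: "(\<Sum>E\<in>?P. \<bar>grid_density k ?N w E - grid_density k ?N w' E\<bar>) \<le> 1 / 8"
    have N0: "N' > 0" "?N > 0" using N' k by (cases N'; auto)+
    let ?d = "grid_density k ?N w" and ?d' = "grid_density k ?N w'"
    let ?b = "{E\<in>?P. \<not> models k ?N (\<epsilon> / 2) w E}" and ?b' = "{E\<in>?P. \<not> models k ?N (\<epsilon> / 2) w' E}"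
    have d0: "0 \<le> ?d E" for E unfolding grid_density_def using w
      by (intro divide_nonneg_nonneg mult_nonneg_nonneg sum_nonneg graph_prob_nonneg) auto
    have "\<exists>E\<in>?P. models k ?N (\<epsilon> / 2) w E \<and> models k ?N (\<epsilon> / 2) w' E"
    proof (rule ccontr)
      assume "\<not> ?thesis"
      then have P: "?P = ?b \<union> ?b'" by auto
      have "real k ^ 2 / ?N = real k / N'" using k by (simp add: power2_eq_square)
      also have "\<dots> \<le> 1 / 4" using N' N0 by (simp add: field_simps flip: of_nat_mult)
      finally have "3 / 4 \<le> (\<Sum>E\<in>?P. ?d E)" using sum_grid_density_ge[of ?N k w] N0 by linarith
      also have "(\<Sum>E\<in>?P. ?d E) = (\<Sum>E\<in>?b \<union> ?b'. ?d E)" by (rule sum.cong[OF P refl])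
      also have "\<dots> \<le> (\<Sum>E\<in>?b. ?d E) + (\<Sum>E\<in>?b'. ?d E)"
      proof -
        have "(\<Sum>E\<in>?b \<union> ?b'. ?d E) + (\<Sum>E\<in>?b \<inter> ?b'. ?d E) = (\<Sum>E\<in>?b. ?d E) + (\<Sum>E\<in>?b'. ?d E)"
          by (rule sum.union_inter) auto
        moreover have "0 \<le> (\<Sum>E\<in>?b \<inter> ?b'. ?d E)" using d0 by (intro sum_nonneg)
        ultimately show ?thesis by linarith
      qed
      also have "(\<Sum>E\<in>?b. ?d E) \<le> 1 / 4" using w samp N0 by blast
      also have "(\<Sum>E\<in>?b'. ?d E) \<le> (\<Sum>E\<in>?b'. ?d' E + \<bar>?d E - ?d' E\<bar>)" by (intro sum_mono) linarith
      also have "\<dots> = (\<Sum>E\<in>?b'. ?d' E) + (\<Sum>E\<in>?b'. \<bar>?d E - ?d' E\<bar>)" by (rule sum.distrib)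
      also have "(\<Sum>E\<in>?b'. ?d' E) \<le> 1 / 4" using w' samp N0 by blast
      also have "(\<Sum>E\<in>?b'. \<bar>?d E - ?d' E\<bar>) \<le> (\<Sum>E\<in>?P. \<bar>?d E - ?d' E\<bar>)" by (intro sum_mono2) auto
      also note close
      finally show False by simp
    qed
    then obtain E where "models k ?N (\<epsilon> / 2) w E" "models k ?N (\<epsilon> / 2) w' E" by blast
    from common_model_imp_close[OF N0(2) k this]
    show "\<exists>\<sigma>. bij_betw \<sigma> (cells ?N) (cells ?N) \<and>
         (\<forall>z\<in>cells ?N. \<bar>real (fst z) / ?N - real (fst (\<sigma> z)) / ?N\<bar> \<le> \<epsilon>) \<and>
         cut_le (cells ?N) (\<lambda>z z'. w z z' - w' (\<sigma> z) (\<sigma> z')) (\<epsilon> * real (?N * ?N) ^ 2)" by simp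
  qed
qed

section \<open>Homomorphism integrals and the counting lemma\<close>

lemma (in prob_space) abs_integral_le_const:
  fixes F :: "'a \<Rightarrow> real"
  assumes "0 \<le> c" "\<And>x. x \<in> space M \<Longrightarrow> \<bar>F x\<bar> \<le> c"
  shows "\<bar>\<integral>x. F x \<partial>M\<bar> \<le> c"
proof (cases "integrable M F")
  case True
  have "(\<integral>x. F x \<partial>M) \<le> c" "- c \<le> (\<integral>x. F x \<partial>M)"
    using True assms by (intro integral_le_const integral_ge_const AE_I2; force)+
  then show ?thesis by linarith
qed (simp add: not_integrable_integral_eq assms(1))

text \<open>Making the underlying set the whole type removes all membership conditions on points; the
  measures of interest live on the unit square but are regarded as measures on the plane.\<close>

locale full_prob_space = prob_space M for M :: "'a measure" +
  assumes space_M [simp]: "space M = UNIV"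
begin

sublocale pair: pair_prob_space M M ..

sublocale product: product_prob_space "\<lambda>_. M" UNIV ..

lemma prob_space_PiM_M: "prob_space (Pi\<^sub>M I (\<lambda>_. M))"
  by (rule prob_space_PiM) (rule prob_space_axioms)

text \<open>The cut-norm with respect to \<open>M\<close>, as an upper bound and in its functional form.\<close>

definition kcut :: "('a \<times> 'a \<Rightarrow> real) \<Rightarrow> real \<Rightarrow> bool" where
  "kcut D c \<longleftrightarrow> (\<forall>f\<in>borel_measurable M. \<forall>g\<in>borel_measurable M. (\<forall>x. 0 \<le> f x \<and> f x \<le> 1) \<longrightarrow> (\<forall>x. 0 \<le> g x \<and> g x \<le> 1) \<longrightarrow>
     \<bar>\<integral>p. f (fst p) * g (snd p) * D p \<partial>(M \<Otimes>\<^sub>M M)\<bar> \<le> c)"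

lemma kcutD:
  assumes "kcut D c" "f \<in> borel_measurable M" "g \<in> borel_measurable M"
    "\<And>x. 0 \<le> f x \<and> f x \<le> 1" "\<And>x. 0 \<le> g x \<and> g x \<le> (1::real)"
  shows "\<bar>\<integral>p. f (fst p) * g (snd p) * D p \<partial>(M \<Otimes>\<^sub>M M)\<bar> \<le> c"
  using assms unfolding kcut_def by blast

lemma kcut_nonneg: "kcut D c \<Longrightarrow> 0 \<le> c"
  using kcutD[of D c "\<lambda>_. 0" "\<lambda>_. 0"] by simp

lemma kcut_uminus: "kcut D c \<Longrightarrow> kcut (\<lambda>p. - D p) c"
  unfolding kcut_def by simp

lemma integrable_test:
  fixes f g :: "'a \<Rightarrow> real"
  assumes [measurable]: "f \<in> borel_measurable M" "g \<in> borel_measurable M"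
    and "\<And>x. 0 \<le> f x \<and> f x \<le> 1" "\<And>x. 0 \<le> g x \<and> g x \<le> (1::real)" and D: "integrable (M \<Otimes>\<^sub>M M) D"
  shows "integrable (M \<Otimes>\<^sub>M M) (\<lambda>p. f (fst p) * g (snd p) * D p)"
proof (rule Bochner_Integration.integrable_bound[OF D])
  have [measurable]: "D \<in> borel_measurable (M \<Otimes>\<^sub>M M)" using D by simp
  show "(\<lambda>p. f (fst p) * g (snd p) * D p) \<in> borel_measurable (M \<Otimes>\<^sub>M M)" by measurable
  show "AE p in M \<Otimes>\<^sub>M M. norm (f (fst p) * g (snd p) * D p) \<le> norm (D p)"
    using assms(3,4) by (intro AE_I2) (auto simp: abs_mult intro!: mult_left_le_one_le mult_le_one)
qed

lemma kcut_add:
  assumes "kcut D c" "kcut D' c'" "integrable (M \<Otimes>\<^sub>M M) D" "integrable (M \<Otimes>\<^sub>M M) D'"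
  shows "kcut (\<lambda>p. D p + D' p) (c + c')"
  unfolding kcut_def
proof (intro ballI impI)
  fix f g :: "'a \<Rightarrow> real"
  assume *: "f \<in> borel_measurable M" "g \<in> borel_measurable M" "\<forall>x. 0 \<le> f x \<and> f x \<le> 1" "\<forall>x. 0 \<le> g x \<and> g x \<le> 1"
  have "(\<integral>p. f (fst p) * g (snd p) * (D p + D' p) \<partial>(M \<Otimes>\<^sub>M M)) =
    (\<integral>p. f (fst p) * g (snd p) * D p \<partial>(M \<Otimes>\<^sub>M M)) + (\<integral>p. f (fst p) * g (snd p) * D' p \<partial>(M \<Otimes>\<^sub>M M))"
    using * assms(3,4) unfolding distrib_left by (intro Bochner_Integration.integral_add integrable_test) auto
  then show "\<bar>\<integral>p. f (fst p) * g (snd p) * (D p + D' p) \<partial>(M \<Otimes>\<^sub>M M)\<bar> \<le> c + c'"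
    using kcutD[OF assms(1) *(1,2)] kcutD[OF assms(2) *(1,2)] *(3,4) by fastforce
qed

lemma kcut_L1:
  assumes D: "integrable (M \<Otimes>\<^sub>M M) D" and c: "(\<integral>p. \<bar>D p\<bar> \<partial>(M \<Otimes>\<^sub>M M)) \<le> c"
  shows "kcut D c"
  unfolding kcut_def
proof (intro ballI impI)
  fix f g :: "'a \<Rightarrow> real"
  assume *: "f \<in> borel_measurable M" "g \<in> borel_measurable M" "\<forall>x. 0 \<le> f x \<and> f x \<le> 1" "\<forall>x. 0 \<le> g x \<and> g x \<le> 1"
  have int: "integrable (M \<Otimes>\<^sub>M M) (\<lambda>p. f (fst p) * g (snd p) * D p)"
    using * D by (intro integrable_test) auto
  have "\<bar>\<integral>p. f (fst p) * g (snd p) * D p \<partial>(M \<Otimes>\<^sub>M M)\<bar> \<le> (\<integral>p. \<bar>f (fst p) * g (snd p) * D p\<bar> \<partial>(M \<Otimes>\<^sub>M M))"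
    by (rule integral_abs_bound)
  also have "\<dots> \<le> (\<integral>p. \<bar>D p\<bar> \<partial>(M \<Otimes>\<^sub>M M))"
    using * int D by (intro integral_mono integrable_abs) (auto simp: abs_mult intro!: mult_left_le_one_le mult_le_one)
  also note c
  finally show "\<bar>\<integral>p. f (fst p) * g (snd p) * D p \<partial>(M \<Otimes>\<^sub>M M)\<bar> \<le> c" .
qed

lemma abs_integral_le_on_set:
  fixes f h :: "'a \<Rightarrow> real"
  assumes [measurable]: "f \<in> borel_measurable M" and h: "integrable M h" and f: "\<And>x. 0 \<le> f x \<and> f x \<le> 1"
  shows "\<exists>S\<in>sets M. \<bar>\<integral>x. f x * h x \<partial>M\<bar> \<le> \<bar>\<integral>x. indicator S x * h x \<partial>M\<bar>"
proof -
  have [measurable]: "h \<in> borel_measurable M" using h by simp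
  have int: "integrable M (\<lambda>x. u x * h x)" if "u \<in> borel_measurable M" "\<And>x. 0 \<le> u x \<and> u x \<le> 1" for u :: "'a \<Rightarrow> real"
    by (rule Bochner_Integration.integrable_bound[OF h]) (use that in \<open>auto simp: abs_mult intro!: mult_left_le_one_le\<close>)
  let ?P = "{x \<in> space M. 0 \<le> h x}" and ?N = "{x \<in> space M. h x < 0}"
  have "(\<integral>x. f x * h x \<partial>M) \<le> (\<integral>x. indicator ?P x * h x \<partial>M)"
  proof (intro integral_mono int)
    show "f x * h x \<le> indicator ?P x * h x" for x
      using f[of x] by (cases "0 \<le> h x") (auto simp: mult_left_le_one_le mult_nonneg_nonpos)
  qed (use f in \<open>auto simp: indicator_def\<close>)
  moreover have "(\<integral>x. indicator ?N x * h x \<partial>M) \<le> (\<integral>x. f x * h x \<partial>M)"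
  proof (intro integral_mono int)
    show "indicator ?N x * h x \<le> f x * h x" for x
    proof (cases "h x < 0")
      case True
      then have "1 * h x \<le> f x * h x" using f[of x] by (intro mult_right_mono_neg) auto
      then show ?thesis using True by simp
    qed (use f[of x] in auto)
  qed (use f in \<open>auto simp: indicator_def\<close>)
  ultimately have "\<bar>\<integral>x. f x * h x \<partial>M\<bar> \<le> \<bar>\<integral>x. indicator ?P x * h x \<partial>M\<bar> \<or>
      \<bar>\<integral>x. f x * h x \<partial>M\<bar> \<le> \<bar>\<integral>x. indicator ?N x * h x \<partial>M\<bar>" by linarith
  moreover have "?P \<in> sets M" "?N \<in> sets M" by measurable
  ultimately show ?thesis by blast
qed

text \<open>A bilinear form is extremal at indicator functions.\<close>

lemma kcut_if_rectangles:
  assumes D: "integrable (M \<Otimes>\<^sub>M M) D"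
    and rect: "\<And>S T. S \<in> sets M \<Longrightarrow> T \<in> sets M \<Longrightarrow>
      \<bar>\<integral>p. indicator S (fst p) * indicator T (snd p) * D p \<partial>(M \<Otimes>\<^sub>M M)\<bar> \<le> c"
  shows "kcut D c"
  unfolding kcut_def
proof (intro ballI impI)
  fix f g :: "'a \<Rightarrow> real"
  assume [measurable]: "f \<in> borel_measurable M" "g \<in> borel_measurable M"
    and f: "\<forall>x. 0 \<le> f x \<and> f x \<le> 1" and g: "\<forall>x. 0 \<le> g x \<and> g x \<le> 1"
  have fst: "(\<integral>p. u (fst p) * v (snd p) * D p \<partial>(M \<Otimes>\<^sub>M M)) = (\<integral>x. u x * (\<integral>y. v y * D (x, y) \<partial>M) \<partial>M)"
    and fsti: "integrable M (\<lambda>x. \<integral>y. v y * D (x, y) \<partial>M)"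
    if m: "u \<in> borel_measurable M" "v \<in> borel_measurable M" "\<And>x. 0 \<le> u x \<and> u x \<le> 1" "\<And>x. 0 \<le> v x \<and> v x \<le> 1"
    for u v :: "'a \<Rightarrow> real"
  proof -
    have i1: "integrable (M \<Otimes>\<^sub>M M) (\<lambda>(x, y). u x * v y * D (x, y))"
      using integrable_test[OF m D] by (simp add: case_prod_unfold)
    have "(\<integral>p. u (fst p) * v (snd p) * D p \<partial>(M \<Otimes>\<^sub>M M)) = (\<integral>x. \<integral>y. u x * v y * D (x, y) \<partial>M \<partial>M)"
      using pair.integral_fst[OF i1] by (simp add: case_prod_unfold)
    then show "(\<integral>p. u (fst p) * v (snd p) * D p \<partial>(M \<Otimes>\<^sub>M M)) = (\<integral>x. u x * (\<integral>y. v y * D (x, y) \<partial>M) \<partial>M)"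
      by (simp add: mult.assoc)
    have "integrable (M \<Otimes>\<^sub>M M) (\<lambda>(x, y). 1 * v y * D (x, y))"
      using integrable_test[OF _ m(2) _ m(4) D, of "\<lambda>_. 1"] by (simp add: case_prod_unfold)
    from pair.integrable_fst[OF this] show "integrable M (\<lambda>x. \<integral>y. v y * D (x, y) \<partial>M)" by simp
  qed
  have snd: "(\<integral>p. u (fst p) * v (snd p) * D p \<partial>(M \<Otimes>\<^sub>M M)) = (\<integral>y. v y * (\<integral>x. u x * D (x, y) \<partial>M) \<partial>M)"
    and sndi: "integrable M (\<lambda>y. \<integral>x. u x * D (x, y) \<partial>M)"
    if m: "u \<in> borel_measurable M" "v \<in> borel_measurable M" "\<And>x. 0 \<le> u x \<and> u x \<le> 1" "\<And>x. 0 \<le> v x \<and> v x \<le> 1"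
    for u v :: "'a \<Rightarrow> real"
  proof -
    have i1: "integrable (M \<Otimes>\<^sub>M M) (\<lambda>(x, y). u x * v y * D (x, y))"
      using integrable_test[OF m D] by (simp add: case_prod_unfold)
    have "(\<integral>p. u (fst p) * v (snd p) * D p \<partial>(M \<Otimes>\<^sub>M M)) = (\<integral>y. \<integral>x. u x * v y * D (x, y) \<partial>M \<partial>M)"
      using pair.integral_snd[OF i1] by (simp add: case_prod_unfold)
    also have "\<dots> = (\<integral>y. v y * (\<integral>x. u x * D (x, y) \<partial>M) \<partial>M)"
      by (simp add: mult.left_commute mult.assoc flip: Bochner_Integration.integral_mult_right_zero)
    finally show "(\<integral>p. u (fst p) * v (snd p) * D p \<partial>(M \<Otimes>\<^sub>M M)) = (\<integral>y. v y * (\<integral>x. u x * D (x, y) \<partial>M) \<partial>M)" .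
    have "integrable (M \<Otimes>\<^sub>M M) (\<lambda>(x, y). u x * 1 * D (x, y))"
      using integrable_test[OF m(1) _ m(3) _ D, of "\<lambda>_. 1"] by (simp add: case_prod_unfold)
    from pair.integrable_snd[OF this] show "integrable M (\<lambda>y. \<integral>x. u x * D (x, y) \<partial>M)" by simp
  qed
  have ind: "\<And>x. 0 \<le> (indicator S x :: real) \<and> indicator S x \<le> (1::real)" for S :: "'a set"
    by (simp add: indicator_def)
  have "\<exists>S\<in>sets M. \<bar>\<integral>x. f x * (\<integral>y. g y * D (x, y) \<partial>M) \<partial>M\<bar> \<le> \<bar>\<integral>x. indicator S x * (\<integral>y. g y * D (x, y) \<partial>M) \<partial>M\<bar>"
    using f g by (intro abs_integral_le_on_set fsti[of f]) auto
  then obtain S where [measurable]: "S \<in> sets M" and S: "\<bar>\<integral>x. f x * (\<integral>y. g y * D (x, y) \<partial>M) \<partial>M\<bar> \<le> \<bar>\<integral>x. indicator S x * (\<integral>y. g y * D (x, y) \<partial>M) \<partial>M\<bar>" by blast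
  have "\<exists>T\<in>sets M. \<bar>\<integral>y. g y * (\<integral>x. indicator S x * D (x, y) \<partial>M) \<partial>M\<bar> \<le> \<bar>\<integral>y. indicator T y * (\<integral>x. indicator S x * D (x, y) \<partial>M) \<partial>M\<bar>"
    using g ind by (intro abs_integral_le_on_set sndi[of _ g]) auto
  then obtain T where [measurable]: "T \<in> sets M" and T: "\<bar>\<integral>y. g y * (\<integral>x. indicator S x * D (x, y) \<partial>M) \<partial>M\<bar> \<le> \<bar>\<integral>y. indicator T y * (\<integral>x. indicator S x * D (x, y) \<partial>M) \<partial>M\<bar>" by blast
  have "\<bar>\<integral>p. f (fst p) * g (snd p) * D p \<partial>(M \<Otimes>\<^sub>M M)\<bar> \<le> \<bar>\<integral>p. indicator S (fst p) * g (snd p) * D p \<partial>(M \<Otimes>\<^sub>M M)\<bar>"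
    using S f g ind by (subst (1 2) fst) auto
  also have "\<dots> \<le> \<bar>\<integral>p. indicator S (fst p) * indicator T (snd p) * D p \<partial>(M \<Otimes>\<^sub>M M)\<bar>"
    using T f g ind by (subst (1 2) snd) auto
  also have "\<dots> \<le> c" by (rule rect) measurable
  finally show "\<bar>\<integral>p. f (fst p) * g (snd p) * D p \<partial>(M \<Otimes>\<^sub>M M)\<bar> \<le> c" .
qed

lemma AE_fst:
  assumes "AE x in M. P x"
  shows "AE p in M \<Otimes>\<^sub>M M. P (fst p)"
proof -
  have "distr (M \<Otimes>\<^sub>M M) M fst = M" by (rule prob_space.distr_pair_fst[OF prob_space_axioms])
  then have "AE x in distr (M \<Otimes>\<^sub>M M) M fst. P x" using assms by (simp only:)
  from AE_distrD[OF measurable_fst this] show ?thesis .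
qed

lemma AE_snd:
  assumes "AE x in M. P x"
  shows "AE p in M \<Otimes>\<^sub>M M. P (snd p)"
proof -
  have "AE p in distr (M \<Otimes>\<^sub>M M) (M \<Otimes>\<^sub>M M) (\<lambda>(x, y). (y, x)). P (fst p)"
    using AE_fst[OF assms] by (subst pair.distr_pair_swap[symmetric])
  from AE_distrD[OF measurable_pair_swap' this] show ?thesis by (simp add: case_prod_unfold)
qed

text \<open>Each edge carries a kernel of its own, so that edges, non-edges and the order constraint can be
  treated alike.\<close>

definition hom_integral :: "'i set \<Rightarrow> ('i \<times> 'i) set \<Rightarrow> ('i \<times> 'i \<Rightarrow> 'a \<times> 'a \<Rightarrow> real) \<Rightarrow> real" where
  "hom_integral I P K = (\<integral>v. (\<Prod>p\<in>P. K p (v (fst p), v (snd p))) \<partial>Pi\<^sub>M I (\<lambda>_. M))"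

text \<open>With all points but those at \<open>i\<close> and \<open>j\<close> fixed, the remaining factors split into a function of
  the one and a function of the other, that is, into a pair of test functions.\<close>

lemma integral_kernel_le_cut:
  fixes Z :: "'i \<times> 'i \<Rightarrow> 'a \<times> 'a \<Rightarrow> real"
  assumes I: "finite I" "i \<in> I" "j \<in> I" "i \<noteq> j" and C: "finite C"
    "\<And>p. p \<in> C \<Longrightarrow> fst p \<in> I \<and> snd p \<in> I \<and> \<not> {i, j} \<subseteq> {fst p, snd p}"
    and Z: "\<And>p. p \<in> C \<Longrightarrow> Z p \<in> borel_measurable (M \<Otimes>\<^sub>M M)" "\<And>p x. p \<in> C \<Longrightarrow> 0 \<le> Z p x \<and> Z p x \<le> 1"
    and D: "D \<in> borel_measurable (M \<Otimes>\<^sub>M M)" "\<And>x. \<bar>D x\<bar> \<le> 1" and cut: "kcut D c"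
  shows "\<bar>\<integral>v. (\<Prod>p\<in>C. Z p (v (fst p), v (snd p))) * D (v i, v j) \<partial>Pi\<^sub>M I (\<lambda>_. M)\<bar> \<le> c"
proof -
  define J where "J = I - {i, j}"
  have I_eq: "I = insert i (insert j J)" and J: "finite J" "j \<notin> J" "i \<notin> insert j J"
    using I unfolding J_def by auto
  define H where "H v = (\<Prod>p\<in>C. Z p (v (fst p), v (snd p))) * D (v i, v j)" for v
  have pr[measurable]: "(\<lambda>v. (v a, v b)) \<in> Pi\<^sub>M I (\<lambda>_. M) \<rightarrow>\<^sub>M M \<Otimes>\<^sub>M M" if "a \<in> I" "b \<in> I" for a b
    using that by measurable
  have Hm: "H \<in> borel_measurable (Pi\<^sub>M I (\<lambda>_. M))" unfolding H_def
    using C I by (intro borel_measurable_times borel_measurable_prod measurable_compose[OF pr Z(1)] measurable_compose[OF pr D(1)]) auto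
  have prodZ: "0 \<le> (\<Prod>p\<in>C'. Z p (x p)) \<and> (\<Prod>p\<in>C'. Z p (x p)) \<le> 1" if "C' \<subseteq> C" for x C'
    by (intro conjI prod_nonneg prod_le_1) (use Z(2) that in blast)+
  have H1: "\<bar>H v\<bar> \<le> 1" for v
    unfolding H_def abs_mult using prodZ[of C "\<lambda>p. (v (fst p), v (snd p))"] D(2) by (intro mult_le_one) auto
  interpret PJ: prob_space "Pi\<^sub>M J (\<lambda>_. M)" by (rule prob_space_PiM_M)
  interpret PjJ: prob_space "Pi\<^sub>M (insert j J) (\<lambda>_. M)" by (rule prob_space_PiM_M)
  interpret PI: prob_space "Pi\<^sub>M I (\<lambda>_. M)" by (rule prob_space_PiM_M)
  have "(\<integral>v. H v \<partial>Pi\<^sub>M I (\<lambda>_. M)) = (\<integral>x. (\<integral>y. H (x(i := y)) \<partial>M) \<partial>Pi\<^sub>M (insert j J) (\<lambda>_. M))"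
    unfolding I_eq
  proof (rule product.product_integral_insert)
    show "integrable (Pi\<^sub>M (insert i (insert j J)) (\<lambda>_. M)) H"
      unfolding I_eq[symmetric] using Hm H1 by (intro PI.integrable_const_bound[of _ 1]) auto
  qed (use J in auto)
  also have "\<dots> = (\<integral>x. (\<integral>z. (\<integral>y. H (x(j := z, i := y)) \<partial>M) \<partial>M) \<partial>Pi\<^sub>M J (\<lambda>_. M))"
  proof (rule product.product_integral_insert)
    have "(\<lambda>(x, y). H (x(i := y))) \<in> borel_measurable (Pi\<^sub>M (insert j J) (\<lambda>_. M) \<Otimes>\<^sub>M M)"
      using measurable_compose[OF measurable_add_dim[of i "insert j J" "\<lambda>_. M"], of H borel] Hm
      unfolding I_eq[symmetric] by (simp add: case_prod_unfold)
    then have "(\<lambda>x. \<integral>y. H (x(i := y)) \<partial>M) \<in> borel_measurable (Pi\<^sub>M (insert j J) (\<lambda>_. M))"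
      by (rule borel_measurable_lebesgue_integral)
    then show "integrable (Pi\<^sub>M (insert j J) (\<lambda>_. M)) (\<lambda>x. \<integral>y. H (x(i := y)) \<partial>M)"
      using H1 by (intro PjJ.integrable_const_bound[of _ 1] AE_I2) (auto intro!: abs_integral_le_const)
  qed (use J in auto)
  also have "\<bar>\<dots>\<bar> \<le> c"
  proof (rule PJ.abs_integral_le_const)
    fix x assume "x \<in> space (Pi\<^sub>M J (\<lambda>_. M))"
    define Ci where "Ci = {p\<in>C. i \<in> {fst p, snd p}}"
    define A where "A y = (\<Prod>p\<in>Ci. Z p ((x(i := y)) (fst p), (x(i := y)) (snd p)))" for y
    define B where "B z = (\<Prod>p\<in>C - Ci. Z p ((x(j := z)) (fst p), (x(j := z)) (snd p)))" for z
    have upd: "(\<lambda>y. ((x(t := y)) a, (x(t := y)) b)) \<in> M \<rightarrow>\<^sub>M M \<Otimes>\<^sub>M M" for t a b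
      by (cases "a = t"; cases "b = t") auto
    have Am: "A \<in> borel_measurable M" unfolding A_def
      by (intro borel_measurable_prod measurable_compose[OF upd Z(1)]) (auto simp: Ci_def)
    have Bm: "B \<in> borel_measurable M" unfolding B_def
      by (intro borel_measurable_prod measurable_compose[OF upd Z(1)]) auto
    have A1: "0 \<le> A y \<and> A y \<le> 1" for y unfolding A_def by (rule prodZ) (auto simp: Ci_def)
    have B1: "0 \<le> B y \<and> B y \<le> 1" for y unfolding B_def by (rule prodZ) auto
    have H_split: "H (x(j := z, i := y)) = A y * B z * D (y, z)" for y z
    proof -
      let ?v = "x(j := z, i := y)"
      have "(\<Prod>p\<in>C. Z p (?v (fst p), ?v (snd p))) =
        (\<Prod>p\<in>Ci. Z p (?v (fst p), ?v (snd p))) * (\<Prod>p\<in>C - Ci. Z p (?v (fst p), ?v (snd p)))"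
      proof -
        have "Ci \<subseteq> C" unfolding Ci_def by auto
        from prod.subset_diff[OF this C(1)] show ?thesis by (simp add: mult.commute)
      qed
      also have "(\<Prod>p\<in>Ci. Z p (?v (fst p), ?v (snd p))) = A y"
        unfolding A_def using C(2) I(4) by (intro prod.cong refl) (fastforce simp: Ci_def)
      also have "(\<Prod>p\<in>C - Ci. Z p (?v (fst p), ?v (snd p))) = B z"
        unfolding B_def by (intro prod.cong refl) (auto simp: Ci_def)
      finally have e: "(\<Prod>p\<in>C. Z p (?v (fst p), ?v (snd p))) = A y * B z" .
      have v: "?v i = y" "?v j = z" using I(4) by auto
      show ?thesis unfolding H_def e v ..
    qed
    have "integrable (M \<Otimes>\<^sub>M M) (\<lambda>p. A (fst p) * B (snd p) * D p)"
      using D by (intro integrable_test Am Bm A1 B1 pair.integrable_const_bound[of _ 1]) auto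
    then have "integrable (M \<Otimes>\<^sub>M M) (\<lambda>(y, z). A y * B z * D (y, z))" by (simp add: case_prod_unfold)
    from pair.integral_snd[OF this]
    have "(\<integral>z. (\<integral>y. H (x(j := z, i := y)) \<partial>M) \<partial>M) = (\<integral>p. A (fst p) * B (snd p) * D p \<partial>(M \<Otimes>\<^sub>M M))"
      unfolding H_split by (simp add: case_prod_unfold)
    then show "\<bar>\<integral>z. (\<integral>y. H (x(j := z, i := y)) \<partial>M) \<partial>M\<bar> \<le> c"
      using kcutD[OF cut Am Bm A1 B1] by simp
  qed (rule kcut_nonneg[OF cut])
  finally show ?thesis unfolding H_def .
qed

text \<open>The null set has cut-norm zero, so the bound just proved applies to its indicator without any other
  factors.\<close>

lemma AE_PiM_pair:
  assumes AE: "AE p in M \<Otimes>\<^sub>M M. P p" and I: "finite I" "i \<in> I" "j \<in> I" "i \<noteq> j"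
  shows "AE v in Pi\<^sub>M I (\<lambda>_. M). P (v i, v j)"
proof -
  interpret PI: prob_space "Pi\<^sub>M I (\<lambda>_. M)" by (rule prob_space_PiM_M)
  obtain N where N: "{p\<in>space (M \<Otimes>\<^sub>M M). \<not> P p} \<subseteq> N" "emeasure (M \<Otimes>\<^sub>M M) N = 0" "N \<in> sets (M \<Otimes>\<^sub>M M)"
    using AE by (rule AE_E)
  have pr[measurable]: "(\<lambda>v. (v i, v j)) \<in> Pi\<^sub>M I (\<lambda>_. M) \<rightarrow>\<^sub>M M \<Otimes>\<^sub>M M"
    using I by measurable
  let ?S = "(\<lambda>v. (v i, v j)) -` N \<inter> space (Pi\<^sub>M I (\<lambda>_. M))"
  have S: "?S \<in> sets (Pi\<^sub>M I (\<lambda>_. M))" using N(3) by measurable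
  have "kcut (indicator N) 0"
  proof (rule kcut_L1)
    have "(\<integral>p. indicator N p \<partial>(M \<Otimes>\<^sub>M M)) = measure (M \<Otimes>\<^sub>M M) N" using N(3) by simp
    then show "(\<integral>p. \<bar>indicator N p :: real\<bar> \<partial>(M \<Otimes>\<^sub>M M)) \<le> 0" using N(2) by (simp add: measure_def)
    show "integrable (M \<Otimes>\<^sub>M M) (indicator N :: _ \<Rightarrow> real)" using N by (intro integrable_real_indicator) auto
  qed
  then have "\<bar>\<integral>v. (\<Prod>p\<in>{}. (\<lambda>_. 0) (v (fst p), v (snd p))) * indicator N (v i, v j) \<partial>Pi\<^sub>M I (\<lambda>_. M)\<bar> \<le> (0::real)"
    using I N(3) by (intro integral_kernel_le_cut) (auto simp: indicator_abs_le_1)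
  moreover have "0 \<le> (\<integral>v. indicator N (v i, v j) \<partial>Pi\<^sub>M I (\<lambda>_. M) :: real)"
    by (rule Bochner_Integration.integral_nonneg) simp
  ultimately have "(\<integral>v. indicator N (v i, v j) \<partial>Pi\<^sub>M I (\<lambda>_. M)) = (0::real)" by simp
  also have "(\<integral>v. indicator N (v i, v j) \<partial>Pi\<^sub>M I (\<lambda>_. M)) = (\<integral>v. indicator ?S v \<partial>Pi\<^sub>M I (\<lambda>_. M) :: real)"
    by (intro Bochner_Integration.integral_cong) (auto simp: indicator_def)
  finally have "measure (Pi\<^sub>M I (\<lambda>_. M)) ?S = 0" using S by simp
  then have "?S \<in> null_sets (Pi\<^sub>M I (\<lambda>_. M))" using S PI.emeasure_eq_measure by (intro null_setsI) auto
  then show ?thesis by (rule AE_I') (use N(1) in \<open>auto simp: space_pair_measure\<close>)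
qed

text \<open>The kernels are exchanged one edge at a time.\<close>

lemma counting:
  fixes K K' :: "'i::linorder \<times> 'i \<Rightarrow> 'a \<times> 'a \<Rightarrow> real"
  assumes I: "finite I" and P: "finite P" "\<And>p. p \<in> P \<Longrightarrow> fst p \<in> I \<and> snd p \<in> I \<and> fst p < snd p"
    and K: "\<And>p. p \<in> P \<Longrightarrow> K p \<in> borel_measurable (M \<Otimes>\<^sub>M M)" "\<And>p x. p \<in> P \<Longrightarrow> 0 \<le> K p x \<and> K p x \<le> 1"
    and K': "\<And>p. p \<in> P \<Longrightarrow> K' p \<in> borel_measurable (M \<Otimes>\<^sub>M M)" "\<And>p x. p \<in> P \<Longrightarrow> 0 \<le> K' p x \<and> K' p x \<le> 1"
    and cut: "\<And>p. p \<in> P \<Longrightarrow> kcut (\<lambda>x. K p x - K' p x) (c p)"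
  shows "\<bar>hom_integral I P K - hom_integral I P K'\<bar> \<le> (\<Sum>p\<in>P. c p)"
proof -
  interpret PI: prob_space "Pi\<^sub>M I (\<lambda>_. M)" by (rule prob_space_PiM_M)
  define pr where "pr F A v = (\<Prod>p\<in>A. F p (v (fst p), v (snd p)))" for F :: "'i \<times> 'i \<Rightarrow> 'a \<times> 'a \<Rightarrow> real" and A v
  define ok where "ok F A \<longleftrightarrow> (\<forall>p\<in>A. F p \<in> borel_measurable (M \<Otimes>\<^sub>M M) \<and> (\<forall>x. 0 \<le> F p x \<and> F p x \<le> 1))"
    for F :: "'i \<times> 'i \<Rightarrow> 'a \<times> 'a \<Rightarrow> real" and A
  have proj[measurable]: "(\<lambda>v. (v a, v b)) \<in> Pi\<^sub>M I (\<lambda>_. M) \<rightarrow>\<^sub>M M \<Otimes>\<^sub>M M" if "a \<in> I" "b \<in> I" for a b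
    using that by measurable
  have okm: "pr F A \<in> borel_measurable (Pi\<^sub>M I (\<lambda>_. M))" if "ok F A" "A \<subseteq> P" for F A
    unfolding pr_def using that P(2) unfolding ok_def
    by (intro borel_measurable_prod measurable_compose[OF proj]) auto
  have ok1: "0 \<le> pr F A v \<and> pr F A v \<le> 1" if "ok F A" for F A v
    unfolding pr_def using that unfolding ok_def by (intro conjI prod_nonneg prod_le_1) auto
  have oki: "integrable (Pi\<^sub>M I (\<lambda>_. M)) (\<lambda>v. pr F A v * pr G B v)" if "ok F A" "A \<subseteq> P" "ok G B" "B \<subseteq> P" for F A G B
  proof (rule PI.integrable_const_bound[of _ 1])
    show "AE v in Pi\<^sub>M I (\<lambda>_. M). norm (pr F A v * pr G B v) \<le> 1"
      using ok1[OF that(1)] ok1[OF that(3)] by (intro AE_I2) (auto simp: abs_mult intro!: mult_le_one)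
    show "(\<lambda>v. pr F A v * pr G B v) \<in> borel_measurable (Pi\<^sub>M I (\<lambda>_. M))"
      using okm that by (intro borel_measurable_times) auto
  qed
  have "\<bar>\<integral>v. (pr K A v - pr K' A v) * pr Z C v \<partial>Pi\<^sub>M I (\<lambda>_. M)\<bar> \<le> (\<Sum>p\<in>A. c p)"
    if "A \<subseteq> P" "C \<subseteq> P" "A \<inter> C = {}" "ok Z C" for A C Z
    using finite_subset[OF that(1) P(1)] that
  proof (induction A arbitrary: C Z rule: finite_induct)
    case empty
    then show ?case by (simp add: pr_def)
  next
    case (insert p A)
    have finC: "finite C" using insert P(1) by (blast intro: finite_subset)
    have okA: "ok K A" "ok K' A" "ok K (insert p A)" "ok K' (insert p A)"
      using insert K K' unfolding ok_def by auto
    define F where "F q = (if q \<in> A then K q else Z q)" for q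
    define Z' where "Z' = Z(p := K' p)"
    have okF: "ok F (A \<union> C)" using okA(1) insert unfolding F_def ok_def by auto
    have okZ': "ok Z' (insert p C)" using okA(4) insert unfolding Z'_def ok_def by auto
    have prF: "pr F (A \<union> C) v = pr K A v * pr Z C v" for v
    proof -
      have "pr F (A \<union> C) v = pr F A v * pr F C v"
        unfolding pr_def using insert finC by (intro prod.union_disjoint) auto
      also have "pr F A v = pr K A v" unfolding pr_def F_def by simp
      also have "pr F C v = pr Z C v" unfolding pr_def F_def using insert by (intro prod.cong) auto
      finally show ?thesis .
    qed
    have prZ': "pr Z' (insert p C) v = K' p (v (fst p), v (snd p)) * pr Z C v" for v
    proof -
      have "p \<notin> C" using insert by auto
      then have "pr Z' C v = pr Z C v" unfolding pr_def Z'_def by (intro prod.cong) auto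
      moreover have "pr Z' (insert p C) v = Z' p (v (fst p), v (snd p)) * pr Z' C v"
        unfolding pr_def using finC \<open>p \<notin> C\<close> by simp
      ultimately show ?thesis by (simp add: Z'_def)
    qed
    have prK: "pr G (insert p A) v = G p (v (fst p), v (snd p)) * pr G A v" for G v
      unfolding pr_def using insert by simp
    have split: "(pr K (insert p A) v - pr K' (insert p A) v) * pr Z C v =
      pr F (A \<union> C) v * (K p (v (fst p), v (snd p)) - K' p (v (fst p), v (snd p))) +
      (pr K A v - pr K' A v) * pr Z' (insert p C) v" for v
      unfolding prK prF prZ' by (simp add: algebra_simps)
    have i2: "integrable (Pi\<^sub>M I (\<lambda>_. M)) (\<lambda>v. (pr K A v - pr K' A v) * pr Z' (insert p C) v)"
      unfolding left_diff_distrib using insert okA okZ' by (intro Bochner_Integration.integrable_diff oki) auto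
    have i0: "integrable (Pi\<^sub>M I (\<lambda>_. M)) (\<lambda>v. (pr K (insert p A) v - pr K' (insert p A) v) * pr Z C v)"
      unfolding left_diff_distrib using insert okA by (intro Bochner_Integration.integrable_diff oki) auto
    have i1: "integrable (Pi\<^sub>M I (\<lambda>_. M)) (\<lambda>v. pr F (A \<union> C) v * (K p (v (fst p), v (snd p)) - K' p (v (fst p), v (snd p))))"
      using Bochner_Integration.integrable_diff[OF i0 i2] unfolding split by simp
    have "\<bar>\<integral>v. pr F (A \<union> C) v * (K p (v (fst p), v (snd p)) - K' p (v (fst p), v (snd p))) \<partial>Pi\<^sub>M I (\<lambda>_. M)\<bar> \<le> c p"
      unfolding pr_def
    proof (rule integral_kernel_le_cut[where D = "\<lambda>x. K p x - K' p x" and i = "fst p" and j = "snd p"])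
      show "kcut (\<lambda>x. K p x - K' p x) (c p)" using cut insert by auto
      show "fst q \<in> I \<and> snd q \<in> I \<and> \<not> {fst p, snd p} \<subseteq> {fst q, snd q}" if "q \<in> A \<union> C" for q
      proof -
        have "q \<noteq> p" "q \<in> P" "p \<in> P" using that insert by auto
        then show ?thesis using P(2)[of p] P(2)[of q] by (cases p; cases q) auto
      qed
      show "\<bar>K p x - K' p x\<bar> \<le> 1" for x using K(2)[of p x] K'(2)[of p x] insert by auto
    qed (use I okF finC insert P K K' in \<open>auto simp: ok_def less_imp_neq\<close>)
    moreover have "\<bar>\<integral>v. (pr K A v - pr K' A v) * pr Z' (insert p C) v \<partial>Pi\<^sub>M I (\<lambda>_. M)\<bar> \<le> (\<Sum>p\<in>A. c p)"
      using insert okZ' by (intro insert.IH) auto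
    ultimately show ?case
      using insert(1,2) unfolding split Bochner_Integration.integral_add[OF i1 i2] by (simp add: abs_le_iff)
  qed
  from this[of P "{}" K] have "\<bar>\<integral>v. (pr K P v - pr K' P v) \<partial>Pi\<^sub>M I (\<lambda>_. M)\<bar> \<le> (\<Sum>p\<in>P. c p)"
    by (simp add: ok_def pr_def)
  moreover have "(\<integral>v. (pr K P v - pr K' P v) \<partial>Pi\<^sub>M I (\<lambda>_. M)) = hom_integral I P K - hom_integral I P K'"
  proof -
    have "ok K P" "ok K' P" using K K' unfolding ok_def by auto
    from oki[OF this(1) order_refl, of K "{}"] oki[OF this(2) order_refl, of K "{}"]
    show ?thesis unfolding hom_integral_def pr_def by (simp add: ok_def)
  qed
  ultimately show ?thesis by simp
qed

lemma hom_substitute: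
  assumes I: "finite I" and P: "\<And>p. p \<in> P \<Longrightarrow> fst p \<in> I \<and> snd p \<in> I"
    and K: "\<And>p. p \<in> P \<Longrightarrow> K p \<in> borel_measurable (M \<Otimes>\<^sub>M M)"
    and f: "f \<in> M \<rightarrow>\<^sub>M M" "distr M M f = M"
  shows "hom_integral I P (\<lambda>p x. K p (f (fst x), f (snd x))) = hom_integral I P K"
proof -
  have proj[measurable]: "(\<lambda>v. (v a, v b)) \<in> Pi\<^sub>M I (\<lambda>_. M) \<rightarrow>\<^sub>M M \<Otimes>\<^sub>M M" if "a \<in> I" "b \<in> I" for a b
    using that by measurable
  have "Pi\<^sub>M I (\<lambda>_. M) = distr (Pi\<^sub>M I (\<lambda>_. M)) (Pi\<^sub>M I (\<lambda>_. M)) (compose I f)"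
    using I f prob_space_axioms by (subst distr_PiM_finite_prob_space') auto
  then have "hom_integral I P K = (\<integral>v. (\<Prod>p\<in>P. K p (v (fst p), v (snd p))) \<partial>distr (Pi\<^sub>M I (\<lambda>_. M)) (Pi\<^sub>M I (\<lambda>_. M)) (compose I f))"
    unfolding hom_integral_def by simp
  also have "\<dots> = (\<integral>v. (\<Prod>p\<in>P. K p (compose I f v (fst p), compose I f v (snd p))) \<partial>Pi\<^sub>M I (\<lambda>_. M))"
  proof (rule integral_distr)
    show "compose I f \<in> Pi\<^sub>M I (\<lambda>_. M) \<rightarrow>\<^sub>M Pi\<^sub>M I (\<lambda>_. M)"
      unfolding compose_def using f(1) by measurable
    show "(\<lambda>v. \<Prod>p\<in>P. K p (v (fst p), v (snd p))) \<in> borel_measurable (Pi\<^sub>M I (\<lambda>_. M))"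
      using P by (intro borel_measurable_prod measurable_compose[OF proj K]) auto
  qed
  also have "\<dots> = hom_integral I P (\<lambda>p x. K p (f (fst x), f (snd x)))"
    unfolding hom_integral_def using P by (intro Bochner_Integration.integral_cong prod.cong) (auto simp: compose_def)
  finally show ?thesis ..
qed

end

section \<open>The unit square and the order of its points\<close>

lemma measurable_fst_borel [measurable (raw)]:
  fixes f :: "'c \<Rightarrow> 'a::second_countable_topology \<times> 'b::second_countable_topology"
  assumes "f \<in> M \<rightarrow>\<^sub>M borel"
  shows "(\<lambda>x. fst (f x)) \<in> M \<rightarrow>\<^sub>M borel"
  using measurable_compose[OF assms, of fst borel] by (simp add: borel_measurable_continuous_onI continuous_on_fst)

lemma measurable_snd_borel [measurable (raw)]:
  fixes f :: "'c \<Rightarrow> 'a::second_countable_topology \<times> 'b::second_countable_topology"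
  assumes "f \<in> M \<rightarrow>\<^sub>M borel"
  shows "(\<lambda>x. snd (f x)) \<in> M \<rightarrow>\<^sub>M borel"
  using measurable_compose[OF assms, of snd borel] by (simp add: borel_measurable_continuous_onI continuous_on_snd)

definition sq :: "point measure" where "sq = density lborel (indicator unit_square)"

abbreviation sq2 :: "(point \<times> point) measure" where "sq2 \<equiv> sq \<Otimes>\<^sub>M sq"

lemma unit_square_eq_cbox: "unit_square = cbox (0, 0) (1, 1)"
  unfolding unit_square_def by (auto simp: cbox_Pair_eq)

lemma unit_square_borel [measurable, simp]: "unit_square \<in> sets borel"
  unfolding unit_square_eq_cbox by simp

lemma unit_squares_borel [measurable, simp]: "unit_square \<times> unit_square \<in> sets borel"
  by (intro borel_Times) auto

lemma emeasure_lborel_Times: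
  fixes A :: "'a::euclidean_space set" and B :: "'b::euclidean_space set"
  assumes "A \<in> sets borel" "B \<in> sets borel"
  shows "emeasure lborel (A \<times> B) = emeasure lborel A * emeasure lborel B"
  using lborel.emeasure_pair_measure_Times[of A lborel B] assms by (simp add: lborel_prod)

lemma emeasure_unit_square: "emeasure lborel unit_square = 1"
  unfolding unit_square_def by (subst emeasure_lborel_Times) auto

lemma space_sq [simp]: "space sq = UNIV" and sets_sq [simp, measurable_cong]: "sets sq = sets borel"
  unfolding sq_def by auto

lemma emeasure_sq: "A \<in> sets borel \<Longrightarrow> emeasure sq A = emeasure lborel (unit_square \<inter> A)"
  unfolding sq_def by (subst emeasure_density) (simp_all flip: indicator_inter_arith)

interpretation sq: full_prob_space sq
proof -
  have "prob_space sq"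
    by (rule prob_spaceI) (simp add: emeasure_sq emeasure_unit_square)
  then interpret prob_space sq .
  show "full_prob_space sq" by unfold_locales simp
qed

lemma pair_borel [measurable_cong, simp]: "sets sq2 = sets borel"
proof -
  have "sets sq2 = sets (borel \<Otimes>\<^sub>M borel :: (point \<times> point) measure)"
    by (rule sets_pair_measure_cong) auto
  also have "\<dots> = sets borel" by (simp only: borel_prod)
  finally show ?thesis .
qed

lemma pair_space [simp]: "space sq2 = UNIV" by (simp add: space_pair_measure)

lemma pair_sq_density: "sq2 = density lborel (indicator (unit_square \<times> unit_square))"
proof -
  have "sq2 = density (lborel \<Otimes>\<^sub>M lborel) (\<lambda>(x, y). indicator unit_square x * indicator unit_square y)"
    unfolding sq_def
  proof (rule pair_measure_density)
    show "sigma_finite_measure (density lborel (indicator unit_square))"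
      using sq.sigma_finite_measure_axioms unfolding sq_def .
  qed (auto intro: sigma_finite_lborel)
  also have "(\<lambda>(x, y). indicator unit_square x * indicator unit_square y) = (indicator (unit_square \<times> unit_square) :: _ \<Rightarrow> ennreal)"
    by (auto simp: fun_eq_iff indicator_def)
  finally show ?thesis by (simp add: lborel_prod)
qed

lemma PiM_sq_density:
  assumes I: "finite I"
  shows "Pi\<^sub>M I (\<lambda>_. sq) = density (Pi\<^sub>M I (\<lambda>_. lborel)) (indicator (I \<rightarrow>\<^sub>E unit_square))"
proof -
  interpret L: product_sigma_finite "\<lambda>_. lborel :: point measure" ..
  interpret finite_product_sigma_finite "\<lambda>_. lborel :: point measure" I by standard (rule I)
  have Q: "(I \<rightarrow>\<^sub>E unit_square) \<in> sets (Pi\<^sub>M I (\<lambda>_. lborel))"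
    using I by (intro sets_PiM_I_finite) auto
  show ?thesis
  proof (rule sq.product.PiM_eqI[symmetric])
    show "sets (density (Pi\<^sub>M I (\<lambda>_. lborel)) (indicator (I \<rightarrow>\<^sub>E unit_square))) = sets (Pi\<^sub>M I (\<lambda>_. sq))"
      by (simp, intro sets_PiM_cong) auto
    fix A :: "'a \<Rightarrow> point set" assume A: "\<And>i. i \<in> I \<Longrightarrow> A i \<in> sets sq"
    have "Pi\<^sub>E I A \<in> sets (Pi\<^sub>M I (\<lambda>_. lborel))" using I A by (intro sets_PiM_I_finite) auto
    then have "emeasure (density (Pi\<^sub>M I (\<lambda>_. lborel)) (indicator (I \<rightarrow>\<^sub>E unit_square))) (Pi\<^sub>E I A) =
      emeasure (Pi\<^sub>M I (\<lambda>_. lborel)) ((I \<rightarrow>\<^sub>E unit_square) \<inter> Pi\<^sub>E I A)"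
      using Q by (subst emeasure_density) (simp_all flip: indicator_inter_arith)
    also have "\<dots> = emeasure (Pi\<^sub>M I (\<lambda>_. lborel)) (\<Pi>\<^sub>E i\<in>I. unit_square \<inter> A i)"
      by (simp add: PiE_Int)
    also have "\<dots> = (\<Prod>i\<in>I. emeasure sq (A i))"
      using A by (subst L.emeasure_PiM[OF I]) (auto simp: emeasure_sq)
    finally show "emeasure (density (Pi\<^sub>M I (\<lambda>_. lborel)) (indicator (I \<rightarrow>\<^sub>E unit_square))) (Pi\<^sub>E I A) = (\<Prod>i\<in>I. emeasure sq (A i))" .
  qed (use I in auto)
qed

lemma AE_sq_iff: "(AE x in sq. P x) \<longleftrightarrow> (AE x in lborel. x \<in> unit_square \<longrightarrow> P x)"
  unfolding sq_def by (subst AE_density) (auto simp: indicator_def)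

lemma AE_pair_iff: "(AE x in sq2. P x) \<longleftrightarrow> (AE x in lborel. x \<in> unit_square \<times> unit_square \<longrightarrow> P x)"
  unfolding pair_sq_density
  by (subst AE_density) (auto simp: indicator_def intro!: borel_measurable_indicator borel_Times)

lemma integral_pair_sq:
  fixes g :: "point \<times> point \<Rightarrow> real"
  assumes [measurable]: "g \<in> borel_measurable borel"
  shows "(\<integral>p. g p \<partial>sq2) = (\<integral>p. indicator (unit_square \<times> unit_square) p * g p \<partial>lborel)"
proof -
  have "density lborel (\<lambda>p. ennreal (indicator (unit_square \<times> unit_square) p)) = sq2"
    unfolding pair_sq_density by (simp only: ennreal_indicator)
  then show ?thesis
    using integral_density[of g lborel "indicator (unit_square \<times> unit_square)"]
    by (simp add: borel_Times)
qed

text \<open>Values outside of the unit interval are irrelevant, so that the Borel version can be taken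
  in the unit interval everywhere.\<close>

lemma ex_borel_version:
  assumes V: "V \<in> borel_measurable (lebesgue_on (unit_square \<times> unit_square))"
    and V01: "\<And>p. p \<in> unit_square \<times> unit_square \<Longrightarrow> 0 \<le> V p \<and> V p \<le> 1"
  shows "\<exists>V'\<in>borel_measurable borel. (\<forall>p. 0 \<le> V' p \<and> V' p \<le> (1::real)) \<and> (AE p in sq2. V p = V' p)"
proof -
  have "(\<lambda>p. if p \<in> unit_square \<times> unit_square then V p else 0) \<in> borel_measurable lebesgue"
    using V by (subst borel_measurable_if) auto
  then obtain g where g: "g \<in> borel_measurable lborel"
    "AE p in lborel. (if p \<in> unit_square \<times> unit_square then V p else 0) = g p"
    using completion_ex_borel_measurable_real by blast
  have [measurable]: "g \<in> borel_measurable borel" using g(1) by simp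
  show ?thesis
  proof (intro bexI[of _ "\<lambda>p. max 0 (min 1 (g p))"] conjI)
    show "AE p in sq2. V p = max 0 (min 1 (g p))"
      unfolding AE_pair_iff using g(2)
    proof eventually_elim
      case (elim p)
      then show ?case using V01[of p] by auto
    qed
  qed auto
qed

lemma ex_borel_set_version:
  assumes S: "S \<in> sets (lebesgue_on unit_square)"
  shows "\<exists>S'\<in>sets borel. AE x in sq. x \<in> S \<longleftrightarrow> x \<in> S'"
proof -
  have "S \<in> sets lebesgue" using S by (auto simp: sets_restrict_space)
  then have "indicator S \<in> borel_measurable (completion lborel)" by simp
  then obtain g :: "point \<Rightarrow> real" where g: "g \<in> borel_measurable lborel" "AE x in lborel. indicator S x = g x"
    using completion_ex_borel_measurable_real by blast
  have [measurable]: "g \<in> borel_measurable borel" using g(1) by simp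
  show ?thesis
  proof (intro bexI[of _ "{x. g x = 1}"])
    have "AE x in lborel. x \<in> S \<longleftrightarrow> x \<in> {x. g x = 1}"
      using g(2) by eventually_elim (auto simp: indicator_def split: if_splits)
    then show "AE x in sq. x \<in> S \<longleftrightarrow> x \<in> {x. g x = 1}" unfolding AE_sq_iff by eventually_elim auto
    show "{x. g x = 1} \<in> sets borel" by measurable
  qed
qed

lemma column_close:
  assumes s: "0 \<le> s"
  shows "(\<integral>p. indicator {p. \<bar>fst (fst p) - fst (snd p)\<bar> \<le> s} p \<partial>sq2) \<le> 2 * (s::real)"
proof -
  let ?E = "{p :: point \<times> point. \<bar>fst (fst p) - fst (snd p)\<bar> \<le> s}"
  have E: "?E \<in> sets borel" by measurable
  have "emeasure sq2 ?E = (\<integral>\<^sup>+u. emeasure sq (Pair u -` ?E) \<partial>sq)"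
    using E by (intro sq.emeasure_pair_measure_alt) (simp only: pair_borel)
  also have "\<dots> \<le> (\<integral>\<^sup>+u. ennreal (2 * s) \<partial>sq)"
  proof (intro nn_integral_mono)
    fix u :: point
    have eq: "Pair u -` ?E = {fst u - s .. fst u + s} \<times> UNIV" by auto
    have "emeasure sq (Pair u -` ?E) = emeasure lborel (unit_square \<inter> Pair u -` ?E)"
      unfolding eq by (intro emeasure_sq borel_Times) auto
    also have "\<dots> \<le> emeasure lborel ({fst u - s .. fst u + s} \<times> {0..1::real})"
      unfolding eq by (intro emeasure_mono) (auto simp: unit_square_def intro!: borel_Times)
    also have "\<dots> = emeasure lborel {fst u - s .. fst u + s} * emeasure lborel {0..1::real}"
      by (intro emeasure_lborel_Times) auto
    also have "\<dots> = ennreal (2 * s)" using s by simp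
    finally show "emeasure sq (Pair u -` ?E) \<le> ennreal (2 * s)" .
  qed
  also have "\<dots> = ennreal (2 * s)" using sq.emeasure_space_1 by simp
  finally have "measure sq2 ?E \<le> 2 * s"
    using s by (simp add: sq.pair.emeasure_eq_measure)
  then show ?thesis using E by simp
qed

definition order_kernel :: "point \<times> point \<Rightarrow> real" where
  "order_kernel = indicator {p. fst (fst p) \<le> fst (snd p)}"

lemma order_kernel_measurable [measurable]: "order_kernel \<in> borel_measurable borel"
  unfolding order_kernel_def by measurable

lemma order_kernel_bounds: "0 \<le> order_kernel p \<and> order_kernel p \<le> 1"
  unfolding order_kernel_def by (auto simp: indicator_def)

lemma integrable_pair_bounded:
  fixes g :: "point \<times> point \<Rightarrow> real"
  assumes "g \<in> borel_measurable borel" "\<And>p. \<bar>g p\<bar> \<le> 1"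
  shows "integrable sq2 g"
proof (rule sq.pair.integrable_const_bound[of _ 1])
  show "g \<in> borel_measurable sq2"
    using assms(1) measurable_cong_sets[OF pair_borel refl, of "borel :: real measure"] by blast
qed (use assms(2) in auto)

lemma kcut_close_columns:
  assumes [measurable]: "D \<in> borel_measurable borel" and "\<And>p. \<bar>D p\<bar> \<le> 1" and s: "0 \<le> s"
    and AE: "AE p in sq2. D p = 0 \<or> \<bar>fst (fst p) - fst (snd p)\<bar> \<le> s"
  shows "sq.kcut D (2 * s)"
proof (rule sq.kcut_L1)
  show int: "integrable sq2 D" using assms by (intro integrable_pair_bounded) auto
  have "(\<integral>p. \<bar>D p\<bar> \<partial>sq2) \<le> (\<integral>p. indicator {p. \<bar>fst (fst p) - fst (snd p)\<bar> \<le> s} p \<partial>sq2)"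
  proof (rule integral_mono_AE)
    show "integrable sq2 (\<lambda>p. indicator {p. \<bar>fst (fst p) - fst (snd p)\<bar> \<le> s} p :: real)"
    proof (intro integrable_pair_bounded borel_measurable_indicator)
      show "{p :: point \<times> point. \<bar>fst (fst p) - fst (snd p)\<bar> \<le> s} \<in> sets borel" by measurable
    qed (rule indicator_abs_le_1)
    show "AE p in sq2. \<bar>D p\<bar> \<le> indicator {p. \<bar>fst (fst p) - fst (snd p)\<bar> \<le> s} p"
      using AE by eventually_elim (use assms(2) in \<open>auto simp: indicator_def\<close>)
  qed (use int in auto)
  also have "\<dots> \<le> 2 * s" by (rule column_close[OF s])
  finally show "(\<integral>p. \<bar>D p\<bar> \<partial>sq2) \<le> 2 * s" .
qed

lemma kcut_sum:
  fixes c :: real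
  assumes "finite A" "\<And>a. a \<in> A \<Longrightarrow> sq.kcut (D a) c" "\<And>a. a \<in> A \<Longrightarrow> integrable sq2 (D a)"
  shows "sq.kcut (\<lambda>p. \<Sum>a\<in>A. D a p) (card A * c)"
  using assms
proof (induction A rule: finite_induct)
  case empty
  then show ?case by (simp add: sq.kcut_def)
next
  case (insert a A)
  then have "sq.kcut (\<lambda>p. D a p + (\<Sum>a\<in>A. D a p)) (c + card A * c)" by (intro sq.kcut_add) auto
  then show ?case using insert by (simp add: algebra_simps)
qed

lemma kcut_test_functions:
  assumes cut: "sq.kcut D c" and [measurable]: "f \<in> borel_measurable borel" "g \<in> borel_measurable borel"
    and f: "\<And>x. 0 \<le> f x \<and> f x \<le> 1" and g: "\<And>x. 0 \<le> g x \<and> g x \<le> (1::real)"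
  shows "sq.kcut (\<lambda>p. f (fst p) * g (snd p) * D p) c"
  unfolding sq.kcut_def
proof (intro ballI impI)
  fix f' g' :: "point \<Rightarrow> real"
  assume m: "f' \<in> borel_measurable sq" "g' \<in> borel_measurable sq" and 
    b: "\<forall>x. 0 \<le> f' x \<and> f' x \<le> 1" "\<forall>x. 0 \<le> g' x \<and> g' x \<le> 1"
  have [measurable]: "f' \<in> borel_measurable borel" "g' \<in> borel_measurable borel" using m by (auto cong: measurable_cong_sets)
  have "\<bar>\<integral>p. (f' (fst p) * f (fst p)) * (g' (snd p) * g (snd p)) * D p \<partial>sq2\<bar> \<le> c"
  proof (rule sq.kcutD[OF cut])
    show "0 \<le> f' x * f x \<and> f' x * f x \<le> 1" for x
      using f[of x] b(1)[rule_format, of x] by (simp add: mult_le_one)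
    show "0 \<le> g' x * g x \<and> g' x * g x \<le> 1" for x
      using g[of x] b(2)[rule_format, of x] by (simp add: mult_le_one)
  qed measurable
  then show "\<bar>\<integral>p. f' (fst p) * g' (snd p) * (f (fst p) * g (snd p) * D p) \<partial>sq2\<bar> \<le> c"
    by (simp add: mult_ac)
qed

text \<open>Divide the square into \<open>R\<close> vertical strips. The order of two points in different strips is decided
  by the strips, so up to the pairs in a common strip the order kernel is a sum of \<open>R + 1\<close> products
  of indicators, each of which can be absorbed by the test functions.\<close>

lemma kcut_order:
  assumes cut: "sq.kcut D c" and [measurable]: "D \<in> borel_measurable borel" and D1: "\<And>p. \<bar>D p\<bar> \<le> 1" and R: "R > 0"
  shows "sq.kcut (\<lambda>p. order_kernel p * D p) ((real R + 1) * c + 2 / R)"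
proof -
  define q where "q u = nat \<lfloor>real R * fst u\<rfloor>" for u :: point
  have q_count [measurable]: "q \<in> borel \<rightarrow>\<^sub>M count_space UNIV" unfolding q_def by measurable
  have [measurable]: "q \<in> borel_measurable borel" using measurable_compose[OF q_count, of "\<lambda>x. x" borel] by simp
  define F where "F r p = indicator {u. q u = r} (fst p) * indicator {u. r < q u} (snd p) * D p" for r p
  have [measurable]: "Measurable.pred borel (\<lambda>p :: point \<times> point. q (fst p) < q (snd p) \<and> q (fst p) \<le> R)"
    by measurable
  define G where "G p = (order_kernel p - of_bool (q (fst p) < q (snd p) \<and> q (fst p) \<le> R)) * D p" for p
  have Fsum: "(\<Sum>r\<in>{..R}. F r p) = of_bool (q (fst p) < q (snd p) \<and> q (fst p) \<le> R) * D p" for p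
  proof -
    have "(\<Sum>r\<in>{..R}. F r p) = (\<Sum>r\<in>{..R}. if r = q (fst p) then indicator {u. r < q u} (snd p) * D p else 0)"
      unfolding F_def by (intro sum.cong) (auto simp: indicator_def)
    then show ?thesis by (auto simp: indicator_def)
  qed
  have Fcut: "sq.kcut (F r) c" for r
    unfolding F_def by (rule kcut_test_functions[OF cut]) (auto simp: indicator_def)
  have Fint: "integrable sq2 (F r)" for r
    unfolding F_def by (rule integrable_pair_bounded) (use D1 in \<open>auto simp: indicator_def\<close>)
  have Gm[measurable]: "G \<in> borel_measurable borel" unfolding G_def by measurable
  have G1: "\<bar>G p\<bar> \<le> 1" for p unfolding G_def order_kernel_def using D1[of p] by (auto simp: of_bool_def indicator_def)
  have "sq.kcut G (2 * (1 / R))"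
  proof (rule kcut_close_columns)
    have AE1: "AE p in sq2. p \<in> unit_square \<times> unit_square" unfolding AE_pair_iff by simp
    then show "AE p in sq2. G p = 0 \<or> \<bar>fst (fst p) - fst (snd p)\<bar> \<le> 1 / R"
    proof eventually_elim
      case (elim p)
      obtain x a y b where p: "p = ((x, a), (y, b))" by (metis surj_pair)
      have xy: "0 \<le> x" "x \<le> 1" "0 \<le> y" "y \<le> 1" using elim unfolding p unit_square_def by auto
      have fl: "0 \<le> \<lfloor>real R * x\<rfloor>" "0 \<le> \<lfloor>real R * y\<rfloor>" using xy by auto
      have "real R * x \<le> real R" using xy R by (simp add: mult_left_le)
      then have qR: "q (x, a) \<le> R" unfolding q_def by (simp add: nat_le_iff floor_le_iff)
      consider "q (x, a) < q (y, b)" | "q (y, b) < q (x, a)" | "q (x, a) = q (y, b)" by linarith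
      then show ?case
      proof cases
        case 1
        then have "\<lfloor>real R * x\<rfloor> < \<lfloor>real R * y\<rfloor>" using fl unfolding q_def by simp
        then have "real R * x < real R * y" by linarith
        then show ?thesis using 1 qR R unfolding p G_def order_kernel_def by simp
      next
        case 2
        then have "\<lfloor>real R * y\<rfloor> < \<lfloor>real R * x\<rfloor>" using fl unfolding q_def by simp
        then have "real R * y < real R * x" by linarith
        then show ?thesis using 2 R unfolding p G_def order_kernel_def by simp
      next
        case 3
        then have "\<lfloor>real R * y\<rfloor> = \<lfloor>real R * x\<rfloor>" using fl unfolding q_def by (simp add: nat_eq_iff)
        then have "\<bar>real R * x - real R * y\<bar> \<le> 1" by linarith
        then have "real R * \<bar>x - y\<bar> \<le> 1" by (simp add: abs_mult flip: right_diff_distrib)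
        then show ?thesis using R unfolding p by (simp add: field_simps)
      qed
    qed
  qed (use G1 in auto)
  then have "sq.kcut (\<lambda>p. (\<Sum>r\<in>{..R}. F r p) + G p) (card {..R} * c + 2 * (1 / R))"
  proof (rule sq.kcut_add[rotated])
    show "sq.kcut (\<lambda>p. \<Sum>r\<in>{..R}. F r p) (card {..R} * c)" using Fcut Fint by (intro kcut_sum) auto
    show "integrable sq2 (\<lambda>p. \<Sum>r\<in>{..R}. F r p)"
      using Fint by (intro Bochner_Integration.integrable_sum)
    show "integrable sq2 G" using G1 by (intro integrable_pair_bounded) auto
  qed
  moreover have "(\<Sum>r\<in>{..R}. F r p) + G p = order_kernel p * D p" for p
    unfolding Fsum G_def by (simp add: left_diff_distrib)
  ultimately show ?thesis by (simp add: algebra_simps)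
qed

section \<open>Cut-norm and rearrangements via Borel versions\<close>

lemma borel_measurable_completion_AE:
  fixes f g :: "'a \<Rightarrow> 'b::topological_space"
  assumes f: "f \<in> borel_measurable M" and AE: "AE x in M. f x = g x"
  shows "g \<in> borel_measurable (completion M)"
proof (rule measurableI)
  fix A :: "'b set" assume A: "A \<in> sets borel"
  obtain N where N: "{x\<in>space M. f x \<noteq> g x} \<subseteq> N" "emeasure M N = 0" "N \<in> sets M"
    using AE by (rule AE_E)
  have null: "N \<in> null_sets M" using N by auto
  have "g -` A \<inter> space M = ((f -` A \<inter> space M) - N) \<union> (g -` A \<inter> space M \<inter> N)" using N(1) by auto
  moreover have "(f -` A \<inter> space M) - N \<in> sets (completion M)"
    using measurable_sets[OF f A] N(3) by (intro sets_completionI_sets) auto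
  moreover have "g -` A \<inter> space M \<inter> N \<in> sets (completion M)"
    using null by (rule null_sets_completion) auto
  ultimately have "g -` A \<inter> space M \<in> sets (completion M)" by (metis sets.Un)
  then show "g -` A \<inter> space (completion M) \<in> sets (completion M)" by simp
qed simp

lemma integral_completion_cong_AE:
  fixes f g :: "'a \<Rightarrow> real"
  assumes f: "f \<in> borel_measurable M" and AE: "AE x in M. f x = g x"
  shows "integral\<^sup>L (completion M) g = integral\<^sup>L M f"
proof -
  have "integral\<^sup>L (completion M) g = integral\<^sup>L (completion M) f"
  proof (rule integral_cong_AE)
    show "g \<in> borel_measurable (completion M)" by (rule borel_measurable_completion_AE[OF f AE])
    show "f \<in> borel_measurable (completion M)" using f by (rule measurable_completion)
    show "AE x in completion M. g x = f x" using AE_completion[OF AE] by eventually_elim simp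
  qed
  also have "\<dots> = integral\<^sup>L M f" using f by (rule integral_completion)
  finally show ?thesis .
qed

lemma borel_Int_unit_square:
  assumes "A \<in> sets borel"
  shows "A \<inter> unit_square \<in> sets (lebesgue_on unit_square)"
  unfolding sets_restrict_space using assms by (intro image_eqI[of _ _ A]) (auto simp: Int_commute)

text \<open>Lebesgue measurable data agree with Borel measurable data up to null sets, which the integral ignores.\<close>

lemma integral_rectangle:
  assumes S: "S \<in> sets (lebesgue_on unit_square)" "S' \<in> sets borel" "AE x in sq. x \<in> S \<longleftrightarrow> x \<in> S'"
    and T: "T \<in> sets (lebesgue_on unit_square)" "T' \<in> sets borel" "AE x in sq. x \<in> T \<longleftrightarrow> x \<in> T'"
    and V'[measurable]: "V' \<in> borel_measurable borel" and V: "AE p in sq2. V p = (V' p :: real)"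
  shows "(LINT p:S \<times> T|lebesgue. V p) = (\<integral>p. indicator S' (fst p) * indicator T' (snd p) * V' p \<partial>sq2)"
proof -
  have sub: "S \<subseteq> unit_square" "T \<subseteq> unit_square" using S(1) T(1) by (auto simp: sets_restrict_space)
  have [measurable]: "(\<lambda>p. indicator S' (fst p) :: real) \<in> borel_measurable (borel :: (point \<times> point) measure)"
      "(\<lambda>p. indicator T' (snd p) :: real) \<in> borel_measurable (borel :: (point \<times> point) measure)"
    using measurable_compose[OF measurable_fst_borel[OF measurable_ident] borel_measurable_indicator[OF S(2)]]
      measurable_compose[OF measurable_snd_borel[OF measurable_ident] borel_measurable_indicator[OF T(2)]] by simp_all
  have gm: "(\<lambda>p. indicator S' (fst p) * indicator T' (snd p) * V' p) \<in> borel_measurable borel" by measurable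
  have "(LINT p:S \<times> T|lebesgue. V p) =
    (\<integral>p. indicator (unit_square \<times> unit_square) p * (indicator S' (fst p) * indicator T' (snd p) * V' p) \<partial>lborel)"
    unfolding set_lebesgue_integral_def
  proof (rule integral_completion_cong_AE)
    show "(\<lambda>p. indicator (unit_square \<times> unit_square) p * (indicator S' (fst p) * indicator T' (snd p) * V' p)) \<in> borel_measurable lborel"
      using gm by simp
    have "AE p in sq2. indicator (unit_square \<times> unit_square) p * (indicator S' (fst p) * indicator T' (snd p) * V' p) =
        indicator (S \<times> T) p *\<^sub>R V p"
      using sq.AE_fst[OF S(3)] sq.AE_snd[OF T(3)] V
      by eventually_elim (use sub in \<open>auto simp: indicator_def mem_Times_iff\<close>)
    then show "AE p in lborel. indicator (unit_square \<times> unit_square) p * (indicator S' (fst p) * indicator T' (snd p) * V' p) =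
        indicator (S \<times> T) p *\<^sub>R V p"
      unfolding AE_pair_iff by eventually_elim (use sub in \<open>auto simp: indicator_def mem_Times_iff\<close>)
  qed
  also have "\<dots> = (\<integral>p. indicator S' (fst p) * indicator T' (snd p) * V' p \<partial>sq2)"
    using gm by (rule integral_pair_sq[symmetric])
  finally show ?thesis .
qed

lemma abs_integral_rectangle_le:
  assumes "sq.kcut V' c" "S' \<in> sets borel" "T' \<in> sets borel"
  shows "\<bar>\<integral>p. indicator S' (fst p) * indicator T' (snd p) * V' p \<partial>sq2\<bar> \<le> c"
proof (rule sq.kcutD[OF assms(1)])
  show "indicator S' \<in> borel_measurable sq" "indicator T' \<in> borel_measurable sq"
    using assms(2,3) by (intro borel_measurable_indicator; simp)+
qed (simp_all add: indicator_def)

context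
  fixes V V' :: "point \<times> point \<Rightarrow> real"
  assumes V'[measurable]: "V' \<in> borel_measurable borel" and V1: "\<And>p. \<bar>V' p\<bar> \<le> 1"
    and V: "AE p in sq2. V p = V' p"
begin

lemma rectangle_le_if_kcut:
  assumes cut: "sq.kcut V' c" and S: "S \<in> sets (lebesgue_on unit_square)" and T: "T \<in> sets (lebesgue_on unit_square)"
  shows "\<bar>LINT p:S \<times> T|lebesgue. V p\<bar> \<le> c"
proof -
  obtain S' where S': "S' \<in> sets borel" "AE x in sq. x \<in> S \<longleftrightarrow> x \<in> S'" using ex_borel_set_version[OF S] by blast
  obtain T' where T': "T' \<in> sets borel" "AE x in sq. x \<in> T \<longleftrightarrow> x \<in> T'" using ex_borel_set_version[OF T] by blast
  show ?thesis unfolding integral_rectangle[OF S S' T T' V' V]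
    using cut S'(1) T'(1) by (rule abs_integral_rectangle_le)
qed

lemma cut_norm_le_if_kcut:
  assumes "sq.kcut V' c"
  shows "cut_norm V \<le> c"
  unfolding cut_norm_def
proof (rule cSUP_least)
  show "sets (lebesgue_on unit_square) \<times> sets (lebesgue_on unit_square) \<noteq> {}" by (auto intro: sets.empty_sets)
qed (use rectangle_le_if_kcut[OF assms] in auto)

lemma kcut_cut_norm: "sq.kcut V' (cut_norm V)"
proof (rule sq.kcut_if_rectangles)
  show int: "integrable sq2 V'" using V1 by (intro integrable_pair_bounded) auto
  have "(\<integral>p. \<bar>V' p\<bar> \<partial>sq2) \<le> 1"
    using int V1 by (intro sq.pair.integral_le_const) auto
  then have cut1: "sq.kcut V' 1" by (rule sq.kcut_L1[OF int])
  have bdd: "bdd_above ((\<lambda>(S, T). \<bar>LINT p:S \<times> T|lebesgue. V p\<bar>) ` (sets (lebesgue_on unit_square) \<times> sets (lebesgue_on unit_square)))"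
    by (rule bdd_aboveI[of _ 1]) (use rectangle_le_if_kcut[OF cut1] in auto)
  fix S T assume "S \<in> sets sq" "T \<in> sets sq"
  then have S: "S \<in> sets borel" and T: "T \<in> sets borel" by auto
  have L: "A \<inter> unit_square \<in> sets (lebesgue_on unit_square)" if "A \<in> sets borel" for A
    using that by (rule borel_Int_unit_square)
  have AE: "AE x in sq. x \<in> A \<inter> unit_square \<longleftrightarrow> x \<in> A" for A
    unfolding AE_sq_iff by auto
  have "\<bar>LINT p:(S \<inter> unit_square) \<times> (T \<inter> unit_square)|lebesgue. V p\<bar> \<le> cut_norm V"
    unfolding cut_norm_def
    using cSUP_upper[OF _ bdd, of "(S \<inter> unit_square, T \<inter> unit_square)"] L[OF S] L[OF T] by simp
  then show "\<bar>\<integral>p. indicator S (fst p) * indicator T (snd p) * V' p \<partial>sq2\<bar> \<le> cut_norm V"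
    unfolding integral_rectangle[OF L[OF S] S AE L[OF T] T AE V' V] .
qed

end

lemma ex_borel_map_version:
  assumes f: "f \<in> mp_bijections"
  shows "\<exists>f'\<in>borel_measurable borel. distr sq sq f' = sq \<and> (AE x in sq. f x = f' x)"
proof -
  have bij: "bij_betw f unit_square unit_square" and
    mp: "measure_preserving (lebesgue_on unit_square) (lebesgue_on unit_square) f"
    using f unfolding mp_bijections_def by auto
  have fm: "f \<in> lebesgue_on unit_square \<rightarrow>\<^sub>M lebesgue_on unit_square" using mp unfolding measure_preserving_def by auto
  have fQ: "f x \<in> unit_square" if "x \<in> unit_square" for x using bij that by (auto simp: bij_betw_def)
  have fb: "f \<in> borel_measurable (lebesgue_on unit_square)"
  proof (rule measurableI)
    fix A :: "point set" assume A: "A \<in> sets borel"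
    then have "A \<inter> unit_square \<in> sets (lebesgue_on unit_square)" by (rule borel_Int_unit_square)
    from measurable_sets[OF fm this]
    have "f -` (A \<inter> unit_square) \<inter> unit_square \<in> sets (lebesgue_on unit_square)" by simp
    also have "f -` (A \<inter> unit_square) \<inter> unit_square = f -` A \<inter> unit_square" using fQ by auto
    finally show "f -` A \<inter> space (lebesgue_on unit_square) \<in> sets (lebesgue_on unit_square)" by simp
  qed simp
  have ver: "\<exists>g\<in>borel_measurable lborel. AE x in lborel. x \<in> unit_square \<longrightarrow> h (f x) = g x"
    if h: "h \<in> borel_measurable borel" for h :: "point \<Rightarrow> real"
  proof -
    have "(\<lambda>x. h (f x)) \<in> borel_measurable (lebesgue_on unit_square)" using measurable_compose[OF fb h] .
    then have "(\<lambda>x. if x \<in> unit_square then h (f x) else 0) \<in> borel_measurable lebesgue"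
      by (subst borel_measurable_if) auto
    then obtain g where "g \<in> borel_measurable lborel" "AE x in lborel. (if x \<in> unit_square then h (f x) else 0) = g x"
      using completion_ex_borel_measurable_real by blast
    then show ?thesis by (intro bexI[of _ g]) (auto elim: eventually_mono)
  qed
  obtain g1 where g1: "g1 \<in> borel_measurable lborel" "AE x in lborel. x \<in> unit_square \<longrightarrow> fst (f x) = g1 x"
    using ver[of fst] by auto
  obtain g2 where g2: "g2 \<in> borel_measurable lborel" "AE x in lborel. x \<in> unit_square \<longrightarrow> snd (f x) = g2 x"
    using ver[of snd] by auto
  define f' where "f' x = (g1 x, g2 x)" for x
  have [measurable]: "g1 \<in> borel_measurable borel" "g2 \<in> borel_measurable borel" using g1(1) g2(1) by auto
  have f'm: "f' \<in> borel_measurable borel" unfolding f'_def[abs_def] by (intro borel_measurable_Pair) measurable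
  have AE: "AE x in lborel. x \<in> unit_square \<longrightarrow> f x = f' x"
    using g1(2) g2(2) unfolding f'_def by eventually_elim (auto simp: prod_eq_iff)
  have "distr sq sq f' = sq"
  proof (rule measure_eqI)
    fix A assume "A \<in> sets (distr sq sq f')"
    then have A: "A \<in> sets borel" by simp
    have f'sq: "f' \<in> sq \<rightarrow>\<^sub>M sq" using f'm by (simp cong: measurable_cong_sets)
    have vm: "f' -` A \<in> sets borel" using measurable_sets[OF f'm A] by simp
    have AL: "A \<inter> unit_square \<in> sets (lebesgue_on unit_square)" using A by (rule borel_Int_unit_square)
    have pre: "f -` (A \<inter> unit_square) \<inter> unit_square \<in> sets (lebesgue_on unit_square)"
      using measurable_sets[OF fm AL] by simp
    have sub: "f -` (A \<inter> unit_square) \<inter> unit_square \<in> sets lebesgue"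
      using pre sets_restrict_space_iff[of unit_square lebesgue] by simp
    have "emeasure (distr sq sq f') A = emeasure sq (f' -` A)"
      using A by (subst emeasure_distr[OF f'sq]) auto
    also have "\<dots> = emeasure lborel (unit_square \<inter> f' -` A)" using vm by (rule emeasure_sq)
    also have "\<dots> = emeasure lebesgue (unit_square \<inter> f' -` A)" using vm by (simp add: sets.Int)
    also have "\<dots> = emeasure lebesgue (f -` (A \<inter> unit_square) \<inter> unit_square)"
    proof (rule emeasure_eq_AE)
      show "AE x in lebesgue. x \<in> unit_square \<inter> f' -` A \<longleftrightarrow> x \<in> f -` (A \<inter> unit_square) \<inter> unit_square"
        using AE_completion[OF AE] by eventually_elim (use fQ in auto)
      show "unit_square \<inter> f' -` A \<in> sets lebesgue" using vm by auto
    qed (rule sub)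
    also have "\<dots> = emeasure (lebesgue_on unit_square) (f -` (A \<inter> unit_square) \<inter> unit_square)"
      by (subst emeasure_restrict_space) auto
    also have "\<dots> = emeasure (lebesgue_on unit_square) (A \<inter> unit_square)"
      using mp AL unfolding measure_preserving_def by (simp del: vimage_Int)
    also have "\<dots> = emeasure lebesgue (A \<inter> unit_square)" by (subst emeasure_restrict_space) auto
    also have "\<dots> = emeasure lborel (unit_square \<inter> A)" using A by (simp add: sets.Int Int_commute)
    also have "\<dots> = emeasure sq A" using A by (rule emeasure_sq[symmetric])
    finally show "emeasure (distr sq sq f') A = emeasure sq A" .
  qed simp
  then show ?thesis using f'm AE unfolding AE_sq_iff[symmetric] by blast
qed

lemma distr_pair_map:
  assumes f': "f' \<in> borel_measurable borel" "distr sq sq f' = sq"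
  shows "distr sq2 sq2 (\<lambda>(x, y). (f' x, f' y)) = sq2"
proof -
  have m: "f' \<in> sq \<rightarrow>\<^sub>M sq" using f'(1) by (simp cong: measurable_cong_sets)
  have "distr sq sq f' \<Otimes>\<^sub>M distr sq sq f' = distr sq2 sq2 (\<lambda>(x, y). (f' x, f' y))"
    by (rule pair_measure_distr[OF m m]) (simp add: f'(2) sq.sigma_finite_measure_axioms)
  then show ?thesis by (simp add: f'(2))
qed

lemma map_pair_measurable:
  assumes [measurable]: "f' \<in> borel_measurable borel"
  shows "(\<lambda>(x, y). (f' x, f' y)) \<in> sq2 \<rightarrow>\<^sub>M sq2"
proof -
  have m: "f' \<in> sq \<rightarrow>\<^sub>M sq" using assms by (simp cong: measurable_cong_sets)
  show ?thesis using m by measurable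
qed

text \<open>The product of a measure preserving map with itself preserves the product measure, so the preimage of
  a null set is a null set.\<close>

lemma AE_pull:
  assumes f': "f' \<in> borel_measurable borel" "distr sq sq f' = sq" and f: "AE x in sq. f x = f' x"
    and U: "AE p in sq2. U p = U' p"
  shows "AE p in sq2. pull U f p = U' (f' (fst p), f' (snd p))"
proof -
  have "AE p in distr sq2 sq2 (\<lambda>(x, y). (f' x, f' y)). U p = U' p"
    unfolding distr_pair_map[OF f'] by (rule U)
  from AE_distrD[OF map_pair_measurable[OF f'(1)] this] sq.AE_fst[OF f] sq.AE_snd[OF f]
  show ?thesis by eventually_elim (auto simp: pull_def case_prod_unfold)
qed

lemma Shift_upper:
  assumes f: "f \<in> mp_bijections" and x: "x \<in> unit_square"
  shows "\<bar>fst x - fst (f x)\<bar> \<le> Shift f"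
  unfolding Shift_def
proof (rule cSUP_upper[OF x])
  have "\<bar>fst p - fst (f p)\<bar> \<le> 1" if "p \<in> unit_square" for p
  proof -
    have "f p \<in> unit_square" using f that unfolding mp_bijections_def by (auto simp: bij_betw_def)
    then show ?thesis using that unfolding unit_square_def by (auto simp: mem_Times_iff)
  qed
  then show "bdd_above ((\<lambda>p. \<bar>fst p - fst (f p)\<bar>) ` unit_square)" by (auto intro!: bdd_aboveI[of _ 1])
qed

lemma Shift_nonneg:
  assumes "f \<in> mp_bijections"
  shows "0 \<le> Shift f"
proof -
  have "(0, 0) \<in> unit_square" unfolding unit_square_def by auto
  from Shift_upper[OF assms this] show ?thesis by (rule order_trans[OF abs_ge_zero])
qed

section \<open>Continuity of the densities\<close>

definition vertex_pairs :: "nat \<Rightarrow> (nat \<times> nat) set" where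
  "vertex_pairs k = {(i, j). i \<in> {1..k} \<and> j \<in> {1..k} \<and> i < j}"

lemma finite_vertex_pairs [simp]: "finite (vertex_pairs k)"
  by (rule finite_subset[of _ "{1..k} \<times> {1..k}"]) (auto simp: vertex_pairs_def)

lemma vertex_pairsD: "p \<in> vertex_pairs k \<Longrightarrow> fst p \<in> {1..k} \<and> snd p \<in> {1..k} \<and> fst p < snd p"
  unfolding vertex_pairs_def by auto

definition edge_factor :: "nat set set \<Rightarrow> (point \<times> point \<Rightarrow> real) \<Rightarrow> nat \<times> nat \<Rightarrow> point \<times> point \<Rightarrow> real" where
  "edge_factor E W p x = (if {fst p, snd p} \<in> E then W x else 1 - W x)"

text \<open>The order constraint is a product over all pairs of vertices and can be absorbed in the edge
  factors; the density becomes a homomorphism integral without a constraint.\<close>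

definition density_kernel :: "nat set set \<Rightarrow> (point \<times> point \<Rightarrow> real) \<Rightarrow> nat \<times> nat \<Rightarrow> point \<times> point \<Rightarrow> real" where
  "density_kernel E W p x = order_kernel x * edge_factor E W p x"

lemma density_kernel_measurable:
  "W \<in> borel_measurable borel \<Longrightarrow> density_kernel E W p \<in> borel_measurable borel"
  unfolding density_kernel_def[abs_def] edge_factor_def by (cases "{fst p, snd p} \<in> E") simp_all

lemma edge_factor_bounds:
  assumes "\<And>x. 0 \<le> W x \<and> W x \<le> 1"
  shows "0 \<le> edge_factor E W p x \<and> edge_factor E W p x \<le> 1"
  unfolding edge_factor_def using assms[of x] by auto

lemma density_kernel_bounds:
  assumes "\<And>x. 0 \<le> W x \<and> W x \<le> 1"
  shows "0 \<le> density_kernel E W p x \<and> density_kernel E W p x \<le> 1"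
  unfolding density_kernel_def
  using edge_factor_bounds[where W = W and E = E and p = p and x = x, OF assms] order_kernel_bounds[of x]
  by (simp add: mult_le_one)

lemma borel_measurable_pair_sq_iff: "borel_measurable sq2 = (borel_measurable borel :: (_ \<Rightarrow> real) set)"
  by (rule measurable_cong_sets) (rule pair_borel, rule refl)

lemma graph_density_eq_hom:
  assumes W'[measurable]: "W' \<in> borel_measurable borel" and W: "AE p in sq2. W p = W' p"
  shows "graph_density (k, E) W = fact k * sq.hom_integral {1..k} (vertex_pairs k) (density_kernel E W')"
proof -
  let ?I = "{1..k}" and ?P = "vertex_pairs k"
  define S where "S = {v \<in> ?I \<rightarrow>\<^sub>E unit_square. \<forall>i\<in>?I. \<forall>j\<in>?I. i \<le> j \<longrightarrow> fst (v i) \<le> fst (v j)}"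
  define A where "A v = (\<Prod>(i, j)\<in>{(i, j). i \<in> ?I \<and> j \<in> ?I \<and> i < j \<and> {i, j} \<in> E}. W (v i, v j)) *
        (\<Prod>(i, j)\<in>{(i, j). i \<in> ?I \<and> j \<in> ?I \<and> i < j \<and> {i, j} \<notin> E}. 1 - W (v i, v j))" for v
  define H where "H v = (\<Prod>p\<in>?P. density_kernel E W' p (v (fst p), v (snd p)))" for v
  have Q: "(?I \<rightarrow>\<^sub>E unit_square) \<in> sets (Pi\<^sub>M ?I (\<lambda>_. lborel))" by (intro sets_PiM_I_finite) auto
  have PiM_sets: "sets (Pi\<^sub>M ?I (\<lambda>_. lborel :: point measure)) = sets (Pi\<^sub>M ?I (\<lambda>_. sq))"
    by (intro sets_PiM_cong) auto
  have proj: "(\<lambda>v. (v a, v b)) \<in> Pi\<^sub>M ?I (\<lambda>_. sq) \<rightarrow>\<^sub>M sq2" if "a \<in> ?I" "b \<in> ?I" for a b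
    using that by measurable
  have Hm: "H \<in> borel_measurable (Pi\<^sub>M ?I (\<lambda>_. sq))"
    unfolding H_def using density_kernel_measurable[OF W'] vertex_pairsD
    by (intro borel_measurable_prod measurable_compose[OF proj]) (auto simp: borel_measurable_pair_sq_iff)
  then have HmL: "H \<in> borel_measurable (Pi\<^sub>M ?I (\<lambda>_. lborel))"
    using measurable_cong_sets[OF PiM_sets refl, of "borel :: real measure"] by blast
  have A_split: "A v = (\<Prod>p\<in>?P. edge_factor E W p (v (fst p), v (snd p)))" for v
  proof -
    have "(\<Prod>p\<in>?P. edge_factor E W p (v (fst p), v (snd p))) =
      (\<Prod>p\<in>?P. if {fst p, snd p} \<in> E then W (v (fst p), v (snd p)) else 1 - W (v (fst p), v (snd p)))"
      unfolding edge_factor_def ..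
    also have "\<dots> = (\<Prod>p\<in>?P \<inter> {p. {fst p, snd p} \<in> E}. W (v (fst p), v (snd p))) *
       (\<Prod>p\<in>?P \<inter> - {p. {fst p, snd p} \<in> E}. 1 - W (v (fst p), v (snd p)))"
      by (rule prod.If_cases) simp
    also have "?P \<inter> {p. {fst p, snd p} \<in> E} = {(i, j). i \<in> ?I \<and> j \<in> ?I \<and> i < j \<and> {i, j} \<in> E}"
      unfolding vertex_pairs_def by auto
    also have "?P \<inter> - {p. {fst p, snd p} \<in> E} = {(i, j). i \<in> ?I \<and> j \<in> ?I \<and> i < j \<and> {i, j} \<notin> E}"
      unfolding vertex_pairs_def by auto
    finally show ?thesis unfolding A_def by (simp add: case_prod_unfold)
  qed
  have order: "(\<Prod>p\<in>?P. order_kernel (v (fst p), v (snd p))) = (if v \<in> S then 1 else 0)" if v: "v \<in> ?I \<rightarrow>\<^sub>E unit_square" for v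
  proof (cases "v \<in> S")
    case True
    then have "order_kernel (v (fst p), v (snd p)) = 1" if "p \<in> ?P" for p
      using vertex_pairsD[OF that] unfolding S_def order_kernel_def by (auto simp: indicator_def)
    then show ?thesis using True by simp
  next
    case False
    then obtain i j where ij: "i \<in> ?I" "j \<in> ?I" "i \<le> j" "\<not> fst (v i) \<le> fst (v j)" using v unfolding S_def by blast
    then have "i < j" by (cases "i = j") auto
    then have "(i, j) \<in> ?P" using ij unfolding vertex_pairs_def by auto
    moreover have "order_kernel (v (fst (i, j)), v (snd (i, j))) = 0" using ij unfolding order_kernel_def by simp
    ultimately have "(\<Prod>p\<in>?P. order_kernel (v (fst p), v (snd p))) = 0" by (intro prod_zero bexI[of _ "(i, j)"]) auto
    then show ?thesis using False by simp
  qed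
  have "AE v in Pi\<^sub>M ?I (\<lambda>_. sq). \<forall>p\<in>?P. W (v (fst p), v (snd p)) = W' (v (fst p), v (snd p))"
  proof (rule AE_finite_allI)
    fix p assume "p \<in> ?P"
    then show "AE v in Pi\<^sub>M ?I (\<lambda>_. sq). W (v (fst p), v (snd p)) = W' (v (fst p), v (snd p))"
      using vertex_pairsD[of p k] by (intro sq.AE_PiM_pair[OF W]) auto
  qed simp
  then have AEL: "AE v in Pi\<^sub>M ?I (\<lambda>_. lborel). v \<in> ?I \<rightarrow>\<^sub>E unit_square \<longrightarrow>
      (\<forall>p\<in>?P. W (v (fst p), v (snd p)) = W' (v (fst p), v (snd p)))"
    unfolding PiM_sq_density[OF finite_atLeastAtMost] using Q
    by (subst (asm) AE_density) (auto elim!: eventually_mono simp: indicator_def)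
  have "graph_density (k, E) W = fact k * (LINT v : S | completion (Pi\<^sub>M ?I (\<lambda>_. lborel)). A v)"
    unfolding graph_density_def S_def A_def by simp
  also have "(LINT v : S | completion (Pi\<^sub>M ?I (\<lambda>_. lborel)). A v) =
     (\<integral>v. indicator (?I \<rightarrow>\<^sub>E unit_square) v * H v \<partial>Pi\<^sub>M ?I (\<lambda>_. lborel))"
    unfolding set_lebesgue_integral_def
  proof (rule integral_completion_cong_AE)
    show "(\<lambda>v. indicator (?I \<rightarrow>\<^sub>E unit_square) v * H v) \<in> borel_measurable (Pi\<^sub>M ?I (\<lambda>_. lborel))"
      using Q HmL by (intro borel_measurable_times borel_measurable_indicator)
    show "AE v in Pi\<^sub>M ?I (\<lambda>_. lborel). indicator (?I \<rightarrow>\<^sub>E unit_square) v * H v = indicator S v *\<^sub>R A v"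
      using AEL
    proof eventually_elim
      case (elim v)
      show ?case
      proof (cases "v \<in> ?I \<rightarrow>\<^sub>E unit_square")
        case True
        have "H v = (\<Prod>p\<in>?P. order_kernel (v (fst p), v (snd p))) * (\<Prod>p\<in>?P. edge_factor E W' p (v (fst p), v (snd p)))"
          unfolding H_def density_kernel_def by (rule prod.distrib)
        also have "(\<Prod>p\<in>?P. edge_factor E W' p (v (fst p), v (snd p))) = A v"
          unfolding A_split edge_factor_def using elim True by (intro prod.cong) auto
        finally show ?thesis using True order[OF True] by (simp add: indicator_def)
      next
        case False
        then show ?thesis unfolding S_def by (simp add: indicator_def)
      qed
    qed
  qed
  also have "\<dots> = sq.hom_integral ?I ?P (density_kernel E W')"
  proof -
    have "sq.hom_integral ?I ?P (density_kernel E W') = (\<integral>v. H v \<partial>density (Pi\<^sub>M ?I (\<lambda>_. lborel)) (\<lambda>v. ennreal (indicator (?I \<rightarrow>\<^sub>E unit_square) v)))"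
      unfolding sq.hom_integral_def H_def PiM_sq_density[OF finite_atLeastAtMost] by (simp only: ennreal_indicator)
    also have "\<dots> = (\<integral>v. indicator (?I \<rightarrow>\<^sub>E unit_square) v * H v \<partial>Pi\<^sub>M ?I (\<lambda>_. lborel))"
      using Q by (subst integral_density[OF HmL]) auto
    finally show ?thesis ..
  qed
  finally show ?thesis .
qed

lemma integrable_difference:
  assumes "K \<in> borel_measurable borel" "K' \<in> borel_measurable borel"
    "\<And>x. 0 \<le> K x \<and> K x \<le> 1" "\<And>x. 0 \<le> K' x \<and> K' x \<le> (1::real)"
  shows "integrable sq2 (\<lambda>x. K x - K' x)"
  using assms by (intro Bochner_Integration.integrable_diff integrable_pair_bounded) auto

lemma hom_diff_le:
  assumes K: "\<And>p. K p \<in> borel_measurable borel" "\<And>p x. 0 \<le> K p x \<and> K p x \<le> 1"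
    and K': "\<And>p. K' p \<in> borel_measurable borel" "\<And>p x. 0 \<le> K' p x \<and> K' p x \<le> 1"
    and cut: "\<And>p. sq.kcut (\<lambda>x. K p x - K' p x) c"
  shows "\<bar>sq.hom_integral {1..k} (vertex_pairs k) K - sq.hom_integral {1..k} (vertex_pairs k) K'\<bar> \<le> real (card (vertex_pairs k)) * c"
  using sq.counting[of "{1..k}" "vertex_pairs k" K K' "\<lambda>_. c"] assms vertex_pairsD
  by (simp add: borel_measurable_pair_sq_iff)

text \<open>A bijection with a small shift changes the order of two points only if these lie in a narrow
  strip around the diagonal; apart from this, the cut-norm controls the change of the kernels.\<close>

lemma density_continuity:
  assumes W: "orderon W" and U: "orderon U" and f: "f \<in> mp_bijections" and R: "R > 0"
  shows "\<bar>graph_density (k, E) W - graph_density (k, E) U\<bar> \<le>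
    fact k * (real (card (vertex_pairs k)) *
      ((real R + 1) * cut_norm (\<lambda>p. W p - pull U f p) + 2 / R + 4 * Shift f))"
proof -
  have bv: "\<exists>V'\<in>borel_measurable borel. (\<forall>p. 0 \<le> V' p \<and> V' p \<le> (1::real)) \<and> (AE p in sq2. V p = V' p)"
    if "orderon V" for V
    using that unfolding orderon_def by (intro ex_borel_version) auto
  obtain W' where W'[measurable]: "W' \<in> borel_measurable borel" and W'1: "\<And>p. 0 \<le> W' p \<and> W' p \<le> 1"
    and WW': "AE p in sq2. W p = W' p" using bv[OF W] by blast
  obtain U' where U'[measurable]: "U' \<in> borel_measurable borel" and U'1: "\<And>p. 0 \<le> U' p \<and> U' p \<le> 1"
    and UU': "AE p in sq2. U p = U' p" using bv[OF U] by blast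
  obtain f' where f'[measurable]: "f' \<in> borel_measurable borel" and distr: "distr sq sq f' = sq"
    and ff': "AE x in sq. f x = f' x" using ex_borel_map_version[OF f] by blast
  have f'sq: "f' \<in> sq \<rightarrow>\<^sub>M sq" using f' by (simp cong: measurable_cong_sets)
  let ?s = "Shift f" and ?d = "cut_norm (\<lambda>p. W p - pull U f p)"
  have s0: "0 \<le> ?s" by (rule Shift_nonneg[OF f])
  define T where "T x = (f' (fst x), f' (snd x))" for x :: "point \<times> point"
  have T[measurable]: "T \<in> borel_measurable borel" unfolding T_def by (intro borel_measurable_Pair) measurable
  define D where "D x = W' x - U' (T x)" for x
  have Dm[measurable]: "D \<in> borel_measurable borel" unfolding D_def by measurable
  have D1: "\<bar>D x\<bar> \<le> 1" for x using W'1[of x] U'1[of "T x"] unfolding D_def by linarith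
  have "AE x in sq2. W x - pull U f x = D x"
    using WW' AE_pull[OF f' distr ff' UU'] unfolding D_def T_def by eventually_elim simp
  then have cutD: "sq.kcut D ?d" by (intro kcut_cut_norm Dm D1)
  have oD: "sq.kcut (\<lambda>x. order_kernel x * D x) ((real R + 1) * ?d + 2 / R)"
    by (rule kcut_order[OF cutD Dm D1 R])
  have cut: "sq.kcut (\<lambda>x. density_kernel E W' p x - density_kernel E U' p (T x)) ((real R + 1) * ?d + 2 / R + 4 * ?s)" for p
  proof -
    define G where "G x = (order_kernel x - order_kernel (T x)) * edge_factor E U' p (T x)" for x
    have ef: "edge_factor E U' p \<in> borel_measurable borel"
      unfolding edge_factor_def[abs_def] by (cases "{fst p, snd p} \<in> E") simp_all
    have Gm: "G \<in> borel_measurable borel"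
      unfolding G_def by (intro borel_measurable_times borel_measurable_diff order_kernel_measurable
        measurable_compose[OF T order_kernel_measurable] measurable_compose[OF T ef])
    have G1: "\<bar>G x\<bar> \<le> 1" for x
      unfolding G_def using edge_factor_bounds[where W = U' and E = E and p = p and x = "T x", OF U'1] order_kernel_bounds[of x] order_kernel_bounds[of "T x"]
      by (auto simp: abs_mult intro!: mult_le_one)
    have shift: "AE x in sq. \<bar>fst x - fst (f' x)\<bar> \<le> ?s"
    proof -
      have "AE x in sq. x \<in> unit_square" unfolding AE_sq_iff by simp
      with ff' show ?thesis
      proof eventually_elim
        case (elim x)
        then show ?case using Shift_upper[OF f, of x] by simp
      qed
    qed
    have "sq.kcut G (2 * (2 * ?s))"
    proof (rule kcut_close_columns[OF Gm G1])
      show "AE x in sq2. G x = 0 \<or> \<bar>fst (fst x) - fst (snd x)\<bar> \<le> 2 * ?s"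
        using sq.AE_fst[OF shift] sq.AE_snd[OF shift]
      proof eventually_elim
        case (elim x)
        show ?case
        proof (cases "fst (fst x) \<le> fst (snd x) \<longleftrightarrow> fst (f' (fst x)) \<le> fst (f' (snd x))")
          case True
          then show ?thesis unfolding G_def order_kernel_def T_def by (simp add: indicator_def)
        next
          case False
          then show ?thesis using elim by linarith
        qed
      qed
    qed (use s0 in simp)
    then have G: "sq.kcut G (4 * ?s)" by simp
    have int: "integrable sq2 (\<lambda>x. order_kernel x * D x)"
      using D1 order_kernel_bounds by (intro integrable_pair_bounded) (auto simp: abs_mult intro!: mult_le_one)
    have intG: "integrable sq2 G" by (intro integrable_pair_bounded Gm G1)
    show ?thesis
    proof (cases "{fst p, snd p} \<in> E")
      case True
      have "(\<lambda>x. density_kernel E W' p x - density_kernel E U' p (T x)) = (\<lambda>x. order_kernel x * D x + G x)"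
        unfolding density_kernel_def G_def D_def edge_factor_def using True by (auto simp: algebra_simps)
      then show ?thesis using sq.kcut_add[OF oD G int intG] by simp
    next
      case False
      have "(\<lambda>x. density_kernel E W' p x - density_kernel E U' p (T x)) = (\<lambda>x. - (order_kernel x * D x) + G x)"
        unfolding density_kernel_def G_def D_def edge_factor_def using False by (auto simp: algebra_simps)
      then show ?thesis using sq.kcut_add[OF sq.kcut_uminus[OF oD] G _ intG] int by simp
    qed
  qed
  let ?hom = "sq.hom_integral {1..k} (vertex_pairs k)"
  have subst: "?hom (\<lambda>p x. density_kernel E U' p (T x)) = ?hom (density_kernel E U')"
    unfolding T_def using vertex_pairsD density_kernel_measurable[OF U'] f'sq distr
    by (intro sq.hom_substitute) (auto simp: borel_measurable_pair_sq_iff)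
  have "\<bar>?hom (density_kernel E W') - ?hom (\<lambda>p x. density_kernel E U' p (T x))\<bar> \<le>
    real (card (vertex_pairs k)) * ((real R + 1) * ?d + 2 / R + 4 * ?s)"
    using density_kernel_measurable[OF W'] density_kernel_bounds[where W = W', OF W'1] density_kernel_bounds[where W = U', OF U'1]
      measurable_compose[OF T density_kernel_measurable[OF U']] cut
    by (intro hom_diff_le)
  then show ?thesis
    unfolding graph_density_eq_hom[OF W' WW'] graph_density_eq_hom[OF U' UU'] subst
      right_diff_distrib[symmetric] abs_mult by simp
qed

lemma cut_norm_nonneg:
  assumes "V' \<in> borel_measurable borel" "\<And>p. \<bar>V' p\<bar> \<le> 1" "AE p in sq2. V p = V' p"
  shows "0 \<le> cut_norm V"
  using kcut_cut_norm[OF assms] by (rule sq.kcut_nonneg)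

lemma measure_preserving_ident:
  assumes g: "\<And>x. x \<in> space M \<Longrightarrow> g x = x"
  shows "measure_preserving M M g"
proof -
  have "g -` A \<inter> space M = A" if "A \<in> sets M" for A
    using sets.sets_into_space[OF that] g by auto
  then show ?thesis
    using measurable_cong[of M g "\<lambda>x. x" M] g unfolding measure_preserving_def by simp
qed

lemma id_mp_bijections: "id \<in> mp_bijections"
proof -
  have "inv_into unit_square id x = x" if "x \<in> unit_square" for x :: point
    using inv_into_f_f[of id unit_square x] that by simp
  then show ?thesis unfolding mp_bijections_def
    by (auto intro!: measure_preserving_ident)
qed

section \<open>Densities of grid kernels\<close>

definition cell :: "nat \<Rightarrow> point \<Rightarrow> nat \<times> nat" where
  "cell N u = (nat \<lfloor>real N * fst u\<rfloor>, nat \<lfloor>real N * snd u\<rfloor>)"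

lemma cell_vimage_borel [measurable]: "cell N -` {z} \<in> sets borel"
proof -
  have "cell N -` {z} = {u. nat \<lfloor>real N * fst u\<rfloor> = fst z} \<inter> {u. nat \<lfloor>real N * snd u\<rfloor> = snd z}"
    by (auto simp: cell_def prod_eq_iff)
  also have "\<dots> \<in> sets borel" by measurable
  finally show ?thesis .
qed

lemma grid_kernel_measurable:
  fixes F :: "nat \<times> nat \<Rightarrow> nat \<times> nat \<Rightarrow> real"
  shows "(\<lambda>x. F (cell N (fst x)) (cell N (snd x))) \<in> borel_measurable borel"
proof -
  have "(\<lambda>x. (cell N (fst x), cell N (snd x))) \<in> borel \<rightarrow>\<^sub>M count_space UNIV"
  proof (subst measurable_count_space_eq2_countable, safe)
    fix z z' :: "nat \<times> nat"
    have "(\<lambda>x. (cell N (fst x), cell N (snd x))) -` {(z, z')} \<inter> space borel = cell N -` {z} \<times> cell N -` {z'}" by auto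
    then show "(\<lambda>x. (cell N (fst x), cell N (snd x))) -` {(z, z')} \<inter> space borel \<in> sets borel"
      by (simp add: borel_Times cell_vimage_borel)
  qed auto
  from measurable_compose[OF this, of "\<lambda>(z, z'). F z z'" borel] show ?thesis by (simp add: case_prod_unfold)
qed

lemma nat_floor_eq_iff:
  assumes "0 \<le> x" "N > 0"
  shows "nat \<lfloor>real N * x\<rfloor> = i \<longleftrightarrow> real i / N \<le> x \<and> x < (real i + 1) / N"
proof -
  have "nat \<lfloor>real N * x\<rfloor> = i \<longleftrightarrow> \<lfloor>real N * x\<rfloor> = int i" using assms by (auto simp: nat_eq_iff)
  also have "\<dots> \<longleftrightarrow> real i \<le> real N * x \<and> real N * x < real i + 1" by (simp add: floor_eq_iff)
  also have "\<dots> \<longleftrightarrow> real i / N \<le> x \<and> x < (real i + 1) / N"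
    using assms(2) by (simp add: pos_divide_le_eq pos_less_divide_eq mult.commute)
  finally show ?thesis .
qed

definition cell_box :: "nat \<Rightarrow> nat \<times> nat \<Rightarrow> point set" where
  "cell_box N z = {real (fst z) / N ..< (real (fst z) + 1) / N} \<times> {real (snd z) / N ..< (real (snd z) + 1) / N}"

lemma cell_box_borel [measurable, simp]: "cell_box N z \<in> sets borel"
  unfolding cell_box_def by (intro borel_Times) auto

lemma cell_box_subset:
  assumes "z \<in> cells N"
  shows "cell_box N z \<subseteq> unit_square"
proof -
  have "real (fst z) + 1 \<le> N" "real (snd z) + 1 \<le> N" "N > 0" using assms unfolding cells_def by auto
  then have "(real (fst z) + 1) / N \<le> 1" "(real (snd z) + 1) / N \<le> 1" by simp_all
  moreover have "0 \<le> real (fst z) / N" "0 \<le> real (snd z) / N" by simp_all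
  ultimately have "x \<in> unit_square" if "x \<in> cell_box N z" for x
  proof -
    have "real (fst z) / N \<le> fst x" "fst x < (real (fst z) + 1) / N" "real (snd z) / N \<le> snd x" "snd x < (real (snd z) + 1) / N"
      using that unfolding cell_box_def by auto
    then have "0 \<le> fst x" "fst x \<le> 1" "0 \<le> snd x" "snd x \<le> 1"
      using \<open>(real (fst z) + 1) / N \<le> 1\<close> \<open>(real (snd z) + 1) / N \<le> 1\<close>
        \<open>0 \<le> real (fst z) / N\<close> \<open>0 \<le> real (snd z) / N\<close> by linarith+
    then show ?thesis unfolding unit_square_def by (simp add: mem_Times_iff)
  qed
  then show ?thesis by blast
qed

lemma in_cell_box_iff:
  assumes "N > 0" "x \<in> unit_square"
  shows "x \<in> cell_box N z \<longleftrightarrow> cell N x = z"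
proof -
  have "0 \<le> fst x" "0 \<le> snd x" using assms(2) unfolding unit_square_def by auto
  then show ?thesis unfolding cell_box_def cell_def
    using nat_floor_eq_iff[OF _ assms(1), of "fst x" "fst z"] nat_floor_eq_iff[OF _ assms(1), of "snd x" "snd z"]
    by (auto simp: mem_Times_iff prod_eq_iff)
qed

lemma emeasure_cell_box: "N > 0 \<Longrightarrow> emeasure lborel (cell_box N z) = ennreal (1 / real (N * N))"
  unfolding cell_box_def
  by (subst emeasure_lborel_Times) (auto simp: diff_divide_distrib[symmetric] divide_right_mono simp flip: ennreal_mult')

lemma measure_cell:
  assumes N: "N > 0" and z: "z \<in> cells N"
  shows "measure sq (cell N -` {z}) = 1 / real (N * N)"
proof -
  have "emeasure sq (cell N -` {z}) = emeasure lborel (unit_square \<inter> cell N -` {z})"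
    by (rule emeasure_sq) measurable
  also have "unit_square \<inter> cell N -` {z} = cell_box N z"
  proof (rule set_eqI)
    show "x \<in> unit_square \<inter> cell N -` {z} \<longleftrightarrow> x \<in> cell_box N z" for x
      using in_cell_box_iff[OF N, of x z] cell_box_subset[OF z] by (cases "x \<in> unit_square") auto
  qed
  finally show ?thesis using N by (simp add: emeasure_cell_box measure_def del: of_nat_mult)
qed

lemma AE_cell:
  assumes N: "N > 0"
  shows "AE x in sq. cell N x \<in> cells N"
proof -
  have "measure sq (\<Union>z\<in>cells N. cell N -` {z}) = (\<Sum>z\<in>cells N. measure sq (cell N -` {z}))"
    by (rule sq.finite_measure_finite_Union) (auto simp: disjoint_family_on_def)
  also have "\<dots> = 1" using N by (simp add: measure_cell)
  finally have "AE x in sq. x \<in> (\<Union>z\<in>cells N. cell N -` {z})"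
    by (subst (asm) sq.prob_eq_1) (auto intro: sets.finite_UN)
  then show ?thesis by eventually_elim auto
qed

lemma sum_indicator_cells:
  fixes G :: "nat \<times> nat \<Rightarrow> real"
  assumes "cell N x \<in> cells N"
  shows "(\<Sum>z\<in>cells N. G z * indicator (cell N -` {z}) x) = G (cell N x)"
proof -
  have "(\<Sum>z\<in>cells N. G z * indicator (cell N -` {z}) x) = (\<Sum>z\<in>cells N. if z = cell N x then G z else 0)"
    by (intro sum.cong) (auto simp: indicator_def)
  then show ?thesis using assms by simp
qed

text \<open>The cells of independent uniform points are independent and uniformly distributed.\<close>

lemma hom_grid:
  fixes F :: "nat \<times> nat \<Rightarrow> nat \<times> nat \<Rightarrow> nat \<times> nat \<Rightarrow> real"
  assumes N: "N > 0" and I: "finite I" and P: "\<And>p. p \<in> P \<Longrightarrow> fst p \<in> I \<and> snd p \<in> I"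
  shows "sq.hom_integral I P (\<lambda>p x. F p (cell N (fst x)) (cell N (snd x))) =
    (\<Sum>y\<in>I \<rightarrow>\<^sub>E cells N. \<Prod>p\<in>P. F p (y (fst p)) (y (snd p))) / real (N * N) ^ card I"
proof -
  define G where "G y = (\<Prod>p\<in>P. F p (y (fst p)) (y (snd p)))" for y
  define J where "J y v = (\<Prod>i\<in>I. indicator (cell N -` {y i}) (v i) :: real)" for y and v :: "nat \<Rightarrow> point"
  have finX: "finite (I \<rightarrow>\<^sub>E cells N)" using I by (intro finite_PiE) auto
  have int1: "integrable sq (\<lambda>x. indicator (cell N -` {z}) x :: real)" for z
    by (intro integrable_real_indicator) (auto simp: sq.emeasure_eq_measure)
  have Jint: "integrable (Pi\<^sub>M I (\<lambda>_. sq)) (J y)" for y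
    unfolding J_def by (intro sq.product.product_integrable_prod I int1)
  have AE: "AE v in Pi\<^sub>M I (\<lambda>_. sq). \<forall>i\<in>I. cell N (v i) \<in> cells N"
  proof (rule AE_finite_allI[OF I])
    fix i assume "i \<in> I"
    then show "AE v in Pi\<^sub>M I (\<lambda>_. sq). cell N (v i) \<in> cells N"
      using AE_cell[OF N] by (intro AE_PiM_component) (auto intro: sq.prob_space_axioms)
  qed
  have "sq.hom_integral I P (\<lambda>p x. F p (cell N (fst x)) (cell N (snd x))) =
    (\<integral>v. (\<Sum>y\<in>I \<rightarrow>\<^sub>E cells N. G y * J y v) \<partial>Pi\<^sub>M I (\<lambda>_. sq))"
    unfolding sq.hom_integral_def
  proof (rule integral_cong_AE)
    have proj: "(\<lambda>v. (v a, v b)) \<in> Pi\<^sub>M I (\<lambda>_. sq) \<rightarrow>\<^sub>M sq2" if "a \<in> I" "b \<in> I" for a b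
      using that by measurable
    have Fm: "(\<lambda>x. F p (cell N (fst x)) (cell N (snd x))) \<in> borel_measurable sq2" for p
      unfolding borel_measurable_pair_sq_iff by (rule grid_kernel_measurable)
    show "(\<lambda>v. \<Prod>p\<in>P. F p (cell N (fst (v (fst p), v (snd p)))) (cell N (snd (v (fst p), v (snd p))))) \<in> borel_measurable (Pi\<^sub>M I (\<lambda>_. sq))"
      using P by (intro borel_measurable_prod measurable_compose[OF proj Fm]) auto
    show "(\<lambda>v. \<Sum>y\<in>I \<rightarrow>\<^sub>E cells N. G y * J y v) \<in> borel_measurable (Pi\<^sub>M I (\<lambda>_. sq))"
      using Jint by (intro borel_measurable_sum borel_measurable_times) auto
    show "AE v in Pi\<^sub>M I (\<lambda>_. sq). (\<Prod>p\<in>P. F p (cell N (fst (v (fst p), v (snd p)))) (cell N (snd (v (fst p), v (snd p))))) =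
      (\<Sum>y\<in>I \<rightarrow>\<^sub>E cells N. G y * J y v)"
      using AE
    proof eventually_elim
      case (elim v)
      define y0 where "y0 = (\<lambda>i\<in>I. cell N (v i))"
      have y0: "y0 \<in> I \<rightarrow>\<^sub>E cells N" using elim unfolding y0_def by auto
      have "J y v = (if y = y0 then 1 else 0)" if y: "y \<in> I \<rightarrow>\<^sub>E cells N" for y
      proof (cases "y = y0")
        case True
        then show ?thesis unfolding J_def y0_def by (auto intro!: prod.neutral)
      next
        case False
        then obtain i where "i \<in> I" "y i \<noteq> y0 i" using PiE_ext[OF y y0] by blast
        then have "J y v = 0" unfolding J_def y0_def using I by (intro prod_zero bexI[of _ i]) auto
        then show ?thesis using False by simp
      qed
      then have "(\<Sum>y\<in>I \<rightarrow>\<^sub>E cells N. G y * J y v) = (\<Sum>y\<in>I \<rightarrow>\<^sub>E cells N. if y = y0 then G y else 0)"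
        by (intro sum.cong) auto
      also have "\<dots> = G y0" using y0 finX by simp
      also have "\<dots> = (\<Prod>p\<in>P. F p (cell N (fst (v (fst p), v (snd p)))) (cell N (snd (v (fst p), v (snd p)))))"
        unfolding G_def y0_def using P by (intro prod.cong) auto
      finally show ?case ..
    qed
  qed
  also have "\<dots> = (\<Sum>y\<in>I \<rightarrow>\<^sub>E cells N. G y * (\<integral>v. J y v \<partial>Pi\<^sub>M I (\<lambda>_. sq)))"
    using Jint by (subst Bochner_Integration.integral_sum) auto
  also have "\<dots> = (\<Sum>y\<in>I \<rightarrow>\<^sub>E cells N. G y * (1 / real (N * N) ^ card I))"
  proof (intro sum.cong refl)
    fix y assume y: "y \<in> I \<rightarrow>\<^sub>E cells N"
    have "(\<integral>v. J y v \<partial>Pi\<^sub>M I (\<lambda>_. sq)) = (\<Prod>i\<in>I. \<integral>x. indicator (cell N -` {y i}) x \<partial>sq)"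
      unfolding J_def by (rule sq.product.product_integral_prod[OF I int1])
    also have "\<dots> = (\<Prod>i\<in>I. 1 / real (N * N))"
      by (intro prod.cong refl) (simp add: measure_cell[OF N PiE_mem[OF y]])
    finally show "G y * (\<integral>v. J y v \<partial>Pi\<^sub>M I (\<lambda>_. sq)) = G y * (1 / real (N * N) ^ card I)"
      by (simp add: power_one_over)
  qed
  finally show ?thesis unfolding G_def by (simp add: sum_divide_distrib)
qed

text \<open>The order of the columns in place of the order of the points, so that the kernel depends on the cells
  only.\<close>

definition grid_kernel :: "nat \<Rightarrow> nat set set \<Rightarrow> (nat \<times> nat \<Rightarrow> nat \<times> nat \<Rightarrow> real) \<Rightarrow> nat \<times> nat \<Rightarrow> point \<times> point \<Rightarrow> real" where
  "grid_kernel N E w p x = of_bool (fst (cell N (fst x)) < fst (cell N (snd x))) *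
     edge_factor E (\<lambda>x. w (cell N (fst x)) (cell N (snd x))) p x"

definition shifted_edges :: "nat \<Rightarrow> nat set set \<Rightarrow> (nat \<times> nat) set" where
  "shifted_edges k E = {(i, j) \<in> pairs k. {Suc i, Suc j} \<in> E}"

lemma hom_grid_kernel:
  assumes N: "N > 0"
  shows "fact k * sq.hom_integral {1..k} (vertex_pairs k) (grid_kernel N E w) = grid_density k N w (shifted_edges k E)"
proof -
  define F where "F p z z' = of_bool (fst z < fst z') * (if {fst p, snd p} \<in> E then w z z' else 1 - w z z')"
    for p z z' :: "nat \<times> nat"
  have "grid_kernel N E w = (\<lambda>p x. F p (cell N (fst x)) (cell N (snd x)))"
    unfolding grid_kernel_def edge_factor_def F_def by (intro ext) simp
  then have "sq.hom_integral {1..k} (vertex_pairs k) (grid_kernel N E w) =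
    (\<Sum>y\<in>{1..k} \<rightarrow>\<^sub>E cells N. \<Prod>p\<in>vertex_pairs k. F p (y (fst p)) (y (snd p))) / real (N * N) ^ card {1..k}"
    using vertex_pairsD by (simp only:) (intro hom_grid[OF N], auto)
  also have "(\<Sum>y\<in>{1..k} \<rightarrow>\<^sub>E cells N. \<Prod>p\<in>vertex_pairs k. F p (y (fst p)) (y (snd p))) =
    (\<Sum>x\<in>{..<k} \<rightarrow>\<^sub>E cells N. \<Prod>e\<in>pairs k. F (Suc (fst e), Suc (snd e)) (x (fst e)) (x (snd e)))"
  proof (rule sum.reindex_bij_witness[where i = "\<lambda>x. \<lambda>i\<in>{1..k}. x (i - 1)" and j = "\<lambda>y. \<lambda>i\<in>{..<k}. y (Suc i)"])
    fix y assume y: "y \<in> {1..k} \<rightarrow>\<^sub>E cells N"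
    show "(\<lambda>i\<in>{1..k}. (\<lambda>i\<in>{..<k}. y (Suc i)) (i - 1)) = y"
      using y by (intro ext) (auto simp: PiE_iff extensional_def restrict_def)
    show "(\<lambda>i\<in>{..<k}. y (Suc i)) \<in> {..<k} \<rightarrow>\<^sub>E cells N" using y by (auto simp: PiE_iff)
    show "(\<Prod>e\<in>pairs k. F (Suc (fst e), Suc (snd e)) ((\<lambda>i\<in>{..<k}. y (Suc i)) (fst e)) ((\<lambda>i\<in>{..<k}. y (Suc i)) (snd e))) =
      (\<Prod>p\<in>vertex_pairs k. F p (y (fst p)) (y (snd p)))"
      by (rule prod.reindex_bij_witness[where i = "\<lambda>p. (fst p - 1, snd p - 1)" and j = "\<lambda>e. (Suc (fst e), Suc (snd e))"])
        (auto simp: pairs_def vertex_pairs_def)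
  next
    fix x assume x: "x \<in> {..<k} \<rightarrow>\<^sub>E cells N"
    show "(\<lambda>i\<in>{..<k}. (\<lambda>i\<in>{1..k}. x (i - 1)) (Suc i)) = x"
      using x by (intro ext) (auto simp: PiE_iff extensional_def restrict_def)
    show "(\<lambda>i\<in>{1..k}. x (i - 1)) \<in> {1..k} \<rightarrow>\<^sub>E cells N" using x by (auto simp: PiE_iff)
  qed
  also have "\<dots> = (\<Sum>x\<in>{..<k} \<rightarrow>\<^sub>E cells N. if x \<in> increasing_samples k N then graph_prob k w x (shifted_edges k E) else 0)"
  proof (intro sum.cong refl)
    fix x assume x: "x \<in> {..<k} \<rightarrow>\<^sub>E cells N"
    have "(\<Prod>e\<in>pairs k. F (Suc (fst e), Suc (snd e)) (x (fst e)) (x (snd e))) =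
      (\<Prod>e\<in>pairs k. of_bool (fst (x (fst e)) < fst (x (snd e)))) * graph_prob k w x (shifted_edges k E)"
      unfolding graph_prob_def F_def prod.distrib[symmetric]
      by (intro prod.cong refl) (auto simp: shifted_edges_def)
    also have "(\<Prod>e\<in>pairs k. of_bool (fst (x (fst e)) < fst (x (snd e)))) = (if x \<in> increasing_samples k N then 1 else 0 :: real)"
    proof (cases "x \<in> increasing_samples k N")
      case True
      then show ?thesis by (auto simp: increasing_samples_def pairs_def intro!: prod.neutral)
    next
      case False
      then obtain i j where "i < j" "j < k" "\<not> fst (x i) < fst (x j)" using x unfolding increasing_samples_def by blast
      then have "(\<Prod>e\<in>pairs k. of_bool (fst (x (fst e)) < fst (x (snd e)))) = (0 :: real)"
        by (intro prod_zero finite_pairs bexI[of _ "(i, j)"]) (auto simp: pairs_def)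
      then show ?thesis using False by simp
    qed
    finally show "(\<Prod>e\<in>pairs k. F (Suc (fst e), Suc (snd e)) (x (fst e)) (x (snd e))) =
      (if x \<in> increasing_samples k N then graph_prob k w x (shifted_edges k E) else 0)" by simp
  qed
  also have "\<dots> = (\<Sum>x\<in>increasing_samples k N. graph_prob k w x (shifted_edges k E))"
  proof -
    have "finite ({..<k} \<rightarrow>\<^sub>E cells N)" by (intro finite_PiE) auto
    moreover have "increasing_samples k N \<subseteq> {..<k} \<rightarrow>\<^sub>E cells N" unfolding increasing_samples_def by auto
    ultimately show ?thesis by (simp add: sum.inter_restrict[symmetric] Int_absorb1)
  qed
  finally show ?thesis unfolding grid_density_def by simp
qed

text \<open>The order of two points and the order of their columns differ only if both lie in the same column, that
  is, on a set of measure of the order of \<open>1 / N\<close>.\<close>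

lemma graph_density_approx_grid:
  assumes W'[measurable]: "W' \<in> borel_measurable borel" and W'1: "\<And>p. 0 \<le> W' p \<and> W' p \<le> 1"
    and WW': "AE p in sq2. W p = W' p"
    and w: "\<And>z z'. 0 \<le> w z z' \<and> w z z' \<le> 1" and N: "N > 0"
    and close: "(\<integral>x. \<bar>W' x - w (cell N (fst x)) (cell N (snd x))\<bar> \<partial>sq2) \<le> \<eta>"
  shows "\<bar>graph_density (k, E) W - grid_density k N w (shifted_edges k E)\<bar> \<le>
    fact k * (real (card (vertex_pairs k)) * (\<eta> + 2 / N))"
proof -
  define w' where "w' x = w (cell N (fst x)) (cell N (snd x))" for x
  have w'm[measurable]: "w' \<in> borel_measurable borel" unfolding w'_def[abs_def] by (rule grid_kernel_measurable)
  have w'1: "0 \<le> w' x \<and> w' x \<le> 1" for x unfolding w'_def by (rule w)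
  define b where "b x = (of_bool (fst (cell N (fst x)) < fst (cell N (snd x))) :: real)" for x
  have bm[measurable]: "b \<in> borel_measurable borel"
    unfolding b_def[abs_def] by (rule grid_kernel_measurable[of "\<lambda>z z'. of_bool (fst z < fst z')"])
  have b1: "0 \<le> b x \<and> b x \<le> 1" for x unfolding b_def by auto
  have gk: "grid_kernel N E w p x = b x * edge_factor E w' p x" for p x
    unfolding grid_kernel_def b_def w'_def[abs_def] ..
  have efm: "edge_factor E w' p \<in> borel_measurable borel" for p
    unfolding edge_factor_def[abs_def] by (cases "{fst p, snd p} \<in> E") simp_all
  have ef1: "0 \<le> edge_factor E w' p x \<and> edge_factor E w' p x \<le> 1" for p x
    by (rule edge_factor_bounds[OF w'1])
  define D where "D x = order_kernel x * (W' x - w' x)" for x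
  have d1: "\<bar>W' x - w' x\<bar> \<le> 1" for x using W'1[of x] w'1[of x] by linarith
  have D1: "\<bar>D x\<bar> \<le> \<bar>W' x - w' x\<bar>" for x unfolding D_def using order_kernel_bounds[of x]
    by (auto simp: abs_mult intro!: mult_left_le_one_le)
  have intd: "integrable sq2 (\<lambda>x. W' x - w' x)" using d1 by (intro integrable_pair_bounded) auto
  have intD: "integrable sq2 D"
  proof (rule integrable_pair_bounded)
    show "D \<in> borel_measurable borel" unfolding D_def[abs_def] by measurable
  qed (rule order_trans[OF D1 d1])
  have "(\<integral>x. \<bar>D x\<bar> \<partial>sq2) \<le> (\<integral>x. \<bar>W' x - w' x\<bar> \<partial>sq2)"
    using intD intd D1 by (intro integral_mono integrable_abs)
  then have cutD: "sq.kcut D \<eta>" using close intD unfolding w'_def by (intro sq.kcut_L1) auto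
  have cut: "sq.kcut (\<lambda>x. density_kernel E W' p x - grid_kernel N E w p x) (\<eta> + 2 / N)" for p
  proof -
    define G where "G x = (order_kernel x - b x) * edge_factor E w' p x" for x
    have Gm: "G \<in> borel_measurable borel" unfolding G_def[abs_def] using efm by measurable
    have G1: "\<bar>G x\<bar> \<le> 1" for x
      unfolding G_def using ef1[of p x] order_kernel_bounds[of x] b1[of x]
      by (auto simp: abs_mult intro!: mult_le_one)
    have "sq.kcut G (2 * (1 / N))"
    proof (rule kcut_close_columns[OF Gm G1])
      have "AE x in sq2. x \<in> unit_square \<times> unit_square" unfolding AE_pair_iff by simp
      then show "AE x in sq2. G x = 0 \<or> \<bar>fst (fst x) - fst (snd x)\<bar> \<le> 1 / N"
      proof eventually_elim
        case (elim x)
        define s t where "s = fst (fst x)" and "t = fst (snd x)"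
        have st: "0 \<le> s" "0 \<le> t" using elim unfolding s_def t_def unit_square_def by auto
        have fl: "0 \<le> \<lfloor>real N * s\<rfloor>" "0 \<le> \<lfloor>real N * t\<rfloor>" using st by auto
        have bx: "b x = of_bool (\<lfloor>real N * s\<rfloor> < \<lfloor>real N * t\<rfloor>)"
        proof -
          have "nat a < nat c \<longleftrightarrow> a < c" if "0 \<le> a" "0 \<le> c" for a c :: int using that by linarith
          from this[OF fl] show ?thesis unfolding b_def cell_def s_def t_def by simp
        qed
        have ox: "order_kernel x = of_bool (s \<le> t)" unfolding order_kernel_def s_def t_def by (simp add: indicator_def)
        show ?case
        proof (cases "\<lfloor>real N * s\<rfloor> = \<lfloor>real N * t\<rfloor>")
          case True
          then have "\<bar>real N * s - real N * t\<bar> \<le> 1" by linarith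
          then have "real N * \<bar>s - t\<bar> \<le> 1" by (simp add: abs_mult flip: right_diff_distrib)
          then show ?thesis using N unfolding s_def t_def by (simp add: field_simps)
        next
          case False
          have "s \<le> t \<longleftrightarrow> \<lfloor>real N * s\<rfloor> < \<lfloor>real N * t\<rfloor>"
          proof
            assume "s \<le> t"
            then have "real N * s \<le> real N * t" by (intro mult_left_mono) auto
            then have "\<lfloor>real N * s\<rfloor> \<le> \<lfloor>real N * t\<rfloor>" by (rule floor_mono)
            then show "\<lfloor>real N * s\<rfloor> < \<lfloor>real N * t\<rfloor>" using False by simp
          next
            assume "\<lfloor>real N * s\<rfloor> < \<lfloor>real N * t\<rfloor>"
            then have "real N * s < real N * t" by linarith
            then show "s \<le> t" using N by simp
          qed
          then show ?thesis unfolding G_def bx ox by simp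
        qed
      qed
    qed simp
    then have G: "sq.kcut G (2 / N)" by simp
    have intG: "integrable sq2 G" by (intro integrable_pair_bounded Gm G1)
    show ?thesis
    proof (cases "{fst p, snd p} \<in> E")
      case True
      have "(\<lambda>x. density_kernel E W' p x - grid_kernel N E w p x) = (\<lambda>x. D x + G x)"
        unfolding density_kernel_def gk G_def D_def edge_factor_def using True by (auto simp: algebra_simps)
      then show ?thesis using sq.kcut_add[OF cutD G intD intG] by simp
    next
      case False
      have "(\<lambda>x. density_kernel E W' p x - grid_kernel N E w p x) = (\<lambda>x. - D x + G x)"
        unfolding density_kernel_def gk G_def D_def edge_factor_def using False by (auto simp: algebra_simps)
      then show ?thesis using sq.kcut_add[OF sq.kcut_uminus[OF cutD] G _ intG] intD by simp
    qed
  qed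
  have gkm: "grid_kernel N E w p \<in> borel_measurable borel" for p
    using bm efm[of p] unfolding gk[abs_def] by (intro borel_measurable_times)
  have gk1: "0 \<le> grid_kernel N E w p x \<and> grid_kernel N E w p x \<le> 1" for p x
    unfolding gk using b1[of x] ef1[of p x] by (simp add: mult_le_one)
  have "\<bar>sq.hom_integral {1..k} (vertex_pairs k) (density_kernel E W') - sq.hom_integral {1..k} (vertex_pairs k) (grid_kernel N E w)\<bar> \<le>
    real (card (vertex_pairs k)) * (\<eta> + 2 / N)"
    using density_kernel_measurable[OF W'] density_kernel_bounds[where W = W', OF W'1] gkm gk1 cut
    by (intro hom_diff_le)
  then show ?thesis
    unfolding graph_density_eq_hom[OF W' WW'] hom_grid_kernel[OF N, symmetric]
      right_diff_distrib[symmetric] abs_mult by simp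
qed

section \<open>Approximation by grid kernels\<close>

lemma AE_swap:
  assumes "AE p in sq2. P p"
  shows "AE p in sq2. P (snd p, fst p)"
proof -
  have "AE p in distr sq2 sq2 (\<lambda>(x, y). (y, x)). P p"
    using assms by (subst sq.pair.distr_pair_swap[symmetric])
  from AE_distrD[OF measurable_pair_swap' this] show ?thesis by (simp add: case_prod_unfold)
qed

lemma ex_continuous_approximation:
  assumes W'[measurable]: "W' \<in> borel_measurable borel" and W'1: "\<And>p. 0 \<le> W' p \<and> W' p \<le> 1" and e: "\<eta> > 0"
  obtains h :: "point \<times> point \<Rightarrow> real" where "continuous_on UNIV h" "\<And>p. 0 \<le> h p \<and> h p \<le> 1"
    "(\<integral>p. \<bar>W' p - h p\<bar> \<partial>sq2) < \<eta>"
proof -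
  have "W' \<in> borel_measurable lebesgue" using W' by (intro measurable_completion) simp
  then have "W' measurable_on UNIV" by (intro lebesgue_measurable_imp_measurable_on) auto
  then obtain N g where N: "negligible N" and g: "\<And>n. continuous_on UNIV (g n)"
    and lim: "\<And>x. x \<notin> N \<Longrightarrow> (\<lambda>n. g n x) \<longlonglongrightarrow> W' x"
    unfolding measurable_on_def by auto
  define h where "h n x = max 0 (min 1 (g n x))" for n x
  have hc: "continuous_on UNIV (h n)" for n
    unfolding h_def[abs_def] by (intro continuous_intros g)
  have h1: "0 \<le> h n x \<and> h n x \<le> 1" for n x unfolding h_def by auto
  have hm[measurable]: "h n \<in> borel_measurable borel" for n by (rule borel_measurable_continuous_onI[OF hc])
  have "N \<in> null_sets (completion lborel)" using N by (simp add: negligible_iff_null_sets)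
  then obtain N' where N': "N' \<in> null_sets lborel" "N \<subseteq> N'" unfolding null_sets_completion_iff2 by blast
  have "AE x in lborel. x \<notin> N'" by (rule AE_not_in[OF N'(1)])
  then have AE: "AE x in sq2. x \<notin> N" unfolding AE_pair_iff by eventually_elim (use N'(2) in auto)
  have "(\<lambda>n. \<integral>p. \<bar>W' p - h n p\<bar> \<partial>sq2) \<longlonglongrightarrow> (\<integral>p. 0 \<partial>sq2)"
  proof (rule integral_dominated_convergence[where w = "\<lambda>_. 1"])
    show "(\<lambda>p. \<bar>W' p - h n p\<bar>) \<in> borel_measurable sq2" for n
      unfolding borel_measurable_pair_sq_iff by measurable
    show "AE p in sq2. (\<lambda>n. \<bar>W' p - h n p\<bar>) \<longlonglongrightarrow> 0"
      using AE
    proof eventually_elim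
      case (elim p)
      have "(\<lambda>n. h n p) \<longlonglongrightarrow> max 0 (min 1 (W' p))"
        unfolding h_def by (intro tendsto_max tendsto_min tendsto_const lim elim)
      also have "max 0 (min 1 (W' p)) = W' p" using W'1[of p] by auto
      finally have "(\<lambda>n. \<bar>W' p - h n p\<bar>) \<longlonglongrightarrow> \<bar>W' p - W' p\<bar>" by (intro tendsto_intros)
      then show ?case by simp
    qed
    show "AE p in sq2. norm \<bar>W' p - h n p\<bar> \<le> 1" for n
    proof (rule AE_I2)
      show "norm \<bar>W' p - h n p\<bar> \<le> 1" for p using W'1[of p] h1[of n p] by (simp add: abs_le_iff)
    qed
  qed auto
  then have "(\<lambda>n. \<integral>p. \<bar>W' p - h n p\<bar> \<partial>sq2) \<longlonglongrightarrow> 0" by simp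
  then have "\<forall>\<^sub>F n in sequentially. (\<integral>p. \<bar>W' p - h n p\<bar> \<partial>sq2) < \<eta>"
    using e by (rule order_tendstoD(2))
  then obtain n where "(\<integral>p. \<bar>W' p - h n p\<bar> \<partial>sq2) < \<eta>"
    unfolding eventually_sequentially by blast
  then show thesis using hc h1 by (intro that[of "h n"]) auto
qed

definition corner :: "nat \<Rightarrow> nat \<times> nat \<Rightarrow> point" where
  "corner N z = (real (fst z) / N, real (snd z) / N)"

lemma dist_prod_le: "dist p q \<le> dist (fst p) (fst q) + dist (snd p) (snd q)"
  unfolding dist_prod_def by (rule sqrt_sum_squares_le_sum) auto

lemma corner_cell:
  assumes N: "N > 0" and u: "u \<in> unit_square"
  shows "corner N (cell N u) \<in> unit_square" "dist (corner N (cell N u)) u \<le> 2 / N"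
proof -
  have co: "0 \<le> real (nat \<lfloor>real N * t\<rfloor>) / N \<and> real (nat \<lfloor>real N * t\<rfloor>) / N \<le> t \<and> dist (real (nat \<lfloor>real N * t\<rfloor>) / N) t \<le> 1 / N"
    if t: "0 \<le> t" for t
  proof -
    have "real (nat \<lfloor>real N * t\<rfloor>) / N \<le> t" "t < (real (nat \<lfloor>real N * t\<rfloor>) + 1) / N"
      using nat_floor_eq_iff[OF t N, of "nat \<lfloor>real N * t\<rfloor>"] by auto
    then show ?thesis by (simp add: dist_real_def add_divide_distrib)
  qed
  have u': "0 \<le> fst u" "fst u \<le> 1" "0 \<le> snd u" "snd u \<le> 1" using u unfolding unit_square_def by auto
  show "corner N (cell N u) \<in> unit_square"
    unfolding corner_def cell_def unit_square_def using co[OF u'(1)] co[OF u'(3)] u' by auto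
  have "dist (corner N (cell N u)) u \<le> 1 / N + 1 / N"
    unfolding corner_def cell_def using co[OF u'(1)] co[OF u'(3)]
    by (intro order_trans[OF dist_prod_le] add_mono) auto
  then show "dist (corner N (cell N u)) u \<le> 2 / N" by simp
qed

text \<open>Sample a continuous approximation at the corners of the cells; the average over the two orders
  of the arguments restores the symmetry.\<close>

lemma ex_grid_approximation:
  assumes W: "orderon W" and W'[measurable]: "W' \<in> borel_measurable borel" and W'1: "\<And>p. 0 \<le> W' p \<and> W' p \<le> 1"
    and WW': "AE p in sq2. W p = W' p" and e: "\<eta> > 0"
  obtains N0 where "\<And>N. N \<ge> N0 \<Longrightarrow> \<exists>w. (\<forall>z z'. w z z' = w z' z \<and> 0 \<le> w z z' \<and> w z z' \<le> 1) \<and>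
    (\<integral>x. \<bar>W' x - w (cell N (fst x)) (cell N (snd x))\<bar> \<partial>sq2) \<le> \<eta>"
proof -
  obtain h where h: "continuous_on UNIV h" and h1: "\<And>p. 0 \<le> h p \<and> h p \<le> 1"
    and hW: "(\<integral>p. \<bar>W' p - h p\<bar> \<partial>sq2) < \<eta> / 2"
    using ex_continuous_approximation[OF W' W'1, of "\<eta> / 2"] e by auto
  have [measurable]: "h \<in> borel_measurable borel" by (rule borel_measurable_continuous_onI[OF h])
  have "uniformly_continuous_on (unit_square \<times> unit_square) h"
    using h by (intro compact_uniformly_continuous compact_Times)
      (auto intro: continuous_on_subset simp: unit_square_eq_cbox)
  then obtain d where d: "d > 0" and
    uc: "\<And>x x'. x \<in> unit_square \<times> unit_square \<Longrightarrow> x' \<in> unit_square \<times> unit_square \<Longrightarrow> dist x' x < d \<Longrightarrow> dist (h x') (h x) < \<eta> / 2"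
    unfolding uniformly_continuous_on_def using e by (metis half_gt_zero)
  obtain N0 :: nat where N0: "4 / d < N0" using reals_Archimedean2 by blast
  have N00: "N0 > 0" using N0 d by (cases "N0 = 0") (auto simp: divide_less_0_iff)
  show thesis
  proof (rule that[of N0])
    fix N assume NN0: "N \<ge> N0"
    then have N: "N > 0" using N00 by simp
    have "4 / d < N" using N0 NN0 by linarith
    then have Nd: "4 / N < d" using d N by (simp add: field_simps)
    define c where "c = (\<lambda>u. corner N (cell N u))"
    define w where "w z z' = (h (corner N z, corner N z') + h (corner N z', corner N z)) / 2" for z z'
    have near: "\<bar>h (u, v) - h (c u, c v)\<bar> < \<eta> / 2" if "u \<in> unit_square" "v \<in> unit_square" for u v
    proof -
      have "dist (c u, c v) (u, v) \<le> dist (c u) u + dist (c v) v" using dist_prod_le[of "(c u, c v)" "(u, v)"] by simp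
      also have "\<dots> \<le> 2 / N + 2 / N" unfolding c_def using corner_cell(2)[OF N] that by (intro add_mono) auto
      also have "\<dots> < d" using Nd by simp
      finally have "dist (h (c u, c v)) (h (u, v)) < \<eta> / 2"
        using corner_cell(1)[OF N] that unfolding c_def by (intro uc) auto
      then show ?thesis by (simp add: dist_real_def abs_minus_commute)
    qed
    define w' where "w' x = w (cell N (fst x)) (cell N (snd x))" for x
    have w1: "0 \<le> w z z' \<and> w z z' \<le> 1" for z z'
      unfolding w_def using h1[of "(corner N z, corner N z')"] h1[of "(corner N z', corner N z)"] by simp
    have [measurable]: "w' \<in> borel_measurable borel" unfolding w'_def[abs_def] by (rule grid_kernel_measurable)
    define S where "S x = (snd x, fst x)" for x :: "point \<times> point"
    have S[measurable]: "S \<in> borel_measurable borel" unfolding S_def[abs_def] by (intro borel_measurable_Pair) measurable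
    have Q: "AE x in sq2. x \<in> unit_square \<times> unit_square" unfolding AE_pair_iff by simp
    have bound: "AE x in sq2. \<bar>W' x - w' x\<bar> \<le> \<bar>W' x - h x\<bar> / 2 + \<bar>W' (S x) - h (S x)\<bar> / 2 + \<eta> / 2"
      using Q WW' AE_swap[OF WW']
    proof eventually_elim
      case (elim x)
      obtain u v where x: "x = (u, v)" by (cases x)
      have uv: "u \<in> unit_square" "v \<in> unit_square" using elim unfolding x by auto
      have "W (u, v) = W (v, u)" using W uv unfolding orderon_def by blast
      then have sym: "W' (S x) = W' x" using elim unfolding x S_def by simp
      have w'x: "w' x = (h (c u, c v) + h (c v, c u)) / 2" unfolding w'_def w_def x c_def by simp
      have hS: "h (S x) = h (v, u)" "h x = h (u, v)" unfolding S_def x by auto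
      have key: "\<bar>a - (r + t) / 2\<bar> \<le> \<bar>a - p\<bar> / 2 + \<bar>a - q\<bar> / 2 + \<eta> / 2"
        if "\<bar>p - r\<bar> < \<eta> / 2" "\<bar>q - t\<bar> < \<eta> / 2" for a p q r t :: real
      proof -
        have "\<bar>a - r\<bar> \<le> \<bar>a - p\<bar> + \<eta> / 2" "\<bar>a - t\<bar> \<le> \<bar>a - q\<bar> + \<eta> / 2" using that by linarith+
        moreover have "\<bar>a - (r + t) / 2\<bar> \<le> \<bar>a - r\<bar> / 2 + \<bar>a - t\<bar> / 2" by (simp add: abs_if field_simps)
        ultimately show ?thesis by linarith
      qed
      show ?case unfolding sym w'x hS by (rule key[OF near[OF uv] near[OF uv(2) uv(1)]])
    qed
    have i1: "integrable sq2 (\<lambda>x. \<bar>W' x - h x\<bar>)"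
    proof (rule integrable_pair_bounded)
      show "\<bar>\<bar>W' x - h x\<bar>\<bar> \<le> 1" for x using W'1[of x] h1[of x] by (simp add: abs_le_iff)
    qed measurable
    have i2: "integrable sq2 (\<lambda>x. \<bar>W' (S x) - h (S x)\<bar>)"
    proof (rule integrable_pair_bounded)
      show "\<bar>\<bar>W' (S x) - h (S x)\<bar>\<bar> \<le> 1" for x using W'1[of "S x"] h1[of "S x"] by (simp add: abs_le_iff)
    qed measurable
    have i3: "integrable sq2 (\<lambda>x. \<bar>W' x - w' x\<bar>)"
    proof (rule integrable_pair_bounded)
      show "\<bar>\<bar>W' x - w' x\<bar>\<bar> \<le> 1" for x
        using W'1[of x] w1[of "cell N (fst x)" "cell N (snd x)"] unfolding w'_def by (simp add: abs_le_iff)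
    qed measurable
    have "(\<integral>(x, y). \<bar>W' (y, x) - h (y, x)\<bar> \<partial>sq2) = (\<integral>x. \<bar>W' x - h x\<bar> \<partial>sq2)"
      by (rule sq.pair.integral_product_swap) (unfold borel_measurable_pair_sq_iff, measurable)
    then have swap: "(\<integral>x. \<bar>W' (S x) - h (S x)\<bar> \<partial>sq2) = (\<integral>x. \<bar>W' x - h x\<bar> \<partial>sq2)"
      unfolding S_def by (simp add: case_prod_unfold)
    have "(\<integral>x. \<bar>W' x - w' x\<bar> \<partial>sq2) \<le>
      (\<integral>x. \<bar>W' x - h x\<bar> / 2 + \<bar>W' (S x) - h (S x)\<bar> / 2 + \<eta> / 2 \<partial>sq2)"
      using i1 i2 i3 bound by (intro integral_mono_AE) auto
    also have "\<dots> = (\<integral>x. \<bar>W' x - h x\<bar> \<partial>sq2) + \<eta> / 2"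
      using i1 i2 swap sq.pair.prob_space by simp
    also have "\<dots> \<le> \<eta>" using hW by simp
    finally have "(\<integral>x. \<bar>W' x - w (cell N (fst x)) (cell N (snd x))\<bar> \<partial>sq2) \<le> \<eta>" unfolding w'_def .
    moreover have "w z z' = w z' z" for z z' unfolding w_def by simp
    ultimately show "\<exists>w. (\<forall>z z'. w z z' = w z' z \<and> 0 \<le> w z z' \<and> w z z' \<le> 1) \<and>
      (\<integral>x. \<bar>W' x - w (cell N (fst x)) (cell N (snd x))\<bar> \<partial>sq2) \<le> \<eta>"
      using w1 by blast
  qed
qed

section \<open>Permutations of the grid as bijections of the square\<close>

lemma cell_box_shift:
  assumes "x \<in> cell_box N z"
  shows "x + (corner N z' - corner N z) \<in> cell_box N z'"
  using assms unfolding cell_box_def corner_def by (auto simp: mem_Times_iff add_divide_distrib)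

text \<open>Half-open cells are permuted by translations. The points of the closed square outside of all of
  them, on its upper and right edges, stay where they are.\<close>

definition grid_map :: "nat \<Rightarrow> (nat \<times> nat \<Rightarrow> nat \<times> nat) \<Rightarrow> point \<Rightarrow> point" where
  "grid_map N \<sigma> x = (if cell N x \<in> cells N then x + (corner N (\<sigma> (cell N x)) - corner N (cell N x)) else x)"

context
  fixes N :: nat and \<sigma> :: "nat \<times> nat \<Rightarrow> nat \<times> nat"
  assumes N: "N > 0" and \<sigma>: "bij_betw \<sigma> (cells N) (cells N)"
begin

lemma permuted_cell_in: "z \<in> cells N \<Longrightarrow> \<sigma> z \<in> cells N"
  using \<sigma> by (auto simp: bij_betw_def)

lemma grid_map_box:
  assumes x: "x \<in> unit_square" and z: "cell N x \<in> cells N"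
  shows "grid_map N \<sigma> x \<in> unit_square" "cell N (grid_map N \<sigma> x) = \<sigma> (cell N x)"
proof -
  have "x \<in> cell_box N (cell N x)" using in_cell_box_iff[OF N x] by simp
  from cell_box_shift[OF this, of "\<sigma> (cell N x)"]
  have b: "grid_map N \<sigma> x \<in> cell_box N (\<sigma> (cell N x))" unfolding grid_map_def using z by simp
  then show Q: "grid_map N \<sigma> x \<in> unit_square" using cell_box_subset[OF permuted_cell_in[OF z]] by blast
  show "cell N (grid_map N \<sigma> x) = \<sigma> (cell N x)" using b in_cell_box_iff[OF N Q] by simp
qed

lemma grid_map_unit_square: "x \<in> unit_square \<Longrightarrow> grid_map N \<sigma> x \<in> unit_square"
  using grid_map_box(1) by (cases "cell N x \<in> cells N") (auto simp: grid_map_def)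

lemma emeasure_split_cells:
  assumes X: "X \<in> sets lebesgue" "X \<subseteq> unit_square"
  shows "emeasure lebesgue X = emeasure lebesgue (X - (\<Union>z\<in>cells N. cell_box N z)) +
    (\<Sum>z\<in>cells N. emeasure lebesgue (X \<inter> cell_box N z))"
proof -
  have box: "cell_box N z \<in> sets lebesgue" for z by auto
  have UN: "(\<Union>z\<in>cells N. cell_box N z) \<in> sets lebesgue" by (intro sets.finite_UN) auto
  have disj: "disjoint_family_on (\<lambda>z. X \<inter> cell_box N z) (cells N)"
    unfolding disjoint_family_on_def
  proof (intro ballI impI, rule ccontr)
    fix z z' assume zz: "z \<in> cells N" "z' \<in> cells N" "z \<noteq> z'" "(X \<inter> cell_box N z) \<inter> (X \<inter> cell_box N z') \<noteq> {}"
    then obtain x where x: "x \<in> X" "x \<in> cell_box N z" "x \<in> cell_box N z'" by blast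
    then have "cell N x = z" "cell N x = z'" using X(2) in_cell_box_iff[OF N, of x] by blast+
    then show False using zz(3) by simp
  qed
  have "X = (X - (\<Union>z\<in>cells N. cell_box N z)) \<union> (\<Union>z\<in>cells N. X \<inter> cell_box N z)" by blast
  then have "emeasure lebesgue X = emeasure lebesgue (X - (\<Union>z\<in>cells N. cell_box N z)) + emeasure lebesgue (\<Union>z\<in>cells N. X \<inter> cell_box N z)"
    using X(1) box UN by (subst plus_emeasure) (auto intro!: sets.finite_UN sets.Diff)
  also have "emeasure lebesgue (\<Union>z\<in>cells N. X \<inter> cell_box N z) = (\<Sum>z\<in>cells N. emeasure lebesgue (X \<inter> cell_box N z))"
    using X(1) box disj by (intro sum_emeasure[symmetric]) auto
  finally show ?thesis .
qed

lemma vimage_grid_map_box: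
  assumes z: "z \<in> cells N" and A: "A \<subseteq> unit_square"
  shows "(grid_map N \<sigma> -` A \<inter> unit_square) \<inter> cell_box N z = (\<lambda>x. (corner N z - corner N (\<sigma> z)) + x) ` (A \<inter> cell_box N (\<sigma> z))"
proof (intro set_eqI iffI)
  fix x assume "x \<in> (grid_map N \<sigma> -` A \<inter> unit_square) \<inter> cell_box N z"
  then have x: "grid_map N \<sigma> x \<in> A" "x \<in> unit_square" "x \<in> cell_box N z" by auto
  then have cx: "cell N x = z" using in_cell_box_iff[OF N] by blast
  have y: "grid_map N \<sigma> x = x + (corner N (\<sigma> z) - corner N z)" using cx z unfolding grid_map_def by simp
  have "grid_map N \<sigma> x \<in> cell_box N (\<sigma> z)" unfolding y by (rule cell_box_shift[OF x(3)])
  then show "x \<in> (\<lambda>x. (corner N z - corner N (\<sigma> z)) + x) ` (A \<inter> cell_box N (\<sigma> z))"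
    using x(1) by (intro image_eqI[of _ _ "grid_map N \<sigma> x"]) (auto simp: y)
next
  fix x assume "x \<in> (\<lambda>x. (corner N z - corner N (\<sigma> z)) + x) ` (A \<inter> cell_box N (\<sigma> z))"
  then obtain y where y: "y \<in> A" "y \<in> cell_box N (\<sigma> z)" and xy: "x = (corner N z - corner N (\<sigma> z)) + y" by blast
  have xb: "x \<in> cell_box N z" unfolding xy using cell_box_shift[OF y(2), of z] by (simp add: algebra_simps)
  then have xQ: "x \<in> unit_square" using cell_box_subset[OF z] by blast
  then have "cell N x = z" using in_cell_box_iff[OF N] xb by blast
  then have "grid_map N \<sigma> x = y" using z unfolding grid_map_def xy by simp
  then show "x \<in> (grid_map N \<sigma> -` A \<inter> unit_square) \<inter> cell_box N z" using y(1) xQ xb by auto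
qed

lemma vimage_grid_map_rest:
  "(grid_map N \<sigma> -` A \<inter> unit_square) - (\<Union>z\<in>cells N. cell_box N z) = (A \<inter> unit_square) - (\<Union>z\<in>cells N. cell_box N z)"
proof -
  have "grid_map N \<sigma> x = x" if "x \<in> unit_square" "x \<notin> (\<Union>z\<in>cells N. cell_box N z)" for x
    using that in_cell_box_iff[OF N that(1)] unfolding grid_map_def by auto
  then show ?thesis by auto
qed

lemma measure_preserving_grid_map:
  "measure_preserving (lebesgue_on unit_square) (lebesgue_on unit_square) (grid_map N \<sigma>)"
proof -
  let ?g = "grid_map N \<sigma>" and ?U = "\<Union>z\<in>cells N. cell_box N z"
  have UN: "?U \<in> sets lebesgue" by (intro sets.finite_UN) auto
  have Q: "unit_square \<inter> space lebesgue \<in> sets lebesgue" by simp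
  have key: "?g -` A \<inter> unit_square \<in> sets lebesgue \<and> emeasure lebesgue (?g -` A \<inter> unit_square) = emeasure lebesgue A"
    if A: "A \<in> sets lebesgue" "A \<subseteq> unit_square" for A
  proof -
    let ?X = "?g -` A \<inter> unit_square"
    have box: "A \<inter> cell_box N z \<in> sets lebesgue" for z using A(1) by auto
    have Xz: "?X \<inter> cell_box N z \<in> sets lebesgue" if "z \<in> cells N" for z
      unfolding vimage_grid_map_box[OF that A(2)] by (rule lebesgue_sets_translation[OF box])
    have rest: "?X - ?U = A - ?U" using vimage_grid_map_rest[of A] A(2) by auto
    have "?X = (?X - ?U) \<union> (\<Union>z\<in>cells N. ?X \<inter> cell_box N z)" by blast
    also have "\<dots> \<in> sets lebesgue"
      unfolding rest using A(1) UN Xz by (intro sets.Un sets.Diff sets.finite_UN) auto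
    finally have Xm: "?X \<in> sets lebesgue" .
    have "emeasure lebesgue ?X = emeasure lebesgue (?X - ?U) + (\<Sum>z\<in>cells N. emeasure lebesgue (?X \<inter> cell_box N z))"
      by (rule emeasure_split_cells[OF Xm]) auto
    also have "(\<Sum>z\<in>cells N. emeasure lebesgue (?X \<inter> cell_box N z)) = (\<Sum>z\<in>cells N. emeasure lebesgue (A \<inter> cell_box N (\<sigma> z)))"
    proof (intro sum.cong refl)
      fix z assume z: "z \<in> cells N"
      show "emeasure lebesgue (?X \<inter> cell_box N z) = emeasure lebesgue (A \<inter> cell_box N (\<sigma> z))"
        unfolding vimage_grid_map_box[OF z A(2)]
        using emeasure_lebesgue_affine[of 1 "corner N z - corner N (\<sigma> z)" "A \<inter> cell_box N (\<sigma> z)"] by (simp add: add.commute)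
    qed
    also have "\<dots> = (\<Sum>z\<in>cells N. emeasure lebesgue (A \<inter> cell_box N z))"
      by (rule sum.reindex_bij_betw[OF \<sigma>])
    also have "emeasure lebesgue (?X - ?U) + \<dots> = emeasure lebesgue A"
      unfolding rest by (rule emeasure_split_cells[OF A, symmetric])
    finally show ?thesis using Xm by simp
  qed
  show ?thesis unfolding measure_preserving_def
  proof (intro conjI ballI measurableI)
    fix x assume "x \<in> space (lebesgue_on unit_square)"
    then show "?g x \<in> space (lebesgue_on unit_square)" using grid_map_unit_square by simp
  next
    fix A assume "A \<in> sets (lebesgue_on unit_square)"
    then have A: "A \<in> sets lebesgue" "A \<subseteq> unit_square" using sets_restrict_space_iff[OF Q] by auto
    show "?g -` A \<inter> space (lebesgue_on unit_square) \<in> sets (lebesgue_on unit_square)"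
      using key[OF A] sets_restrict_space_iff[OF Q] by simp
    show "emeasure (lebesgue_on unit_square) (?g -` A \<inter> space (lebesgue_on unit_square)) = emeasure (lebesgue_on unit_square) A"
      using key[OF A] A by (simp add: emeasure_restrict_space del: emeasure_completion)
  qed
qed

end

lemma grid_map_inverse:
  assumes N: "N > 0" and \<sigma>: "bij_betw \<sigma> (cells N) (cells N)"
    and inv: "\<And>z. z \<in> cells N \<Longrightarrow> \<sigma>' (\<sigma> z) = z" and x: "x \<in> unit_square"
  shows "grid_map N \<sigma>' (grid_map N \<sigma> x) = x"
proof (cases "cell N x \<in> cells N")
  case True
  have "\<sigma> (cell N x) \<in> cells N" using \<sigma> True by (auto simp: bij_betw_def)
  then have "grid_map N \<sigma>' (grid_map N \<sigma> x) = grid_map N \<sigma> x + (corner N (\<sigma>' (\<sigma> (cell N x))) - corner N (\<sigma> (cell N x)))"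
    unfolding grid_map_def[of N \<sigma>' "grid_map N \<sigma> x"] grid_map_box(2)[OF N \<sigma> x True] by simp
  also have "\<dots> = x" using True inv unfolding grid_map_def[of N \<sigma> x] by simp
  finally show ?thesis .
qed (simp add: grid_map_def)

lemma measure_preserving_cong:
  assumes "\<And>x. x \<in> space M \<Longrightarrow> f x = g x" "measure_preserving M M' f"
  shows "measure_preserving M M' g"
proof -
  have "f -` A \<inter> space M = g -` A \<inter> space M" for A using assms(1) by auto
  then show ?thesis using assms measurable_cong[of M f g M'] unfolding measure_preserving_def by simp
qed

lemma grid_map_mp_bijections:
  assumes N: "N > 0" and \<sigma>: "bij_betw \<sigma> (cells N) (cells N)"
  shows "grid_map N \<sigma> \<in> mp_bijections"
proof -
  define \<sigma>' where "\<sigma>' = inv_into (cells N) \<sigma>"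
  have \<sigma>': "bij_betw \<sigma>' (cells N) (cells N)" unfolding \<sigma>'_def by (rule bij_betw_inv_into[OF \<sigma>])
  have i1: "\<sigma>' (\<sigma> z) = z" and i2: "\<sigma> (\<sigma>' z) = z" if "z \<in> cells N" for z
    using bij_betw_inv_into_left[OF \<sigma> that] bij_betw_inv_into_right[OF \<sigma> that] unfolding \<sigma>'_def by auto
  have bij: "bij_betw (grid_map N \<sigma>) unit_square unit_square"
  proof (rule bij_betw_byWitness[where f' = "grid_map N \<sigma>'"])
    show "\<forall>x\<in>unit_square. grid_map N \<sigma>' (grid_map N \<sigma> x) = x" using grid_map_inverse[OF N \<sigma> i1] by blast
    show "\<forall>x\<in>unit_square. grid_map N \<sigma> (grid_map N \<sigma>' x) = x" using grid_map_inverse[OF N \<sigma>' i2] by blast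
    show "grid_map N \<sigma> ` unit_square \<subseteq> unit_square" using grid_map_unit_square[OF N \<sigma>] by blast
    show "grid_map N \<sigma>' ` unit_square \<subseteq> unit_square" using grid_map_unit_square[OF N \<sigma>'] by blast
  qed
  have "grid_map N \<sigma>' x = inv_into unit_square (grid_map N \<sigma>) x" if "x \<in> unit_square" for x
  proof (rule inv_into_f_eq[symmetric])
    show "inj_on (grid_map N \<sigma>) unit_square" using bij by (simp add: bij_betw_def)
    show "grid_map N \<sigma>' x \<in> unit_square" using grid_map_unit_square[OF N \<sigma>' that] .
    show "grid_map N \<sigma> (grid_map N \<sigma>' x) = x" using grid_map_inverse[OF N \<sigma>' i2 that] .
  qed
  then have "measure_preserving (lebesgue_on unit_square) (lebesgue_on unit_square) (inv_into unit_square (grid_map N \<sigma>))"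
    by (intro measure_preserving_cong[OF _ measure_preserving_grid_map[OF N \<sigma>']]) simp
  then show ?thesis unfolding mp_bijections_def
    using bij measure_preserving_grid_map[OF N \<sigma>] by simp
qed

lemma Shift_grid_map_le:
  assumes "0 \<le> s" "\<And>z. z \<in> cells N \<Longrightarrow> \<bar>real (fst z) / N - real (fst (\<sigma> z)) / N\<bar> \<le> s"
  shows "Shift (grid_map N \<sigma>) \<le> s"
  unfolding Shift_def
proof (rule cSUP_least)
  show "unit_square \<noteq> {}" unfolding unit_square_def by auto
  show "\<bar>fst x - fst (grid_map N \<sigma> x)\<bar> \<le> s" for x
    using assms(1) assms(2)[of "cell N x"] unfolding grid_map_def corner_def by auto
qed

lemma kcut_cong_AE:
  assumes [measurable]: "D \<in> borel_measurable borel" "D' \<in> borel_measurable borel"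
    and AE: "AE x in sq2. D x = D' x" and cut: "sq.kcut D c"
  shows "sq.kcut D' c"
  unfolding sq.kcut_def
proof (intro ballI impI)
  fix f g :: "point \<Rightarrow> real"
  assume m: "f \<in> borel_measurable sq" "g \<in> borel_measurable sq" and b: "\<forall>x. 0 \<le> f x \<and> f x \<le> 1" "\<forall>x. 0 \<le> g x \<and> g x \<le> 1"
  have [measurable]: "f \<in> borel_measurable borel" "g \<in> borel_measurable borel" using m by (auto cong: measurable_cong_sets)
  have "(\<integral>p. f (fst p) * g (snd p) * D' p \<partial>sq2) = (\<integral>p. f (fst p) * g (snd p) * D p \<partial>sq2)"
  proof (rule integral_cong_AE)
    show "AE p in sq2. f (fst p) * g (snd p) * D' p = f (fst p) * g (snd p) * D p"
      using AE by eventually_elim simp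
  qed (unfold borel_measurable_pair_sq_iff, measurable)
  then show "\<bar>\<integral>p. f (fst p) * g (snd p) * D' p \<partial>sq2\<bar> \<le> c"
    using sq.kcutD[OF cut m] b by simp
qed

text \<open>Only the averages of the test functions over the cells matter.\<close>

lemma kcut_grid:
  assumes N: "N > 0" and cut: "cut_le (cells N) \<Delta> (c * real (N * N) ^ 2)"
  shows "sq.kcut (\<lambda>x. \<Delta> (cell N (fst x)) (cell N (snd x))) c"
  unfolding sq.kcut_def
proof (intro ballI impI)
  fix f g :: "point \<Rightarrow> real"
  assume m: "f \<in> borel_measurable sq" "g \<in> borel_measurable sq" and b: "\<forall>x. 0 \<le> f x \<and> f x \<le> 1" "\<forall>x. 0 \<le> g x \<and> g x \<le> 1"
  have [measurable]: "f \<in> borel_measurable borel" "g \<in> borel_measurable borel" using m by (auto cong: measurable_cong_sets)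
  let ?n = "real (N * N)"
  have n: "?n > 0" using N by simp
  then have n2: "?n ^ 2 > 0" by (rule zero_less_power)
  define avg where "avg h z = ?n * (\<integral>x. h x * indicator (cell N -` {z}) x \<partial>sq)" for h :: "point \<Rightarrow> real" and z
  have hint: "integrable sq (\<lambda>x. h x * indicator (cell N -` {z}) x)"
    if "h \<in> borel_measurable sq" "\<forall>x. 0 \<le> h x \<and> h x \<le> 1" for h :: "point \<Rightarrow> real" and z
  proof (rule sq.integrable_const_bound[of _ 1])
    show "(\<lambda>x. h x * indicator (cell N -` {z}) x) \<in> borel_measurable sq"
      by (intro borel_measurable_times that(1) borel_measurable_indicator) (simp add: cell_vimage_borel)
  qed (use that(2) in \<open>auto simp: indicator_def\<close>)
  have avg: "0 \<le> avg h z \<and> avg h z \<le> 1"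
    if h: "h \<in> borel_measurable sq" "\<forall>x. 0 \<le> h x \<and> h x \<le> 1" and z: "z \<in> cells N" for h :: "point \<Rightarrow> real" and z
  proof -
    have "(\<integral>x. h x * indicator (cell N -` {z}) x \<partial>sq) \<le> (\<integral>x. indicator (cell N -` {z}) x \<partial>sq)"
      using h hint[OF h] by (intro integral_mono integrable_real_indicator) (auto simp: indicator_def sq.emeasure_eq_measure)
    also have "\<dots> = 1 / ?n" using measure_cell[OF N z] by simp
    finally have "avg h z \<le> ?n * (1 / ?n)" unfolding avg_def using n by (intro mult_left_mono) auto
    moreover have "0 \<le> avg h z" unfolding avg_def using h n by (intro mult_nonneg_nonneg Bochner_Integration.integral_nonneg) auto
    ultimately show ?thesis using N by simp
  qed
  define J where "J z z' p = (f (fst p) * indicator (cell N -` {z}) (fst p)) * (g (snd p) * indicator (cell N -` {z'}) (snd p))"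
    for z z' and p :: "point \<times> point"
  have Jint: "integrable sq2 (J z z')" and Jval: "(\<integral>p. J z z' p \<partial>sq2) = avg f z * avg g z' / ?n ^ 2" for z z'
  proof -
    have m1: "(\<lambda>x. f x * indicator (cell N -` {z}) x) \<in> borel_measurable sq" "(\<lambda>x. g x * indicator (cell N -` {z'}) x) \<in> borel_measurable sq"
      using hint[OF m(1) b(1)] hint[OF m(2) b(2)] by auto
    have "integrable sq2 (\<lambda>p. (f (fst p) * indicator (cell N -` {z}) (fst p)) * (g (snd p) * indicator (cell N -` {z'}) (snd p)) * 1)"
      by (rule sq.integrable_test[OF m1]) (use b in \<open>auto simp: indicator_def\<close>)
    then show i: "integrable sq2 (J z z')" unfolding J_def[abs_def] by simp
    have "integrable sq2 (\<lambda>(x, y). (f x * indicator (cell N -` {z}) x) * (g y * indicator (cell N -` {z'}) y))"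
      using i unfolding J_def[abs_def] by (simp add: case_prod_unfold)
    from sq.pair.integral_fst[OF this]
    have "(\<integral>p. J z z' p \<partial>sq2) = (\<integral>x. (\<integral>y. (f x * indicator (cell N -` {z}) x) * (g y * indicator (cell N -` {z'}) y) \<partial>sq) \<partial>sq)"
      unfolding J_def by (simp add: case_prod_unfold)
    also have "\<dots> = (\<integral>x. f x * indicator (cell N -` {z}) x \<partial>sq) * (\<integral>y. g y * indicator (cell N -` {z'}) y \<partial>sq)"
      by simp
    also have "\<dots> = avg f z * avg g z' / ?n ^ 2" unfolding avg_def using N by (simp add: power2_eq_square)
    finally show "(\<integral>p. J z z' p \<partial>sq2) = avg f z * avg g z' / ?n ^ 2" .
  qed
  have "(\<integral>p. f (fst p) * g (snd p) * \<Delta> (cell N (fst p)) (cell N (snd p)) \<partial>sq2) =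
    (\<integral>p. (\<Sum>z\<in>cells N. \<Sum>z'\<in>cells N. J z z' p * \<Delta> z z') \<partial>sq2)"
  proof (rule integral_cong_AE)
    have "(\<lambda>x. \<Delta> (cell N (fst x)) (cell N (snd x))) \<in> borel_measurable borel" by (rule grid_kernel_measurable)
    then show "(\<lambda>p. f (fst p) * g (snd p) * \<Delta> (cell N (fst p)) (cell N (snd p))) \<in> borel_measurable sq2"
      unfolding borel_measurable_pair_sq_iff by measurable
    show "(\<lambda>p. \<Sum>z\<in>cells N. \<Sum>z'\<in>cells N. J z z' p * \<Delta> z z') \<in> borel_measurable sq2"
      using Jint by (intro borel_measurable_sum borel_measurable_times) auto
    show "AE p in sq2. f (fst p) * g (snd p) * \<Delta> (cell N (fst p)) (cell N (snd p)) =
        (\<Sum>z\<in>cells N. \<Sum>z'\<in>cells N. J z z' p * \<Delta> z z')"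
      using sq.AE_fst[OF AE_cell[OF N]] sq.AE_snd[OF AE_cell[OF N]]
    proof eventually_elim
      case (elim p)
      have "(\<Sum>z\<in>cells N. \<Sum>z'\<in>cells N. J z z' p * \<Delta> z z') =
        (\<Sum>z\<in>cells N. (\<Sum>z'\<in>cells N. (f (fst p) * g (snd p) * \<Delta> z z') * indicator (cell N -` {z'}) (snd p)) * indicator (cell N -` {z}) (fst p))"
        unfolding J_def by (simp add: sum_distrib_left sum_distrib_right mult_ac)
      also have "\<dots> = f (fst p) * g (snd p) * \<Delta> (cell N (fst p)) (cell N (snd p))"
        unfolding sum_indicator_cells[OF elim(2)] by (rule sum_indicator_cells[OF elim(1)])
      finally show ?case ..
    qed
  qed
  also have "\<dots> = (\<Sum>z\<in>cells N. \<Sum>z'\<in>cells N. (\<integral>p. J z z' p \<partial>sq2) * \<Delta> z z')"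
    using Jint by (simp add: Bochner_Integration.integral_sum)
  also have "\<dots> = (\<Sum>z\<in>cells N. \<Sum>z'\<in>cells N. avg f z * avg g z' * \<Delta> z z') / ?n ^ 2"
    unfolding Jval by (simp add: sum_divide_distrib)
  finally have eq: "(\<integral>p. f (fst p) * g (snd p) * \<Delta> (cell N (fst p)) (cell N (snd p)) \<partial>sq2) =
    (\<Sum>z\<in>cells N. \<Sum>z'\<in>cells N. avg f z * avg g z' * \<Delta> z z') / ?n ^ 2" .
  have "\<bar>\<Sum>z\<in>cells N. \<Sum>z'\<in>cells N. avg f z * avg g z' * \<Delta> z z'\<bar> \<le> c * ?n ^ 2"
    using avg[OF m(1) b(1)] avg[OF m(2) b(2)] by (rule cut_leD[OF cut])
  then show "\<bar>\<integral>p. f (fst p) * g (snd p) * \<Delta> (cell N (fst p)) (cell N (snd p)) \<partial>sq2\<bar> \<le> c"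
    unfolding eq abs_divide abs_of_pos[OF n2] pos_divide_le_eq[OF n2] .
qed

section \<open>Convergence in the cut-shift distance and of densities\<close>

lemma orderon_borel_version:
  assumes "orderon W"
  obtains W' where "W' \<in> borel_measurable borel" "\<And>p. 0 \<le> W' p \<and> W' p \<le> 1" "AE p in sq2. W p = W' p"
proof -
  have "\<exists>V'\<in>borel_measurable borel. (\<forall>p. 0 \<le> V' p \<and> V' p \<le> (1::real)) \<and> (AE p in sq2. W p = V' p)"
    using assms unfolding orderon_def by (intro ex_borel_version) auto
  then show thesis using that by blast
qed

lemma cut_norm_pull_nonneg:
  assumes W: "orderon W" and U: "orderon U" and f: "f \<in> mp_bijections"
  shows "0 \<le> cut_norm (\<lambda>p. W p - pull U f p)"
proof -
  obtain W' where W'[measurable]: "W' \<in> borel_measurable borel" and W'1: "\<And>p. 0 \<le> W' p \<and> W' p \<le> 1"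
    and WW': "AE p in sq2. W p = W' p" by (rule orderon_borel_version[OF W]) blast
  obtain U' where U'[measurable]: "U' \<in> borel_measurable borel" and U'1: "\<And>p. 0 \<le> U' p \<and> U' p \<le> 1"
    and UU': "AE p in sq2. U p = U' p" by (rule orderon_borel_version[OF U]) blast
  obtain f' where f'[measurable]: "f' \<in> borel_measurable borel" and distr: "distr sq sq f' = sq"
    and ff': "AE x in sq. f x = f' x" using ex_borel_map_version[OF f] by blast
  have T[measurable]: "(\<lambda>x. (f' (fst x), f' (snd x))) \<in> borel_measurable (borel :: (point \<times> point) measure)"
    by (intro borel_measurable_Pair) measurable
  show ?thesis
  proof (rule cut_norm_nonneg[where V' = "\<lambda>x. W' x - U' (f' (fst x), f' (snd x))"])
    show "(\<lambda>x. W' x - U' (f' (fst x), f' (snd x))) \<in> borel_measurable borel"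
      by (intro borel_measurable_diff W' measurable_compose[OF T U'])
    show "\<bar>W' p - U' (f' (fst p), f' (snd p))\<bar> \<le> 1" for p
      using W'1[of p] U'1[of "(f' (fst p), f' (snd p))"] by (simp add: abs_le_iff)
    show "AE p in sq2. W p - pull U f p = W' p - U' (f' (fst p), f' (snd p))"
      using WW' AE_pull[OF f' distr ff' UU'] by eventually_elim simp
  qed
qed

lemma bdd_below_cut_shift:
  assumes "orderon W" "orderon U"
  shows "bdd_below ((\<lambda>f. Shift f + cut_norm (\<lambda>p. W p - pull U f p)) ` mp_bijections)"
proof (rule bdd_belowI[of _ 0])
  fix y assume "y \<in> (\<lambda>f. Shift f + cut_norm (\<lambda>p. W p - pull U f p)) ` mp_bijections"
  then obtain f where y: "y = Shift f + cut_norm (\<lambda>p. W p - pull U f p)" and f: "f \<in> mp_bijections" by (rule imageE)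
  show "0 \<le> y" unfolding y by (intro add_nonneg_nonneg Shift_nonneg[OF f] cut_norm_pull_nonneg[OF assms f])
qed

lemma cut_shift_dist_le:
  assumes "orderon W" "orderon U" "f \<in> mp_bijections"
  shows "cut_shift_dist W U \<le> Shift f + cut_norm (\<lambda>p. W p - pull U f p)"
  unfolding cut_shift_dist_def by (rule cINF_lower[OF bdd_below_cut_shift[OF assms(1,2)] assms(3)])

lemma cut_shift_dist_less_witness:
  assumes "orderon W" "orderon U" "cut_shift_dist W U < d"
  obtains f where "f \<in> mp_bijections" "Shift f < d" "cut_norm (\<lambda>p. W p - pull U f p) < d"
proof -
  have "\<exists>f\<in>mp_bijections. Shift f + cut_norm (\<lambda>p. W p - pull U f p) < d"
    using assms(3) cINF_less_iff[OF _ bdd_below_cut_shift[OF assms(1,2)], of d] id_mp_bijections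
    unfolding cut_shift_dist_def by blast
  then obtain f where f: "f \<in> mp_bijections" "Shift f + cut_norm (\<lambda>p. W p - pull U f p) < d" by blast
  then show thesis using that[OF f(1)] Shift_nonneg[OF f(1)] cut_norm_pull_nonneg[OF assms(1,2) f(1)] by linarith
qed

text \<open>The difference is split at the two grid kernels; the middle part is controlled by the finite cut-norm,
  the outer parts by the approximation errors, one of them after the substitution.\<close>

lemma cut_shift_dist_grid_le:
  assumes W: "orderon W" and W'[measurable]: "W' \<in> borel_measurable borel" and W'1: "\<And>p. 0 \<le> W' p \<and> W' p \<le> 1"
    and WW': "AE p in sq2. W p = W' p"
    and U: "orderon U" and U'[measurable]: "U' \<in> borel_measurable borel" and U'1: "\<And>p. 0 \<le> U' p \<and> U' p \<le> 1"
    and UU': "AE p in sq2. U p = U' p"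
    and w: "\<And>z z'. 0 \<le> w z z' \<and> w z z' \<le> 1" and u: "\<And>z z'. 0 \<le> u z z' \<and> u z z' \<le> 1" and N: "N > 0"
    and Ww: "(\<integral>x. \<bar>W' x - w (cell N (fst x)) (cell N (snd x))\<bar> \<partial>sq2) \<le> \<eta>"
    and Uu: "(\<integral>x. \<bar>U' x - u (cell N (fst x)) (cell N (snd x))\<bar> \<partial>sq2) \<le> \<eta>"
    and \<sigma>: "bij_betw \<sigma> (cells N) (cells N)" and e: "0 \<le> \<epsilon>"
    and shift: "\<And>z. z \<in> cells N \<Longrightarrow> \<bar>real (fst z) / N - real (fst (\<sigma> z)) / N\<bar> \<le> \<epsilon>"
    and cut: "cut_le (cells N) (\<lambda>z z'. w z z' - u (\<sigma> z) (\<sigma> z')) (\<epsilon> * real (N * N) ^ 2)"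
  shows "cut_shift_dist W U \<le> 2 * \<epsilon> + 2 * \<eta>"
proof -
  let ?f = "grid_map N \<sigma>"
  have f: "?f \<in> mp_bijections" by (rule grid_map_mp_bijections[OF N \<sigma>])
  obtain f' where f'[measurable]: "f' \<in> borel_measurable borel" and distr: "distr sq sq f' = sq"
    and ff': "AE x in sq. ?f x = f' x" using ex_borel_map_version[OF f] by blast
  define T where "T x = (f' (fst x), f' (snd x))" for x :: "point \<times> point"
  have T[measurable]: "T \<in> borel_measurable borel" unfolding T_def by (intro borel_measurable_Pair) measurable
  define w' where "w' x = w (cell N (fst x)) (cell N (snd x))" for x
  define u' where "u' x = u (cell N (fst x)) (cell N (snd x))" for x
  define d where "d x = w (cell N (fst x)) (cell N (snd x)) - u (\<sigma> (cell N (fst x))) (\<sigma> (cell N (snd x)))" for x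
  have w'm[measurable]: "w' \<in> borel_measurable borel" unfolding w'_def[abs_def] by (rule grid_kernel_measurable)
  have u'm[measurable]: "u' \<in> borel_measurable borel" unfolding u'_def[abs_def] by (rule grid_kernel_measurable)
  have dm[measurable]: "d \<in> borel_measurable borel"
    unfolding d_def[abs_def] by (rule grid_kernel_measurable[of "\<lambda>z z'. w z z' - u (\<sigma> z) (\<sigma> z')"])
  have w'1: "0 \<le> w' x \<and> w' x \<le> 1" and u'1: "0 \<le> u' x \<and> u' x \<le> 1" for x
    unfolding w'_def u'_def using w u by auto
  have UT[measurable]: "(\<lambda>x. U' (T x)) \<in> borel_measurable borel" "(\<lambda>x. u' (T x)) \<in> borel_measurable borel"
    by (rule measurable_compose[OF T U'] measurable_compose[OF T u'm])+
  have i1: "integrable sq2 (\<lambda>x. W' x - w' x)" by (rule integrable_difference[OF W' w'm W'1 w'1])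
  have i2: "integrable sq2 (\<lambda>x. w' x - u' (T x))" by (rule integrable_difference[OF w'm UT(2) w'1 u'1])
  have i3: "integrable sq2 (\<lambda>x. u' (T x) - U' (T x))" by (rule integrable_difference[OF UT(2,1) u'1 U'1])
  have c1: "sq.kcut (\<lambda>x. W' x - w' x) \<eta>" using Ww unfolding w'_def[symmetric] by (intro sq.kcut_L1 i1)
  have "(\<integral>x. \<bar>u' (T x) - U' (T x)\<bar> \<partial>sq2) = (\<integral>x. \<bar>u' x - U' x\<bar> \<partial>distr sq2 sq2 (\<lambda>(x, y). (f' x, f' y)))"
    by (subst integral_distr[OF map_pair_measurable[OF f']]) (unfold borel_measurable_pair_sq_iff T_def case_prod_unfold, measurable)
  also have "\<dots> = (\<integral>x. \<bar>U' x - u' x\<bar> \<partial>sq2)"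
    unfolding distr_pair_map[OF f' distr] by (simp add: abs_minus_commute)
  finally have c3: "sq.kcut (\<lambda>x. u' (T x) - U' (T x)) \<eta>"
    using Uu unfolding u'_def[symmetric] by (intro sq.kcut_L1 i3) simp
  have cell_T: "AE x in sq. cell N (f' x) = \<sigma> (cell N x)"
  proof -
    have "AE x in sq. x \<in> unit_square" unfolding AE_sq_iff by simp
    with ff' AE_cell[OF N] show ?thesis
    proof eventually_elim
      case (elim x)
      then show ?case using grid_map_box(2)[OF N \<sigma>, of x] by simp
    qed
  qed
  have c2: "sq.kcut (\<lambda>x. w' x - u' (T x)) \<epsilon>"
  proof (rule kcut_cong_AE[OF dm])
    show "(\<lambda>x. w' x - u' (T x)) \<in> borel_measurable borel" by (intro borel_measurable_diff w'm UT)
    show "AE x in sq2. d x = w' x - u' (T x)"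
      using sq.AE_fst[OF cell_T] sq.AE_snd[OF cell_T]
      by eventually_elim (simp add: d_def w'_def u'_def T_def)
    show "sq.kcut d \<epsilon>" unfolding d_def[abs_def] by (rule kcut_grid[OF N cut])
  qed
  have sum: "sq.kcut (\<lambda>x. (W' x - w' x) + (w' x - u' (T x)) + (u' (T x) - U' (T x))) (\<eta> + \<epsilon> + \<eta>)"
    by (rule sq.kcut_add[OF sq.kcut_add[OF c1 c2 i1 i2] c3 Bochner_Integration.integrable_add[OF i1 i2] i3])
  have "sq.kcut (\<lambda>x. W' x - U' (T x)) (\<eta> + \<epsilon> + \<eta>)" using sum by simp
  then have "cut_norm (\<lambda>p. W p - pull U ?f p) \<le> \<eta> + \<epsilon> + \<eta>"
  proof (rule cut_norm_le_if_kcut[rotated -1])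
    show "(\<lambda>x. W' x - U' (T x)) \<in> borel_measurable borel" by (intro borel_measurable_diff W' UT)
    show "\<bar>W' p - U' (T p)\<bar> \<le> 1" for p using W'1[of p] U'1[of "T p"] by (simp add: abs_le_iff)
    show "AE p in sq2. W p - pull U ?f p = W' p - U' (T p)"
      using WW' AE_pull[OF f' distr ff' UU'] unfolding T_def by eventually_elim simp
  qed
  moreover have "Shift ?f \<le> \<epsilon>" using shift by (rule Shift_grid_map_le[OF e])
  ultimately show ?thesis using cut_shift_dist_le[OF W U f] by linarith
qed

text \<open>If all densities on \<open>k\<close> vertices nearly agree, then so do the densities of grid approximations,
  and the finite theorem provides the rearrangement.\<close>

lemma close_densities_imp_close:
  assumes e: "\<epsilon> > 0"
  obtains k \<delta> where "\<delta> > 0"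
    "\<And>W U. orderon W \<Longrightarrow> orderon U \<Longrightarrow>
      (\<And>E. simple_ordered_graph (k, E) \<Longrightarrow> \<bar>graph_density (k, E) W - graph_density (k, E) U\<bar> \<le> \<delta>) \<Longrightarrow>
      cut_shift_dist W U < \<epsilon>"
proof -
  have e8: "\<epsilon> / 8 > 0" using e by simp
  obtain k :: nat where k: "k > 0" and main:
    "\<And>N' w w'. N' \<ge> 4 * k \<Longrightarrow>
       (\<And>u v. w u v = w v u \<and> 0 \<le> w u v \<and> w u v \<le> 1) \<Longrightarrow> (\<And>u v. w' u v = w' v u \<and> 0 \<le> w' u v \<and> w' u v \<le> 1) \<Longrightarrow>
       (\<Sum>E\<in>Pow (pairs k). \<bar>grid_density k (k * N') w E - grid_density k (k * N') w' E\<bar>) \<le> 1 / 8 \<Longrightarrow>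
       \<exists>\<sigma>. bij_betw \<sigma> (cells (k * N')) (cells (k * N')) \<and>
         (\<forall>z\<in>cells (k * N'). \<bar>real (fst z) / (k * N') - real (fst (\<sigma> z)) / (k * N')\<bar> \<le> \<epsilon> / 8) \<and>
         cut_le (cells (k * N')) (\<lambda>z z'. w z z' - w' (\<sigma> z) (\<sigma> z')) (\<epsilon> / 8 * real (k * N' * (k * N')) ^ 2)"
    by (rule grid_inverse_counting[OF e8]) blast
  \<comment> \<open>The total discrepancy \<open>1 / 8\<close> is shared by the \<open>G\<close> graphs: each share \<open>1 / (8 * G)\<close> consists of
    \<open>\<delta>\<close> and of \<open>1 / (32 * G)\<close> for either grid approximation.\<close>
  define G where "G = real (card (Pow (pairs k)))"
  have G: "G > 0" unfolding G_def by (simp add: card_Pow)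
  define \<delta> where "\<delta> = 1 / (16 * G)"
  define C where "C = fact k * (real (card (vertex_pairs k)) + 1)"
  have C: "C > 0" unfolding C_def by simp
  define \<eta> where "\<eta> = min (\<epsilon> / 8) (1 / (64 * G * C))"
  have eta: "\<eta> > 0" using e G C unfolding \<eta>_def by simp
  have etaC: "C * (2 * \<eta>) \<le> 1 / (32 * G)"
  proof -
    have "C * (2 * \<eta>) \<le> C * (2 * (1 / (64 * G * C)))" using C unfolding \<eta>_def by (intro mult_left_mono) auto
    also have "\<dots> = 1 / (32 * G)" using C by simp
    finally show ?thesis .
  qed
  show thesis
  proof (rule that[of \<delta> k])
    show "\<delta> > 0" unfolding \<delta>_def using G by simp
    fix W U assume W: "orderon W" and U: "orderon U" and
      close: "\<And>E. simple_ordered_graph (k, E) \<Longrightarrow> \<bar>graph_density (k, E) W - graph_density (k, E) U\<bar> \<le> \<delta>"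
    obtain W' where W': "W' \<in> borel_measurable borel" "\<And>p. 0 \<le> W' p \<and> W' p \<le> 1" "AE p in sq2. W p = W' p"
      by (rule orderon_borel_version[OF W]) blast
    obtain U' where U': "U' \<in> borel_measurable borel" "\<And>p. 0 \<le> U' p \<and> U' p \<le> 1" "AE p in sq2. U p = U' p"
      by (rule orderon_borel_version[OF U]) blast
    obtain N1 where N1: "\<And>N. N \<ge> N1 \<Longrightarrow> \<exists>w. (\<forall>z z'. w z z' = w z' z \<and> 0 \<le> w z z' \<and> w z z' \<le> 1) \<and>
      (\<integral>x. \<bar>W' x - w (cell N (fst x)) (cell N (snd x))\<bar> \<partial>sq2) \<le> \<eta>"
      using ex_grid_approximation[OF W W' eta] by blast
    obtain N2 where N2: "\<And>N. N \<ge> N2 \<Longrightarrow> \<exists>w. (\<forall>z z'. w z z' = w z' z \<and> 0 \<le> w z z' \<and> w z z' \<le> 1) \<and>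
      (\<integral>x. \<bar>U' x - w (cell N (fst x)) (cell N (snd x))\<bar> \<partial>sq2) \<le> \<eta>"
      using ex_grid_approximation[OF U U' eta] by blast
    obtain N3 :: nat where N3: "2 / \<eta> < N3" using reals_Archimedean2 by blast
    define N' where "N' = 4 * k + N1 + N2 + N3"
    define N where "N = k * N'"
    have NN': "N \<ge> N'" using k unfolding N_def by simp
    then have N: "N \<ge> N1" "N \<ge> N2" "N > 0" using k unfolding N'_def by auto
    have "real N3 \<le> real N" using NN' unfolding N'_def by simp
    then have "2 / \<eta> \<le> N" using N3 by linarith
    then have N\<eta>: "2 / N \<le> \<eta>" using eta N(3) by (simp add: field_simps)
    obtain w where w: "\<And>z z'. w z z' = w z' z \<and> 0 \<le> w z z' \<and> w z z' \<le> 1"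
      and Ww: "(\<integral>x. \<bar>W' x - w (cell N (fst x)) (cell N (snd x))\<bar> \<partial>sq2) \<le> \<eta>" using N1[OF N(1)] by blast
    obtain u where u: "\<And>z z'. u z z' = u z' z \<and> 0 \<le> u z z' \<and> u z z' \<le> 1"
      and Uu: "(\<integral>x. \<bar>U' x - u (cell N (fst x)) (cell N (snd x))\<bar> \<partial>sq2) \<le> \<eta>" using N2[OF N(2)] by blast
    have w01: "0 \<le> w z z' \<and> w z z' \<le> 1" and u01: "0 \<le> u z z' \<and> u z z' \<le> 1" for z z' using w u by auto
    have bound: "fact k * (real (card (vertex_pairs k)) * (\<eta> + 2 / N)) \<le> 1 / (32 * G)"
    proof -
      have "fact k * (real (card (vertex_pairs k)) * (\<eta> + 2 / N)) \<le> fact k * ((real (card (vertex_pairs k)) + 1) * (2 * \<eta>))"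
        using N\<eta> eta by (intro mult_left_mono mult_mono) auto
      also have "\<dots> = C * (2 * \<eta>)" unfolding C_def by simp
      finally show ?thesis using etaC by linarith
    qed
    have "(\<Sum>F\<in>Pow (pairs k). \<bar>grid_density k N w F - grid_density k N u F\<bar>) \<le> (\<Sum>F\<in>Pow (pairs k). 1 / (8 * G))"
    proof (rule sum_mono)
      fix F assume F: "F \<in> Pow (pairs k)"
      define E where "E = (\<lambda>(i, j). {Suc i, Suc j}) ` F"
      have simple: "simple_ordered_graph (k, E)"
        unfolding simple_ordered_graph_def E_def using F by (auto simp: pairs_def card_insert_if)
      have "shifted_edges k E = F"
      proof (intro set_eqI iffI)
        fix p assume "p \<in> shifted_edges k E"
        then obtain i j i' j' where p: "p = (i, j)" "i < j" and q: "(i', j') \<in> F" "{Suc i, Suc j} = {Suc i', Suc j'}"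
          unfolding shifted_edges_def E_def pairs_def by auto
        have "i' < j'" using F q(1) unfolding pairs_def by auto
        then show "p \<in> F" using p q by (auto simp: doubleton_eq_iff)
      qed (use F in \<open>auto simp: shifted_edges_def E_def\<close>)
      then have "\<bar>graph_density (k, E) W - grid_density k N w F\<bar> \<le> 1 / (32 * G)"
        "\<bar>graph_density (k, E) U - grid_density k N u F\<bar> \<le> 1 / (32 * G)"
        using graph_density_approx_grid[OF W' w01 N(3) Ww, of k E] graph_density_approx_grid[OF U' u01 N(3) Uu, of k E] bound
        by simp_all
      moreover have "\<bar>graph_density (k, E) W - graph_density (k, E) U\<bar> \<le> 1 / (16 * G)"
        using close[OF simple] unfolding \<delta>_def .
      moreover have "1 / (32 * G) + 1 / (32 * G) + 1 / (16 * G) = 1 / (8 * G)" using G by (simp add: field_simps)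
      ultimately show "\<bar>grid_density k N w F - grid_density k N u F\<bar> \<le> 1 / (8 * G)" by linarith
    qed
    also have "\<dots> = 1 / 8" unfolding sum_constant G_def[symmetric] using G by simp
    finally have sum: "(\<Sum>F\<in>Pow (pairs k). \<bar>grid_density k N w F - grid_density k N u F\<bar>) \<le> 1 / 8" .
    have "N' \<ge> 4 * k" unfolding N'_def by simp
    from main[OF this w u sum[unfolded N_def]]
    obtain \<sigma> where \<sigma>: "bij_betw \<sigma> (cells N) (cells N)"
      "\<forall>z\<in>cells N. \<bar>real (fst z) / N - real (fst (\<sigma> z)) / N\<bar> \<le> \<epsilon> / 8"
      "cut_le (cells N) (\<lambda>z z'. w z z' - u (\<sigma> z) (\<sigma> z')) (\<epsilon> / 8 * real (N * N) ^ 2)"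
      unfolding N_def[symmetric] by (auto simp: N_def)
    have "cut_shift_dist W U \<le> 2 * (\<epsilon> / 8) + 2 * \<eta>"
      using cut_shift_dist_grid_le[OF W W' U U' w01 u01 N(3) Ww Uu \<sigma>(1) _ _ \<sigma>(3)] \<sigma>(2) e by simp
    also have "\<dots> \<le> 2 * (\<epsilon> / 8) + 2 * (\<epsilon> / 8)" unfolding \<eta>_def by simp
    also have "\<dots> < \<epsilon>" using e by simp
    finally show "cut_shift_dist W U < \<epsilon>" .
  qed
qed

theorem theorem1p2:
  fixes W :: "nat \<Rightarrow> point \<times> point \<Rightarrow> real"
  assumes "\<And>n. orderon (W n)"
  shows "(\<forall>\<epsilon>>0. \<exists>N. \<forall>m\<ge>N. \<forall>n\<ge>N. cut_shift_dist (W m) (W n) < \<epsilon>) \<longleftrightarrow>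
         (\<forall>F. simple_ordered_graph F \<longrightarrow> convergent (\<lambda>n. graph_density F (W n)))"
proof
  assume cauchy: "\<forall>\<epsilon>>0. \<exists>N. \<forall>m\<ge>N. \<forall>n\<ge>N. cut_shift_dist (W m) (W n) < \<epsilon>"
  show "\<forall>F. simple_ordered_graph F \<longrightarrow> convergent (\<lambda>n. graph_density F (W n))"
  proof (intro allI impI)
    fix F :: ordered_graph
    obtain k E where F: "F = (k, E)" by (cases F)
    define C where "C = fact k * (real (card (vertex_pairs k)) + 1)"
    have C: "C > 0" unfolding C_def by simp
    have "Cauchy (\<lambda>n. graph_density F (W n))"
    proof (rule metric_CauchyI)
      fix e :: real assume e: "e > 0"
      obtain R :: nat where R: "4 * C / e < R" using reals_Archimedean2 by blast
      have "0 < 4 * C / e" using C e by simp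
      then have R0: "R > 0" using R by (cases "R = 0") auto
      have CR: "C * (2 / R) < e / 2"
      proof -
        have "4 * C < e * R" using R e by (simp add: field_simps)
        then show ?thesis using R0 by (simp add: field_simps)
      qed
      define d where "d = e / (2 * C * (real R + 5))"
      have d: "d > 0" using e C unfolding d_def by simp
      have Cd: "C * ((real R + 5) * d) = e / 2" 
      proof -
        have "a * (b * (e / (2 * a * b))) = e / 2" if "a > 0" "b > 0" for a b :: real
          using that by (simp add: field_simps)
        from this[OF C, of "real R + 5"] have "C * ((real R + 5) * (e / (2 * C * (real R + 5)))) = e / 2"
          by (simp only: add_nonneg_pos of_nat_0_le_iff zero_less_numeral)
        then show ?thesis unfolding d_def .
      qed
      obtain N where N: "\<And>m n. m \<ge> N \<Longrightarrow> n \<ge> N \<Longrightarrow> cut_shift_dist (W m) (W n) < d"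
        using cauchy d by blast
      show "\<exists>M. \<forall>m\<ge>M. \<forall>n\<ge>M. dist (graph_density F (W m)) (graph_density F (W n)) < e"
      proof (intro exI[of _ N] allI impI)
        fix m n assume mn: "m \<ge> N" "n \<ge> N"
        obtain f where f: "f \<in> mp_bijections" "Shift f < d" "cut_norm (\<lambda>p. W m p - pull (W n) f p) < d"
          by (rule cut_shift_dist_less_witness[OF assms assms N[OF mn]])
        let ?B = "(real R + 1) * cut_norm (\<lambda>p. W m p - pull (W n) f p) + 2 / R + 4 * Shift f"
        have B: "?B \<le> (real R + 1) * d + 2 / R + 4 * d"
          using f by (intro add_mono mult_left_mono) auto
        have "0 \<le> ?B" using Shift_nonneg[OF f(1)] cut_norm_pull_nonneg[OF assms assms f(1), of m n] by simp
        have "dist (graph_density F (W m)) (graph_density F (W n)) \<le> fact k * (real (card (vertex_pairs k)) * ?B)"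
          unfolding F dist_real_def by (rule density_continuity[OF assms assms f(1) R0])
        also have "\<dots> \<le> C * ?B"
          unfolding C_def mult.assoc using \<open>0 \<le> ?B\<close> by (intro mult_left_mono mult_right_mono) auto
        also have "\<dots> \<le> C * ((real R + 1) * d + 2 / R + 4 * d)" using B C by (intro mult_left_mono) auto
        also have "\<dots> = C * (2 / R) + C * ((real R + 5) * d)" by (simp add: algebra_simps)
        also have "\<dots> < e" using CR Cd by linarith
        finally show "dist (graph_density F (W m)) (graph_density F (W n)) < e" .
      qed
    qed
    then show "convergent (\<lambda>n. graph_density F (W n))" by (rule Cauchy_convergent)
  qed
next
  assume conv: "\<forall>F. simple_ordered_graph F \<longrightarrow> convergent (\<lambda>n. graph_density F (W n))"
  show "\<forall>\<epsilon>>0. \<exists>N. \<forall>m\<ge>N. \<forall>n\<ge>N. cut_shift_dist (W m) (W n) < \<epsilon>"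
  proof (intro allI impI)
    fix \<epsilon> :: real assume e: "\<epsilon> > 0"
    obtain k \<delta> where \<delta>: "\<delta> > 0" and close: "\<And>W U. orderon W \<Longrightarrow> orderon U \<Longrightarrow>
      (\<And>E. simple_ordered_graph (k, E) \<Longrightarrow> \<bar>graph_density (k, E) W - graph_density (k, E) U\<bar> \<le> \<delta>) \<Longrightarrow>
      cut_shift_dist W U < \<epsilon>"
      by (rule close_densities_imp_close[OF e]) blast
    let ?S = "{E. simple_ordered_graph (k, E)}"
    have fin: "finite ?S"
      by (rule finite_subset[of _ "Pow (Pow {1..k})"]) (auto simp: simple_ordered_graph_def)
    have "\<forall>E\<in>?S. \<exists>N. \<forall>m\<ge>N. \<forall>n\<ge>N. dist (graph_density (k, E) (W m)) (graph_density (k, E) (W n)) < \<delta>"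
    proof
      fix E assume "E \<in> ?S"
      then have "convergent (\<lambda>n. graph_density (k, E) (W n))" using conv by simp
      then have "Cauchy (\<lambda>n. graph_density (k, E) (W n))" by (rule convergent_Cauchy)
      then show "\<exists>N. \<forall>m\<ge>N. \<forall>n\<ge>N. dist (graph_density (k, E) (W m)) (graph_density (k, E) (W n)) < \<delta>"
        using \<delta> by (rule metric_CauchyD)
    qed
    then obtain N where N: "\<And>E m n. E \<in> ?S \<Longrightarrow> m \<ge> N E \<Longrightarrow> n \<ge> N E \<Longrightarrow>
        dist (graph_density (k, E) (W m)) (graph_density (k, E) (W n)) < \<delta>"
      by metis
    have le: "N E \<le> Max (N ` ?S)" if "E \<in> ?S" for E using fin that by (intro Max_ge) auto
    show "\<exists>N. \<forall>m\<ge>N. \<forall>n\<ge>N. cut_shift_dist (W m) (W n) < \<epsilon>"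
    proof (intro exI[of _ "Max (N ` ?S)"] allI impI close assms)
      fix m n E assume mn: "m \<ge> Max (N ` ?S)" "n \<ge> Max (N ` ?S)" and E: "simple_ordered_graph (k, E)"
      then have ES: "E \<in> ?S" by simp
      show "\<bar>graph_density (k, E) (W m) - graph_density (k, E) (W n)\<bar> \<le> \<delta>"
        using N[OF ES order_trans[OF le[OF ES] mn(1)] order_trans[OF le[OF ES] mn(2)]] by (simp add: dist_real_def)
    qed
  qed
qed

end
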